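(* Let $(G,g)$ be a solvable and simply connected Lie group of dimension $3$ with a left-invariant Riemannian metric $g$, and let $\mathfrak g$ be its Lie algebra, with the inner product also denoted $g$. Then the conformal Lie group $(G,[g])$ admits a left-invariant Weyl-Einstein structure if and only if $(\mathfrak g,g)$ is (isometrically isomorphic, i.e. isomorphic as a metric Lie algebra, to) one of the following metric Lie algebras: \begin{enumerate} \item $(\mathbb R^3,g_\bullet)$; \item $(\mathbb R\ltimes_{\mathrm{Id}}\mathbb R^2,g_{\nu})$, for any $\nu>0$; \item $(\mathfrak{so}(2)\ltimes \mathbb R^2,g_{1,\nu})$, for any $\nu>0$; \item $(\mathfrak g_t,h_{t,\nu})$, for $t>1$ and any $\nu>0$; \item $(\mathfrak g_0,m_\nu)$, for any $\nu>0$. \end{enumerate}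
   Context: Notation for the metric Lie algebras. $(\mathbb R^3,g_\bullet)$ is the abelian Lie algebra with the standard inner product. The other Lie algebras have a basis $\{x,y,z\}$ with brackets: - $\mathbb R\ltimes_{\mathrm{Id}}\mathbb R^2$: $[x,y]=0$, $[z,x]=x$, $[z,y]=y$; - $\mathfrak{so}(2)\ltimes\mathbb R^2$: $[x,y]=0$, $[z,x]=-y$, $[z,y]=x$; - $\mathfrak g_t$ ($t\in\mathbb R$): $[x,y]=0$, $[z,x]=y$, $[z,y]=-tx+2y$. With $\{x^*,y^*,z^*\}$ the dual basis and $\xi\odot\zeta:=\frac12(\xi\otimes\zeta+\zeta\otimes\xi)$, set $g_\nu= x^*\odot x^*+y^*\odot y^*+\nu\, z^*\odot z^*$, $g_{\mu,\nu}= x^*\odot x^*+\mu\, y^*\odot y^*+\nu\, z^*\odot z^*$, $h_{\mu,\nu}= x^*\odot x^*+2x^*\odot y^*+\mu\, y^*\odot y^*+\nu\, z^*\odot z^*$, $m_\nu= x^*\odot x^*+x^*\odot y^*+y^*\odot y^*+\nu\, z^*\odot z^*$. A Weyl structure on a conformal manifold $(M,c)$ is a torsion-free linear connection $\nabla$ on $M$ preserving $c$; equivalently, for each metric $g\in c$ there is a 1-form $\theta$ on $M$ (the Lee form of $\nabla$ with respect to $g$) with $\nabla g=-2\theta\otimes g$. One then has $\nabla_XY=\nabla^g_XY+\theta(X)Y+\theta(Y)X-g(X,Y)T$, where $\nabla^g$ is the Levi-Civita connection of $g$ and $T$ is the $g$-dual vector field of $\theta$; conversely any 1-form $\theta$ defines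 a Weyl structure by this formula. A Weyl structure on a Lie group with a conformal class $c$ containing a left-invariant metric is left-invariant if its Lee form with respect to any left-invariant metric in $c$ is left-invariant. The curvature of $\nabla$ is $R^\nabla(X,Y)Z=\nabla_{[X,Y]}Z-\nabla_X\nabla_YZ+\nabla_Y\nabla_XZ$ and its Ricci tensor is $\mathrm{Ric}^\nabla(X,Y)=\mathrm{Tr}(Z\mapsto R^\nabla(X,Z)Y)$ (in general not symmetric). $\nabla$ is Weyl-Einstein if the trace-free symmetric part of $\mathrm{Ric}^\nabla$ (with respect to some, equivalently any, metric in $c$) vanishes. *)

theory Defs
  imports "HOL-Analysis.Analysis"
begin

section \<open>Smooth manifolds and Lie groups\<close>

text \<open>On an open set \<open>S\<close>, \<open>Ck_on n f S\<close> says that \<open>f\<close> is n times continuously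
  differentiable, expressed by iterated directional derivatives.\<close>

primrec Ck_on :: "nat \<Rightarrow> ('a::euclidean_space \<Rightarrow> 'b::euclidean_space) \<Rightarrow> 'a set \<Rightarrow> bool" where
  "Ck_on 0 f S \<longleftrightarrow> continuous_on S f"
| "Ck_on (Suc n) f S \<longleftrightarrow>
     (\<forall>x\<in>S. f differentiable (at x)) \<and>
     (\<forall>v. Ck_on n (\<lambda>x. frechet_derivative f (at x) v) S)"

definition smooth_on :: "('a::euclidean_space \<Rightarrow> 'b::euclidean_space) \<Rightarrow> 'a set \<Rightarrow> bool" where
  "smooth_on f S \<longleftrightarrow> (\<forall>n. Ck_on n f S)"

text \<open>A chart is a pair of its domain and its coordinate map; the manifold is the whole type \<open>'m\<close>,
  and its dimension is that of the model space \<open>'e\<close>. The atlas need not be maximal.\<close>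

type_synonym ('m, 'e) atlas = "('m set \<times> ('m \<Rightarrow> 'e)) set"

definition smooth_atlas ::
    "('m::{t2_space,second_countable_topology}, 'e::euclidean_space) atlas \<Rightarrow> bool" where
  "smooth_atlas A \<longleftrightarrow>
     (\<forall>(U, \<phi>)\<in>A. open U \<and> open (\<phi> ` U) \<and> homeomorphism U (\<phi> ` U) \<phi> (inv_into U \<phi>)) \<and>
     (\<Union>(U, \<phi>)\<in>A. U) = UNIV \<and>
     (\<forall>(U, \<phi>)\<in>A. \<forall>(V, \<psi>)\<in>A. smooth_on (\<psi> \<circ> inv_into U \<phi>) (\<phi> ` (U \<inter> V)))"

definition smooth_map ::
    "('m::topological_space, 'e::euclidean_space) atlas \<Rightarrow>
     ('n::topological_space, 'f::euclidean_space) atlas \<Rightarrow> ('m \<Rightarrow> 'n) \<Rightarrow> bool" where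
  "smooth_map A B F \<longleftrightarrow>
     continuous_on UNIV F \<and>
     (\<forall>(U, \<phi>)\<in>A. \<forall>(V, \<psi>)\<in>B.
        smooth_on (\<psi> \<circ> F \<circ> inv_into U \<phi>) (\<phi> ` (U \<inter> F -` V)))"

definition product_atlas ::
    "('m, 'e) atlas \<Rightarrow> ('n, 'f) atlas \<Rightarrow> ('m \<times> 'n, 'e \<times> 'f) atlas" where
  "product_atlas A B = {(U \<times> V, map_prod \<phi> \<psi>) | U \<phi> V \<psi>. (U, \<phi>) \<in> A \<and> (V, \<psi>) \<in> B}"

text \<open>The group law is that of the class \<open>group_add\<close>. It is written additively, but commutativity
  is not assumed: the product of \<open>a\<close> and \<open>b\<close> is \<open>a + b\<close> and the identity element is \<open>0\<close>.\<close>

definition lie_group ::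
    "('g::{t2_space,second_countable_topology,group_add}, 'e::euclidean_space) atlas \<Rightarrow> bool" where
  "lie_group A \<longleftrightarrow>
     smooth_atlas A \<and>
     smooth_map (product_atlas A A) A (\<lambda>(a, b). a + b) \<and>
     smooth_map A A uminus"

section \<open>Vector fields, 1-forms and metrics\<close>

text \<open>Vector fields are derivations of the algebra of smooth functions. So that equality of vector
  fields is equality of HOL functions, they are made to vanish on functions that are not smooth.
  Tensor fields are multilinear maps over the smooth functions; their values on
  arguments that are not vector fields are irrelevant.\<close>

definition smooth_fun :: "('m::topological_space, 'e::euclidean_space) atlas \<Rightarrow> ('m \<Rightarrow> real) \<Rightarrow> bool" where
  "smooth_fun A f \<longleftrightarrow> (\<forall>(U, \<phi>)\<in>A. smooth_on (f \<circ> inv_into U \<phi>) (\<phi> ` U))"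

type_synonym 'm vfield = "('m \<Rightarrow> real) \<Rightarrow> 'm \<Rightarrow> real"

definition vadd :: "'m vfield \<Rightarrow> 'm vfield \<Rightarrow> 'm vfield" where
  "vadd X Y = (\<lambda>f p. X f p + Y f p)"

definition vdiff :: "'m vfield \<Rightarrow> 'm vfield \<Rightarrow> 'm vfield" where
  "vdiff X Y = (\<lambda>f p. X f p - Y f p)"

definition vmult :: "('m \<Rightarrow> real) \<Rightarrow> 'm vfield \<Rightarrow> 'm vfield" where
  "vmult h X = (\<lambda>f p. h p * X f p)"

definition vbracket :: "'m vfield \<Rightarrow> 'm vfield \<Rightarrow> 'm vfield" where
  "vbracket X Y = (\<lambda>f p. X (Y f) p - Y (X f) p)"

definition vector_fields :: "('m::topological_space, 'e::euclidean_space) atlas \<Rightarrow> 'm vfield set" where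
  "vector_fields A = {X.
     (\<forall>f. \<not> smooth_fun A f \<longrightarrow> X f = (\<lambda>p. 0)) \<and>
     (\<forall>f. smooth_fun A f \<longrightarrow> smooth_fun A (X f)) \<and>
     (\<forall>f h. smooth_fun A f \<and> smooth_fun A h \<longrightarrow>
        X (\<lambda>p. f p + h p) = (\<lambda>p. X f p + X h p) \<and>
        X (\<lambda>p. f p * h p) = (\<lambda>p. X f p * h p + f p * X h p)) \<and>
     (\<forall>c f. smooth_fun A f \<longrightarrow> X (\<lambda>p. c * f p) = (\<lambda>p. c * X f p))}"

definition one_form ::
    "('m::topological_space, 'e::euclidean_space) atlas \<Rightarrow> ('m vfield \<Rightarrow> 'm \<Rightarrow> real) \<Rightarrow> bool" where
  "one_form A \<theta> \<longleftrightarrow>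
     (\<forall>X\<in>vector_fields A. smooth_fun A (\<theta> X)) \<and>
     (\<forall>X\<in>vector_fields A. \<forall>Y\<in>vector_fields A. \<theta> (vadd X Y) = (\<lambda>p. \<theta> X p + \<theta> Y p)) \<and>
     (\<forall>X\<in>vector_fields A. \<forall>h. smooth_fun A h \<longrightarrow> \<theta> (vmult h X) = (\<lambda>p. h p * \<theta> X p))"

text \<open>The premise \<open>X f p \<noteq> 0\<close> for some \<open>f\<close> says that the tangent vector of \<open>X\<close> at \<open>p\<close> is nonzero.\<close>

definition riemannian_metric ::
    "('m::topological_space, 'e::euclidean_space) atlas \<Rightarrow>
     ('m vfield \<Rightarrow> 'm vfield \<Rightarrow> 'm \<Rightarrow> real) \<Rightarrow> bool" where
  "riemannian_metric A g \<longleftrightarrow>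
     (\<forall>X\<in>vector_fields A. one_form A (g X)) \<and>
     (\<forall>X\<in>vector_fields A. \<forall>Y\<in>vector_fields A. g X Y = g Y X) \<and>
     (\<forall>X\<in>vector_fields A. \<forall>p. (\<exists>f. X f p \<noteq> 0) \<longrightarrow> g X X p > 0)"

definition conformal_class ::
    "('m::topological_space, 'e::euclidean_space) atlas \<Rightarrow>
     ('m vfield \<Rightarrow> 'm vfield \<Rightarrow> 'm \<Rightarrow> real) \<Rightarrow> ('m vfield \<Rightarrow> 'm vfield \<Rightarrow> 'm \<Rightarrow> real) set" where
  "conformal_class A g = {h. \<exists>u. smooth_fun A u \<and>
     (\<forall>X\<in>vector_fields A. \<forall>Y\<in>vector_fields A. h X Y = (\<lambda>p. exp (2 * u p) * g X Y p))}"

section \<open>Left-invariance and the Lie algebra of a Lie group\<close>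

text \<open>Push-forward by the left translation by \<open>a\<close>.\<close>

definition push_left :: "'g::group_add \<Rightarrow> 'g vfield \<Rightarrow> 'g vfield" where
  "push_left a X = (\<lambda>f p. X (\<lambda>q. f (a + q)) (- a + p))"

definition left_invariant_fields ::
    "('g::{topological_space,group_add}, 'e::euclidean_space) atlas \<Rightarrow> 'g vfield set" where
  "left_invariant_fields A = {X\<in>vector_fields A. \<forall>a. push_left a X = X}"

definition left_invariant_form ::
    "('g::{topological_space,group_add}, 'e::euclidean_space) atlas \<Rightarrow>
     ('g vfield \<Rightarrow> 'g \<Rightarrow> real) \<Rightarrow> bool" where
  "left_invariant_form A \<theta> \<longleftrightarrow> one_form A \<theta> \<and>
     (\<forall>a. \<forall>X\<in>vector_fields A. \<forall>p. \<theta> (push_left a X) (a + p) = \<theta> X p)"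

definition left_invariant_metric ::
    "('g::{topological_space,group_add}, 'e::euclidean_space) atlas \<Rightarrow>
     ('g vfield \<Rightarrow> 'g vfield \<Rightarrow> 'g \<Rightarrow> real) \<Rightarrow> bool" where
  "left_invariant_metric A g \<longleftrightarrow> riemannian_metric A g \<and>
     (\<forall>a. \<forall>X\<in>vector_fields A. \<forall>Y\<in>vector_fields A. \<forall>p.
        g (push_left a X) (push_left a Y) (a + p) = g X Y p)"

record 'a lie_algebra =
  la_carrier :: "'a set"
  la_zero :: 'a
  la_add :: "'a \<Rightarrow> 'a \<Rightarrow> 'a"
  la_scale :: "real \<Rightarrow> 'a \<Rightarrow> 'a"
  la_bracket :: "'a \<Rightarrow> 'a \<Rightarrow> 'a"

record 'a metric_lie_algebra = "'a lie_algebra" +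
  la_inner :: "'a \<Rightarrow> 'a \<Rightarrow> real"

definition la_subspace :: "('a, 'b) lie_algebra_scheme \<Rightarrow> 'a set \<Rightarrow> bool" where
  "la_subspace L W \<longleftrightarrow> W \<subseteq> la_carrier L \<and> la_zero L \<in> W \<and>
     (\<forall>u\<in>W. \<forall>v\<in>W. la_add L u v \<in> W) \<and> (\<forall>c. \<forall>u\<in>W. la_scale L c u \<in> W)"

definition la_derived :: "('a, 'b) lie_algebra_scheme \<Rightarrow> 'a set \<Rightarrow> 'a set" where
  "la_derived L S = \<Inter>{W. la_subspace L W \<and> (\<forall>u\<in>S. \<forall>v\<in>S. la_bracket L u v \<in> W)}"

definition la_solvable :: "('a, 'b) lie_algebra_scheme \<Rightarrow> bool" where
  "la_solvable L \<longleftrightarrow> (\<exists>k. (la_derived L ^^ k) (la_carrier L) = {la_zero L})"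

definition metric_isomorphic :: "'a metric_lie_algebra \<Rightarrow> 'b metric_lie_algebra \<Rightarrow> bool" where
  "metric_isomorphic L M \<longleftrightarrow> (\<exists>F. bij_betw F (la_carrier L) (la_carrier M) \<and>
     (\<forall>u\<in>la_carrier L. \<forall>v\<in>la_carrier L.
        F (la_add L u v) = la_add M (F u) (F v) \<and>
        F (la_bracket L u v) = la_bracket M (F u) (F v) \<and>
        la_inner M (F u) (F v) = la_inner L u v) \<and>
     (\<forall>c. \<forall>u\<in>la_carrier L. F (la_scale L c u) = la_scale M c (F u)))"

definition lie_algebra_of ::
    "('g::{topological_space,group_add}, 'e::euclidean_space) atlas \<Rightarrow> 'g vfield lie_algebra" where
  "lie_algebra_of A =
     \<lparr>la_carrier = left_invariant_fields A,
      la_zero = (\<lambda>f p. 0),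
      la_add = vadd,
      la_scale = (\<lambda>c. vmult (\<lambda>p. c)),
      la_bracket = vbracket\<rparr>"

text \<open>For left-invariant \<open>g\<close>, \<open>X\<close> and \<open>Y\<close> the function \<open>g X Y\<close> is constant; it is evaluated at the
  identity element.\<close>

definition metric_lie_algebra_of ::
    "('g::{topological_space,group_add}, 'e::euclidean_space) atlas \<Rightarrow>
     ('g vfield \<Rightarrow> 'g vfield \<Rightarrow> 'g \<Rightarrow> real) \<Rightarrow> 'g vfield metric_lie_algebra" where
  "metric_lie_algebra_of A g =
     lie_algebra.extend (lie_algebra_of A) (metric_lie_algebra.fields (\<lambda>X Y. g X Y 0))"

definition solvable_lie_group ::
    "('g::{t2_space,second_countable_topology,group_add}, 'e::euclidean_space) atlas \<Rightarrow> bool" where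
  "solvable_lie_group A \<longleftrightarrow> lie_group A \<and> la_solvable (lie_algebra_of A)"

section \<open>Weyl structures\<close>

text \<open>A connection \<open>D\<close> is written \<open>D X Y\<close> for the covariant derivative of \<open>Y\<close> in direction \<open>X\<close>.\<close>

definition linear_connection ::
    "('m::topological_space, 'e::euclidean_space) atlas \<Rightarrow>
     ('m vfield \<Rightarrow> 'm vfield \<Rightarrow> 'm vfield) \<Rightarrow> bool" where
  "linear_connection A D \<longleftrightarrow>
     (\<forall>X\<in>vector_fields A. \<forall>Y\<in>vector_fields A. D X Y \<in> vector_fields A) \<and>
     (\<forall>X\<in>vector_fields A. \<forall>Y\<in>vector_fields A. \<forall>Z\<in>vector_fields A.
        D (vadd X Y) Z = vadd (D X Z) (D Y Z) \<and>
        D X (vadd Y Z) = vadd (D X Y) (D X Z)) \<and>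
     (\<forall>X\<in>vector_fields A. \<forall>Y\<in>vector_fields A. \<forall>h. smooth_fun A h \<longrightarrow>
        D (vmult h X) Y = vmult h (D X Y) \<and>
        D X (vmult h Y) = vadd (vmult (X h) Y) (vmult h (D X Y)))"

definition torsion_free ::
    "('m::topological_space, 'e::euclidean_space) atlas \<Rightarrow>
     ('m vfield \<Rightarrow> 'm vfield \<Rightarrow> 'm vfield) \<Rightarrow> bool" where
  "torsion_free A D \<longleftrightarrow>
     (\<forall>X\<in>vector_fields A. \<forall>Y\<in>vector_fields A. vdiff (D X Y) (D Y X) = vbracket X Y)"

text \<open>The equation \<open>D h = - 2 \<theta> \<otimes> h\<close>.\<close>

definition lee_form ::
    "('m::topological_space, 'e::euclidean_space) atlas \<Rightarrow>
     ('m vfield \<Rightarrow> 'm vfield \<Rightarrow> 'm vfield) \<Rightarrow> ('m vfield \<Rightarrow> 'm vfield \<Rightarrow> 'm \<Rightarrow> real) \<Rightarrow>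
     ('m vfield \<Rightarrow> 'm \<Rightarrow> real) \<Rightarrow> bool" where
  "lee_form A D h \<theta> \<longleftrightarrow> one_form A \<theta> \<and>
     (\<forall>X\<in>vector_fields A. \<forall>Y\<in>vector_fields A. \<forall>Z\<in>vector_fields A. \<forall>p.
        X (h Y Z) p - h (D X Y) Z p - h Y (D X Z) p = - 2 * \<theta> X p * h Y Z p)"

definition weyl_structure ::
    "('m::topological_space, 'e::euclidean_space) atlas \<Rightarrow>
     ('m vfield \<Rightarrow> 'm vfield \<Rightarrow> 'm \<Rightarrow> real) set \<Rightarrow>
     ('m vfield \<Rightarrow> 'm vfield \<Rightarrow> 'm vfield) \<Rightarrow> bool" where
  "weyl_structure A c D \<longleftrightarrow>
     linear_connection A D \<and> torsion_free A D \<and> (\<forall>h\<in>c. \<exists>\<theta>. lee_form A D h \<theta>)"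

definition left_invariant_weyl ::
    "('g::{topological_space,group_add}, 'e::euclidean_space) atlas \<Rightarrow>
     ('g vfield \<Rightarrow> 'g vfield \<Rightarrow> 'g \<Rightarrow> real) set \<Rightarrow>
     ('g vfield \<Rightarrow> 'g vfield \<Rightarrow> 'g vfield) \<Rightarrow> bool" where
  "left_invariant_weyl A c D \<longleftrightarrow> weyl_structure A c D \<and>
     (\<forall>h\<in>c. left_invariant_metric A h \<longrightarrow>
        (\<forall>\<theta>. lee_form A D h \<theta> \<longrightarrow> left_invariant_form A \<theta>))"

text \<open>Note the sign: this is minus the more common convention for the curvature.\<close>

definition curvature ::
    "('m vfield \<Rightarrow> 'm vfield \<Rightarrow> 'm vfield) \<Rightarrow> 'm vfield \<Rightarrow> 'm vfield \<Rightarrow> 'm vfield \<Rightarrow> 'm vfield" where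
  "curvature D X Y Z =
     vadd (vdiff (D (vbracket X Y) Z) (D X (D Y Z))) (D Y (D X Z))"

text \<open>\<open>DIM('e)\<close> vector fields whose tangent vectors at \<open>p\<close> are linearly independent, hence a basis of
  the tangent space at \<open>p\<close>.\<close>

definition basis_at ::
    "('m::topological_space, 'e::euclidean_space) atlas \<Rightarrow> 'm \<Rightarrow> (nat \<Rightarrow> 'm vfield) \<Rightarrow> bool" where
  "basis_at A p E \<longleftrightarrow>
     (\<forall>i<DIM('e). E i \<in> vector_fields A) \<and>
     (\<forall>c. (\<forall>f. (\<Sum>i<DIM('e). c i * E i f p) = 0) \<longrightarrow> (\<forall>i<DIM('e). c i = 0))"

text \<open>The trace at \<open>p\<close> of the endomorphism of the tangent space induced by a map \<open>T\<close> of vector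
  fields that is linear over the smooth functions; \<open>a\<close> is its matrix in a basis.\<close>

definition trace_at ::
    "('m::topological_space, 'e::euclidean_space) atlas \<Rightarrow> 'm \<Rightarrow> ('m vfield \<Rightarrow> 'm vfield) \<Rightarrow> real" where
  "trace_at A p T = (THE t. \<exists>E a. basis_at A p E \<and>
     (\<forall>j<DIM('e). \<forall>f. T (E j) f p = (\<Sum>i<DIM('e). a i j * E i f p)) \<and>
     t = (\<Sum>i<DIM('e). a i i))"

definition ricci ::
    "('m::topological_space, 'e::euclidean_space) atlas \<Rightarrow>
     ('m vfield \<Rightarrow> 'm vfield \<Rightarrow> 'm vfield) \<Rightarrow> 'm vfield \<Rightarrow> 'm vfield \<Rightarrow> 'm \<Rightarrow> real" where
  "ricci A D X Y = (\<lambda>p. trace_at A p (\<lambda>Z. curvature D X Z Y))"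

definition symmetric_part ::
    "('m vfield \<Rightarrow> 'm vfield \<Rightarrow> 'm \<Rightarrow> real) \<Rightarrow> 'm vfield \<Rightarrow> 'm vfield \<Rightarrow> 'm \<Rightarrow> real" where
  "symmetric_part B X Y = (\<lambda>p. (B X Y p + B Y X p) / 2)"

definition metric_trace_at ::
    "('m::topological_space, 'e::euclidean_space) atlas \<Rightarrow> ('m vfield \<Rightarrow> 'm vfield \<Rightarrow> 'm \<Rightarrow> real) \<Rightarrow>
     'm \<Rightarrow> ('m vfield \<Rightarrow> 'm vfield \<Rightarrow> 'm \<Rightarrow> real) \<Rightarrow> real" where
  "metric_trace_at A h p B = (THE t. \<exists>E.
     (\<forall>i<DIM('e). E i \<in> vector_fields A) \<and>
     (\<forall>i<DIM('e). \<forall>j<DIM('e). h (E i) (E j) p = (if i = j then 1 else 0)) \<and>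
     t = (\<Sum>i<DIM('e). B (E i) (E i) p))"

definition trace_free_part ::
    "('m::topological_space, 'e::euclidean_space) atlas \<Rightarrow> ('m vfield \<Rightarrow> 'm vfield \<Rightarrow> 'm \<Rightarrow> real) \<Rightarrow>
     ('m vfield \<Rightarrow> 'm vfield \<Rightarrow> 'm \<Rightarrow> real) \<Rightarrow> 'm vfield \<Rightarrow> 'm vfield \<Rightarrow> 'm \<Rightarrow> real" where
  "trace_free_part A h B X Y =
     (\<lambda>p. B X Y p - metric_trace_at A h p B / real DIM('e) * h X Y p)"

definition weyl_einstein ::
    "('m::topological_space, 'e::euclidean_space) atlas \<Rightarrow>
     ('m vfield \<Rightarrow> 'm vfield \<Rightarrow> 'm \<Rightarrow> real) set \<Rightarrow>
     ('m vfield \<Rightarrow> 'm vfield \<Rightarrow> 'm vfield) \<Rightarrow> bool" where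
  "weyl_einstein A c D \<longleftrightarrow> weyl_structure A c D \<and>
     (\<exists>h\<in>c. \<forall>X\<in>vector_fields A. \<forall>Y\<in>vector_fields A. \<forall>p.
        trace_free_part A h (symmetric_part (ricci A D)) X Y p = 0)"

definition admits_left_invariant_weyl_einstein ::
    "('g::{topological_space,group_add}, 'e::euclidean_space) atlas \<Rightarrow>
     ('g vfield \<Rightarrow> 'g vfield \<Rightarrow> 'g \<Rightarrow> real) set \<Rightarrow> bool" where
  "admits_left_invariant_weyl_einstein A c \<longleftrightarrow>
     (\<exists>D. left_invariant_weyl A c D \<and> weyl_einstein A c D)"

section \<open>The model metric Lie algebras\<close>

text \<open>Coordinates 1, 2, 3 of \<open>real ^ 3\<close> are those with respect to the basis \<open>x, y, z\<close>.\<close>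

abbreviation e_x :: "real ^ 3" where "e_x \<equiv> axis 1 1"
abbreviation e_y :: "real ^ 3" where "e_y \<equiv> axis 2 1"

abbreviation dx :: "real ^ 3 \<Rightarrow> real" where "dx \<equiv> \<lambda>u. u $ 1"
abbreviation dy :: "real ^ 3 \<Rightarrow> real" where "dy \<equiv> \<lambda>u. u $ 2"
abbreviation dz :: "real ^ 3 \<Rightarrow> real" where "dz \<equiv> \<lambda>u. u $ 3"

text \<open>The alternating bilinear map with \<open>[x, y] = xy\<close>, \<open>[z, x] = zx\<close> and \<open>[z, y] = zy\<close>.\<close>

definition bracket3 :: "real ^ 3 \<Rightarrow> real ^ 3 \<Rightarrow> real ^ 3 \<Rightarrow> real ^ 3 \<Rightarrow> real ^ 3 \<Rightarrow> real ^ 3" where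
  "bracket3 xy zx zy u v =
     (u $ 1 * v $ 2 - u $ 2 * v $ 1) *\<^sub>R xy +
     (u $ 3 * v $ 1 - u $ 1 * v $ 3) *\<^sub>R zx +
     (u $ 3 * v $ 2 - u $ 2 * v $ 3) *\<^sub>R zy"

definition sym_prod :: "('v \<Rightarrow> real) \<Rightarrow> ('v \<Rightarrow> real) \<Rightarrow> 'v \<Rightarrow> 'v \<Rightarrow> real" (infixl "\<odot>" 75) where
  "(\<xi> \<odot> \<zeta>) u v = (\<xi> u * \<zeta> v + \<zeta> u * \<xi> v) / 2"

definition g_nu :: "real \<Rightarrow> real ^ 3 \<Rightarrow> real ^ 3 \<Rightarrow> real" where
  "g_nu \<nu> u v = (dx \<odot> dx) u v + (dy \<odot> dy) u v + \<nu> * (dz \<odot> dz) u v"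

definition g_munu :: "real \<Rightarrow> real \<Rightarrow> real ^ 3 \<Rightarrow> real ^ 3 \<Rightarrow> real" where
  "g_munu \<mu> \<nu> u v = (dx \<odot> dx) u v + \<mu> * (dy \<odot> dy) u v + \<nu> * (dz \<odot> dz) u v"

definition h_munu :: "real \<Rightarrow> real \<Rightarrow> real ^ 3 \<Rightarrow> real ^ 3 \<Rightarrow> real" where
  "h_munu \<mu> \<nu> u v =
     (dx \<odot> dx) u v + 2 * (dx \<odot> dy) u v + \<mu> * (dy \<odot> dy) u v + \<nu> * (dz \<odot> dz) u v"

definition m_nu :: "real \<Rightarrow> real ^ 3 \<Rightarrow> real ^ 3 \<Rightarrow> real" where
  "m_nu \<nu> u v = (dx \<odot> dx) u v + (dx \<odot> dy) u v + (dy \<odot> dy) u v + \<nu> * (dz \<odot> dz) u v"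

definition model ::
    "(real ^ 3 \<Rightarrow> real ^ 3 \<Rightarrow> real ^ 3) \<Rightarrow> (real ^ 3 \<Rightarrow> real ^ 3 \<Rightarrow> real) \<Rightarrow>
     (real ^ 3) metric_lie_algebra" where
  "model br ip =
     \<lparr>la_carrier = UNIV, la_zero = 0, la_add = (+), la_scale = (*\<^sub>R), la_bracket = br, la_inner = ip\<rparr>"

definition abelian3 :: "real ^ 3 \<Rightarrow> real ^ 3 \<Rightarrow> real ^ 3" where
  "abelian3 = (\<lambda>u v. 0)"

definition R_Id_R2 :: "real ^ 3 \<Rightarrow> real ^ 3 \<Rightarrow> real ^ 3" where
  "R_Id_R2 = bracket3 0 e_x e_y"

definition so2_R2 :: "real ^ 3 \<Rightarrow> real ^ 3 \<Rightarrow> real ^ 3" where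
  "so2_R2 = bracket3 0 (- e_y) e_x"

definition g_t :: "real \<Rightarrow> real ^ 3 \<Rightarrow> real ^ 3 \<Rightarrow> real ^ 3" where
  "g_t t = bracket3 0 e_y (- t *\<^sub>R e_x + 2 *\<^sub>R e_y)"

end

theory Submission
  imports Defs "HOL-Real_Asymp.Real_Asymp"
begin

text \<open>
  Everything in the statement is left-invariant, so the question becomes one about the structure
  constants of a metric Lie algebra, and finally one about a small polynomial system.

  From the group to constants. A derivation of the smooth functions is, at each point, a directional
  derivative (\<open>vector_field_at\<close>), and a left-invariant one is determined by its value at the identity
  element; so the left-invariant fields form a space of the dimension of the group (\<open>lfield_bij\<close>).
  A left-invariant orthonormal frame \<open>E\<close> therefore spans all vector fields over the smooth functions,
  with coefficients \<open>g X (E i)\<close> (\<open>frame_expand\<close>). A left-invariant Weyl connection is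
  given in the frame by constants, which metricity and torsion-freeness express through the bracket
  coefficients and the values \<open>t i\<close> of the Lee form on the frame (\<open>weyl_christoffel\<close>);
  conversely every vector \<open>t\<close> defines such a connection (\<open>weyl_connection\<close>). Its Ricci tensor has
  constant coefficients in the frame, and the Weyl-Einstein equation says that the symmetrised
  matrix of these coefficients is a multiple of the identity matrix
  (\<open>weyl_einstein_imp\<close>, \<open>weyl_einstein_if\<close>).

  A normal form. A bracket on Euclidean three-space is \<open>L (cross3 x y)\<close> for a linear map \<open>L\<close>. Let
  \<open>a\<close> be the vector that represents the antisymmetric part of \<open>L\<close>. The Jacobi identity says that
  \<open>L a = 0\<close>, and then the transpose of \<open>L\<close> kills \<open>a\<close> as well. If \<open>a \<noteq> 0\<close>, let \<open>n\<close> be the unit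
  vector along \<open>a\<close>; if \<open>a = 0\<close>, then \<open>L\<close> is symmetric, and singular because the algebra is solvable,
  and \<open>n\<close> is a unit vector in its kernel. Either way the plane orthogonal to \<open>n\<close> is an abelian ideal
  (\<open>unit_normal_exists\<close>). Rotating this plane until the symmetric part of the bracket with \<open>n\<close> is
  diagonal gives an orthonormal basis \<open>u, v, w = n\<close> with \<open>[u, v] = 0\<close>, \<open>[w, u] = \<alpha> u - \<gamma> v\<close> and
  \<open>[w, v] = \<gamma> u + \<beta> v\<close> (\<open>adapted_exists\<close>).

  The equation. In such a basis the Weyl-Einstein equation has a solution, a Lee form, exactly if
  \<open>\<alpha> = \<beta>\<close>, or \<open>\<gamma> = 0\<close> and \<open>\<alpha> \<beta> = 0\<close> (\<open>adapted_weyl_einstein_iff\<close>). The parameters that satisfy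
  this condition are those of the five families: all zero; \<open>\<alpha> = \<beta> \<noteq> 0\<close> and \<open>\<gamma> = 0\<close>; \<open>\<alpha> = \<beta> = 0\<close> and
  \<open>\<gamma> \<noteq> 0\<close>; \<open>\<alpha> = \<beta> \<noteq> 0\<close> and \<open>\<gamma> \<noteq> 0\<close>, where the parameter of the model is \<open>1 + (\<gamma> / \<alpha>)\<^sup>2\<close>; and \<open>\<gamma> = 0\<close> with exactly one of
  \<open>\<alpha>\<close>, \<open>\<beta>\<close> nonzero. The lemmas \<open>model_frame_abelian\<close> to \<open>model_frame_g_0\<close> exhibit adapted bases of
  the models, and a metric Lie algebra is isomorphic to a model if and only if it has an adapted
  basis with the same parameters (\<open>metric_isomorphic_iff_adapted\<close>).
\<close>

section \<open>Calculus of smooth functions\<close>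

text \<open>The Frechet derivative at a point depends only on the germ there, which is why the set is open.\<close>

lemma Ck_on_cong:
  fixes f :: "'a::euclidean_space \<Rightarrow> 'b::euclidean_space"
  assumes "open S" "\<And>x. x \<in> S \<Longrightarrow> f x = g x" "Ck_on n f S"
  shows "Ck_on n g S"
  using assms
proof (induction n arbitrary: f g)
  case 0
  then show ?case using continuous_on_cong[of S S f g] by simp
next
  case (Suc n)
  have D: "f differentiable at x" if "x \<in> S" for x using Suc.prems(3) that by simp
  have E: "frechet_derivative f (at x) = frechet_derivative g (at x)" if "x \<in> S" for x
    by (rule frechet_derivative_transform_within_open[OF D Suc.prems(1)]) (use that Suc.prems(2) in auto)
  have "g differentiable at x" if "x \<in> S" for x
    using D[OF that] unfolding differentiable_def
    using has_derivative_transform_within_open[OF _ Suc.prems(1) that, of f _ UNIV g] Suc.prems(2) by metis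
  moreover have "Ck_on n (\<lambda>x. frechet_derivative g (at x) v) S" for v
    by (rule Suc.IH[OF Suc.prems(1), of "\<lambda>x. frechet_derivative f (at x) v"])
      (use E Suc.prems(3) in auto)
  ultimately show ?case by simp
qed

text \<open>Introduction rule with an explicit formula for the derivative in place of the choice
  operator in \<open>frechet_derivative\<close>. The closure properties below all come from it by induction on
  the order, with the derivative formula supplied by the usual rules of calculus.\<close>

lemma Ck_on_SucI:
  fixes f :: "'a::euclidean_space \<Rightarrow> 'b::euclidean_space"
  assumes S: "open S" and D: "\<And>x. x \<in> S \<Longrightarrow> (f has_derivative f' x) (at x)"
    and C: "\<And>v. Ck_on n (\<lambda>x. f' x v) S"
  shows "Ck_on (Suc n) f S"
proof -
  have "Ck_on n (\<lambda>x. frechet_derivative f (at x) v) S" for v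
    by (rule Ck_on_cong[OF S _ C[of v]]) (use D frechet_derivative_at in metis)
  then show ?thesis
    using D by (auto simp: differentiable_def)
qed

lemma Ck_on_SucD:
  "Ck_on (Suc n) f S \<Longrightarrow> x \<in> S \<Longrightarrow> (f has_derivative frechet_derivative f (at x)) (at x)"
  by (simp add: frechet_derivative_works[symmetric])

lemma Ck_on_SucD2: "Ck_on (Suc n) f S \<Longrightarrow> Ck_on n (\<lambda>x. frechet_derivative f (at x) v) S"
  by simp

lemma Ck_on_Suc_imp: "Ck_on (Suc n) f S \<Longrightarrow> Ck_on n f S"
proof (induction n arbitrary: f)
  case 0
  then have "f differentiable_on S"
    by (auto simp: differentiable_on_def intro: differentiable_at_withinI)
  then show ?case by (simp add: differentiable_imp_continuous_on)
next
  case (Suc n)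
  have "f differentiable at x" if "x \<in> S" for x using Suc.prems that by simp
  moreover have "Ck_on n (\<lambda>x. frechet_derivative f (at x) v) S" for v
    using Suc.IH Suc.prems Ck_on_SucD2 by blast
  ultimately show ?case by simp
qed

lemma Ck_on_subset: "Ck_on n f S \<Longrightarrow> T \<subseteq> S \<Longrightarrow> Ck_on n f T"
  by (induction n arbitrary: f) (auto intro: continuous_on_subset)

lemma Ck_on_UN:
  assumes "\<And>i. i \<in> I \<Longrightarrow> open (S i)" "\<And>i. i \<in> I \<Longrightarrow> Ck_on n f (S i)"
  shows "Ck_on n f (\<Union>i\<in>I. S i)"
  using assms by (induction n arbitrary: f) (auto intro: continuous_on_open_UN)

lemma Ck_on_const: "open S \<Longrightarrow> Ck_on n (\<lambda>x. c) S"
  by (induction n arbitrary: c) auto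

lemma Ck_on_ident: "open S \<Longrightarrow> Ck_on n (\<lambda>x. x) S"
  by (cases n) (auto intro: Ck_on_const)

lemma Ck_on_linear:
  fixes f :: "'a::euclidean_space \<Rightarrow> 'b::euclidean_space" and h :: "'b \<Rightarrow> 'c::euclidean_space"
  assumes "open S" "bounded_linear h" "Ck_on n f S"
  shows "Ck_on n (\<lambda>x. h (f x)) S"
  using assms(3)
proof (induction n arbitrary: f)
  case 0
  then show ?case using assms(2) by (simp add: bounded_linear.continuous_on)
next
  case (Suc n)
  show ?case
    by (rule Ck_on_SucI[OF assms(1), where f' = "\<lambda>x v. h (frechet_derivative f (at x) v)"])
      (use Suc in \<open>auto intro!: bounded_linear.has_derivative[OF assms(2)] simp: frechet_derivative_works[symmetric]\<close>)
qed

lemma Ck_on_add: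
  assumes "open S" "Ck_on n f S" "Ck_on n g S"
  shows "Ck_on n (\<lambda>x. f x + g x) S"
  using assms(2,3)
proof (induction n arbitrary: f g)
  case 0
  then show ?case by (simp add: continuous_on_add)
next
  case (Suc n)
  show ?case
    by (rule Ck_on_SucI[OF assms(1), where f' = "\<lambda>x v. frechet_derivative f (at x) v + frechet_derivative g (at x) v"])
      (use Suc in \<open>auto intro!: has_derivative_add simp: frechet_derivative_works[symmetric]\<close>)
qed

lemma Ck_on_bilinear:
  fixes f :: "'a::euclidean_space \<Rightarrow> 'b::euclidean_space" and g :: "'a \<Rightarrow> 'c::euclidean_space"
    and h :: "'b \<Rightarrow> 'c \<Rightarrow> 'd::euclidean_space"
  assumes "open S" "bounded_bilinear h" "Ck_on n f S" "Ck_on n g S"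
  shows "Ck_on n (\<lambda>x. h (f x) (g x)) S"
  using assms(3,4)
proof (induction n arbitrary: f g)
  case 0
  then show ?case using bounded_bilinear.continuous_on[OF assms(2)] by auto
next
  case (Suc n)
  show ?case
  proof (rule Ck_on_SucI[OF assms(1)])
    show "((\<lambda>x. h (f x) (g x)) has_derivative (\<lambda>v. h (f x) (frechet_derivative g (at x) v) + h (frechet_derivative f (at x) v) (g x))) (at x)"
      if "x \<in> S" for x
      by (intro bounded_bilinear.FDERIV[OF assms(2)] Ck_on_SucD[OF Suc.prems(1) that] Ck_on_SucD[OF Suc.prems(2) that])
    show "Ck_on n (\<lambda>x. h (f x) (frechet_derivative g (at x) v) + h (frechet_derivative f (at x) v) (g x)) S" for v
      by (intro Ck_on_add[OF assms(1)] Suc.IH Ck_on_SucD2 Suc.prems Ck_on_Suc_imp[OF Suc.prems(1)] Ck_on_Suc_imp[OF Suc.prems(2)])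
  qed
qed

lemma Ck_on_sum:
  assumes "open S" "\<And>i. i \<in> I \<Longrightarrow> Ck_on n (f i) S"
  shows "Ck_on n (\<lambda>x. \<Sum>i\<in>I. f i x) S"
  using assms(2)
  by (induction I rule: infinite_finite_induct) (auto intro: Ck_on_const Ck_on_add assms(1))

text \<open>The chain rule writes the derivative of the composition in direction \<open>v\<close> as the sum over
  the basis vectors \<open>b\<close> of the \<open>b\<close>-component of the derivative of \<open>f\<close> times
  \<open>frechet_derivative g (at (f x)) b\<close>. The last factor is again a composition with \<open>f\<close>, so the induction
  has to run over all \<open>g\<close> at once.\<close>

lemma Ck_on_compose:
  fixes f :: "'a::euclidean_space \<Rightarrow> 'b::euclidean_space" and g :: "'b \<Rightarrow> 'c::euclidean_space"
  assumes S: "open S" and "open T" and "Ck_on n f S" "Ck_on n g T" and fT: "f ` S \<subseteq> T"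
  shows "Ck_on n (\<lambda>x. g (f x)) S"
  using assms(3,4)
proof (induction n arbitrary: g)
  case 0
  then show ?case using continuous_on_compose2[of T g S f] fT by simp
next
  case (Suc n)
  have lin: "linear (frechet_derivative g (at y))" if "y \<in> T" for y
    using Ck_on_SucD[OF Suc.prems(2) that] has_derivative_linear by blast
  show ?case
  proof (rule Ck_on_SucI[OF S])
    fix x assume x: "x \<in> S"
    then have fx: "f x \<in> T" using fT by auto
    have "((\<lambda>x. g (f x)) has_derivative (\<lambda>v. frechet_derivative g (at (f x)) (frechet_derivative f (at x) v))) (at x)"
      by (rule has_derivative_compose[OF Ck_on_SucD[OF Suc.prems(1) x] Ck_on_SucD[OF Suc.prems(2) fx]])
    moreover have "frechet_derivative g (at (f x)) w = (\<Sum>b\<in>Basis. (w \<bullet> b) *\<^sub>R frechet_derivative g (at (f x)) b)" for w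
      by (subst euclidean_representation[of w, symmetric])
        (simp add: linear_sum[OF lin[OF fx]] linear_scale[OF lin[OF fx]])
    ultimately show "((\<lambda>x. g (f x)) has_derivative
        (\<lambda>v. \<Sum>b\<in>Basis. (frechet_derivative f (at x) v \<bullet> b) *\<^sub>R frechet_derivative g (at (f x)) b)) (at x)"
      by (elim has_derivative_eq_rhs) (rule ext)
  next
    fix v
    show "Ck_on n (\<lambda>x. \<Sum>b\<in>Basis. (frechet_derivative f (at x) v \<bullet> b) *\<^sub>R frechet_derivative g (at (f x)) b) S"
      by (intro Ck_on_sum[OF S] Ck_on_bilinear[OF S bounded_bilinear_scaleR]
          Ck_on_linear[OF S bounded_linear_inner_left] Ck_on_SucD2[OF Suc.prems(1)]
          Suc.IH Ck_on_SucD2[OF Suc.prems(2)] Ck_on_Suc_imp[OF Suc.prems(1)])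
  qed
qed

lemma Ck_on_Pair:
  assumes S: "open S" and "Ck_on n f S" "Ck_on n g S"
  shows "Ck_on n (\<lambda>x. (f x, g x)) S"
proof -
  have "Ck_on n (\<lambda>x. (f x, 0) + (0, g x)) S"
    by (intro Ck_on_add S Ck_on_linear[OF S _ assms(2), of "\<lambda>y. (y, 0)"]
        Ck_on_linear[OF S _ assms(3), of "\<lambda>y. (0, y)"] bounded_linear_intros)
  then show ?thesis by simp
qed

lemma smooth_on_cong:
  "open S \<Longrightarrow> (\<And>x. x \<in> S \<Longrightarrow> f x = g x) \<Longrightarrow> smooth_on f S \<Longrightarrow> smooth_on g S"
  unfolding smooth_on_def using Ck_on_cong by blast
lemma smooth_on_subset: "smooth_on f S \<Longrightarrow> T \<subseteq> S \<Longrightarrow> smooth_on f T"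
  unfolding smooth_on_def using Ck_on_subset by blast
lemma smooth_on_UN:
  "(\<And>i. i \<in> I \<Longrightarrow> open (S i)) \<Longrightarrow> (\<And>i. i \<in> I \<Longrightarrow> smooth_on f (S i)) \<Longrightarrow> smooth_on f (\<Union>i\<in>I. S i)"
  unfolding smooth_on_def using Ck_on_UN by blast
lemma smooth_on_const: "open S \<Longrightarrow> smooth_on (\<lambda>x. c) S"
  by (simp add: smooth_on_def Ck_on_const)
lemma smooth_on_ident: "open S \<Longrightarrow> smooth_on (\<lambda>x. x) S"
  by (simp add: smooth_on_def Ck_on_ident)
lemma smooth_on_linear:
  "open S \<Longrightarrow> bounded_linear h \<Longrightarrow> smooth_on f S \<Longrightarrow> smooth_on (\<lambda>x. h (f x)) S"
  by (simp add: smooth_on_def Ck_on_linear)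
lemma smooth_on_bilinear:
  "open S \<Longrightarrow> bounded_bilinear h \<Longrightarrow> smooth_on f S \<Longrightarrow> smooth_on g S \<Longrightarrow> smooth_on (\<lambda>x. h (f x) (g x)) S"
  by (simp add: smooth_on_def Ck_on_bilinear)
lemma smooth_on_add:
  "open S \<Longrightarrow> smooth_on f S \<Longrightarrow> smooth_on g S \<Longrightarrow> smooth_on (\<lambda>x. f x + g x) S"
  by (simp add: smooth_on_def Ck_on_add)
lemma smooth_on_mult:
  fixes f g :: "'a::euclidean_space \<Rightarrow> real"
  shows "open S \<Longrightarrow> smooth_on f S \<Longrightarrow> smooth_on g S \<Longrightarrow> smooth_on (\<lambda>x. f x * g x) S"
  by (rule smooth_on_bilinear[OF _ bounded_bilinear_mult])
lemma smooth_on_compose: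
  "open S \<Longrightarrow> open T \<Longrightarrow> smooth_on f S \<Longrightarrow> smooth_on g T \<Longrightarrow> f ` S \<subseteq> T \<Longrightarrow> smooth_on (\<lambda>x. g (f x)) S"
  unfolding smooth_on_def using Ck_on_compose by blast
lemma smooth_on_Pair:
  "open S \<Longrightarrow> smooth_on f S \<Longrightarrow> smooth_on g S \<Longrightarrow> smooth_on (\<lambda>x. (f x, g x)) S"
  by (simp add: smooth_on_def Ck_on_Pair)
lemma smooth_on_has_derivative:
  "smooth_on f S \<Longrightarrow> x \<in> S \<Longrightarrow> (f has_derivative frechet_derivative f (at x)) (at x)"
  unfolding smooth_on_def using Ck_on_SucD by blast
lemma smooth_on_derivative: "smooth_on f S \<Longrightarrow> smooth_on (\<lambda>x. frechet_derivative f (at x) v) S"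
  unfolding smooth_on_def using Ck_on_SucD2 by blast
lemma smooth_on_imp_continuous_on: "smooth_on f S \<Longrightarrow> continuous_on S f"
  unfolding smooth_on_def by (metis Ck_on.simps(1))

lemma smooth_on_exp: "open S \<Longrightarrow> smooth_on (exp :: real \<Rightarrow> real) S"
  unfolding smooth_on_def
proof
  fix n assume S: "open S"
  show "Ck_on n (exp :: real \<Rightarrow> real) S"
  proof (induction n)
    case (Suc n)
    show ?case
    proof (rule Ck_on_SucI[OF S])
      show "(exp has_derivative (\<lambda>v. exp x * v)) (at x)" for x :: real
        using DERIV_exp[of x] unfolding has_field_derivative_def .
      show "Ck_on n (\<lambda>x. exp x * v) S" for v
        by (rule Ck_on_bilinear[OF S bounded_bilinear_mult Suc Ck_on_const[OF S]])
    qed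
  qed (simp add: continuous_on_exp)
qed

text \<open>The derivatives of \<open>exp (- 1 / x)\<close>, extended by zero, are linear combinations of these functions.
  The whole family is treated together because it is closed under differentiation.\<close>

definition flat :: "nat \<Rightarrow> real \<Rightarrow> real" where
  "flat k x = (if x > 0 then (1 / x) ^ k * exp (- (1 / x)) else 0)"

lemma flat_has_derivative:
  "(flat k has_real_derivative flat (k + 2) x - real k * flat (k + 1) x) (at x)"
proof -
  consider "x > 0" | "x < 0" | "x = 0" by linarith
  then show ?thesis
  proof cases
    case 1
    have "((\<lambda>x. (1 / x) ^ k * exp (- (1 / x))) has_real_derivative
        real k * (1 / x) ^ (k - Suc 0) * (- (1 / x\<^sup>2)) * exp (- (1 / x)) + (1 / x) ^ k * (exp (- (1 / x)) * (1 / x\<^sup>2))) (at x)"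
      using 1 by (auto intro!: derivative_eq_intros simp: power2_eq_square)
    moreover have "real k * (1 / x) ^ (k - Suc 0) * (- (1 / x\<^sup>2)) * exp (- (1 / x)) + (1 / x) ^ k * (exp (- (1 / x)) * (1 / x\<^sup>2))
        = flat (k + 2) x - real k * flat (k + 1) x"
      using 1 by (cases k) (simp_all add: flat_def power2_eq_square algebra_simps add_divide_distrib)
    ultimately have "((\<lambda>x. (1 / x) ^ k * exp (- (1 / x))) has_real_derivative flat (k + 2) x - real k * flat (k + 1) x) (at x)"
      by simp
    then show ?thesis
      by (rule has_field_derivative_transform_within_open[where S = "{0<..}"]) (use 1 in \<open>auto simp: flat_def\<close>)
  next
    case 2
    have "((\<lambda>x. 0) has_real_derivative flat (k + 2) x - real k * flat (k + 1) x) (at x)"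
      using 2 by (auto simp: flat_def)
    then show ?thesis
      by (rule has_field_derivative_transform_within_open[where S = "{..<0}"]) (use 2 in \<open>auto simp: flat_def\<close>)
  next
    case 3
    \<comment> \<open>At 0 the exponential beats every power of \<open>1 / y\<close>.\<close>
    have R: "((\<lambda>y. flat k y / y) \<longlongrightarrow> 0) (at_right 0)"
    proof -
      have "((\<lambda>y::real. (1 / y) ^ k * exp (- (1 / y)) / y) \<longlongrightarrow> 0) (at_right 0)"
        by real_asymp
      then show ?thesis
        by (rule Lim_transform_eventually) (auto simp: flat_def eventually_at_filter)
    qed
    have L: "((\<lambda>y. flat k y / y) \<longlongrightarrow> 0) (at_left 0)"
      by (rule Lim_transform_eventually[OF tendsto_const]) (auto simp: flat_def eventually_at_filter)
    have "((\<lambda>y. flat k y / y) \<longlongrightarrow> 0) (at 0)"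
      using R L by (simp add: filterlim_split_at_real)
    then show ?thesis using 3 by (simp add: has_field_derivative_iff flat_def)
  qed
qed

lemma smooth_on_flat: "open S \<Longrightarrow> smooth_on (flat k) S"
  unfolding smooth_on_def
proof
  fix n assume S: "open S"
  show "Ck_on n (flat k) S"
  proof (induction n arbitrary: k)
    case 0
    then show ?case
      using flat_has_derivative DERIV_isCont continuous_at_imp_continuous_on by (metis Ck_on.simps(1))
  next
    case (Suc n)
    have eq: "flat (k + 2) x - real k * flat (k + 1) x = flat (k + 2) x + (- real k) * flat (k + 1) x" for x
      by simp
    show ?case
    proof (rule Ck_on_SucI[OF S])
      show "(flat k has_derivative (\<lambda>v. (flat (k + 2) x + (- real k) * flat (k + 1) x) * v)) (at x)" for x
        using flat_has_derivative[of k x] unfolding eq has_field_derivative_def .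
      show "Ck_on n (\<lambda>x. (flat (k + 2) x + (- real k) * flat (k + 1) x) * v) S" for v
        by (intro Ck_on_bilinear[OF S bounded_bilinear_mult] Ck_on_add[OF S] Ck_on_const[OF S] Suc)
    qed
  qed
qed

lemma smooth_bump:
  fixes a :: "'a::euclidean_space"
  assumes "r > 0"
  obtains b :: "'a \<Rightarrow> real" where "smooth_on b UNIV" "\<And>x. dist a x < r \<Longrightarrow> b x > 0" "\<And>x. dist a x \<ge> r \<Longrightarrow> b x = 0"
proof
  let ?b = "\<lambda>x. flat 0 (r^2 + (- 1) * ((x + (- a)) \<bullet> (x + (- a))))"
  have "smooth_on (\<lambda>x. r^2 + (- 1) * ((x + (- a)) \<bullet> (x + (- a)))) UNIV"
    by (intro smooth_on_add smooth_on_mult smooth_on_bilinear[OF _ bounded_bilinear_inner] smooth_on_const smooth_on_ident open_UNIV)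
  then show "smooth_on ?b UNIV"
    by (rule smooth_on_compose[OF open_UNIV open_UNIV _ smooth_on_flat]) auto
  have nn: "(x + (- a)) \<bullet> (x + (- a)) = (dist a x)^2" for x
    by (simp add: dist_norm power2_norm_eq_inner[symmetric] norm_minus_commute)
  show "?b x > 0" if "dist a x < r" for x
    unfolding nn using that power_strict_mono[of "dist a x" r 2] by (simp add: flat_def)
  show "?b x = 0" if "dist a x \<ge> r" for x
    unfolding nn using that power_mono[of r "dist a x" 2] assms by (simp add: flat_def not_less)
qed

lemma segment_in_convex:
  assumes "convex B" "a \<in> B" "x \<in> B" "t \<in> {0..1::real}"
  shows "a + t *\<^sub>R (x - a) \<in> B"
proof -
  have "(1 - t) *\<^sub>R a + t *\<^sub>R x \<in> B" using assms by (intro convexD) auto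
  then show ?thesis by (simp add: algebra_simps)
qed

text \<open>Differentiation under the integral sign replaces \<open>f\<close> by a directional derivative and
  \<open>m\<close> by \<open>m + 1\<close>; the power of \<open>t\<close> is there to make the induction on the order go through.\<close>

lemma Ck_on_moment:
  fixes f :: "'a::euclidean_space \<Rightarrow> 'b::euclidean_space"
  assumes "open B" "convex B" "a \<in> B" "Ck_on n f B"
  shows "Ck_on n (\<lambda>x. integral {0..1} (\<lambda>t. t ^ m *\<^sub>R f (a + t *\<^sub>R (x - a)))) B"
  using assms(4)
proof (induction n arbitrary: f m)
  have inB: "a + t *\<^sub>R (x - a) \<in> B" if "x \<in> B" "t \<in> {0..1}" for x t
    by (rule segment_in_convex[OF assms(2,3) that])
  {
    case 0
    have "continuous_on (B \<times> cbox 0 1) (\<lambda>(x, t). t ^ m *\<^sub>R f (a + t *\<^sub>R (x - a)))"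
      unfolding split_beta
      by (intro continuous_intros continuous_on_compose2[OF 0[simplified]]) (use inB in auto)
    then show ?case
      using integral_continuous_on_param[of B 0 "1::real" "\<lambda>x t. t ^ m *\<^sub>R f (a + t *\<^sub>R (x - a))"]
      by (simp add: cbox_interval)
  next
    case (Suc n)
    define F where "F = (\<lambda>x (t::real). Blinfun (\<lambda>v. t ^ Suc m *\<^sub>R frechet_derivative f (at (a + t *\<^sub>R (x - a))) v))"
    have D: "(f has_derivative frechet_derivative f (at x)) (at x)" if "x \<in> B" for x
      using Ck_on_SucD[OF Suc.prems that] .
    have C: "Ck_on n (\<lambda>x. frechet_derivative f (at x) v) B" for v using Suc.prems by simp
    have C0: "continuous_on B (\<lambda>x. frechet_derivative f (at x) v)" for v
      using C[of v]
    proof (induction n)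
      case (Suc n) then show ?case using Ck_on_Suc_imp by blast
    qed simp
    have F: "blinfun_apply (F x t) = (\<lambda>v. t ^ Suc m *\<^sub>R frechet_derivative f (at (a + t *\<^sub>R (x - a))) v)"
      if "x \<in> B" "t \<in> {0..1}" for x t
      unfolding F_def
      by (intro bounded_linear_Blinfun_apply bounded_linear_intros has_derivative_bounded_linear[OF D] inB that)
    have hd: "((\<lambda>x. t ^ m *\<^sub>R f (a + t *\<^sub>R (x - a))) has_derivative blinfun_apply (F x t)) (at x within B)"
      if "x \<in> B" "t \<in> cbox 0 1" for x t
    proof -
      have t: "t \<in> {0..1}" using that by (simp add: cbox_interval)
      have lin: "linear (frechet_derivative f (at (a + t *\<^sub>R (x - a))))"
        using D[OF inB[OF that(1) t]] has_derivative_linear by blast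
      have "((\<lambda>x. f (a + t *\<^sub>R (x - a))) has_derivative (\<lambda>v. frechet_derivative f (at (a + t *\<^sub>R (x - a))) (t *\<^sub>R v))) (at x within B)"
        by (rule has_derivative_compose[where f = "\<lambda>x. a + t *\<^sub>R (x - a)" and g = f, OF _ D[OF inB[OF that(1) t]]])
          (auto intro!: derivative_eq_intros)
      then have "((\<lambda>x. t ^ m *\<^sub>R f (a + t *\<^sub>R (x - a))) has_derivative (\<lambda>v. t ^ m *\<^sub>R frechet_derivative f (at (a + t *\<^sub>R (x - a))) (t *\<^sub>R v))) (at x within B)"
        by (rule has_derivative_scaleR_right)
      then show ?thesis unfolding F[OF that(1) t] by (simp add: linear_scale[OF lin] mult.commute)
    qed
    have cF: "continuous_on (B \<times> cbox 0 1) (\<lambda>(x, t). F x t)"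
      unfolding split_beta
    proof (rule continuous_on_blinfun_componentwise)
      fix i :: 'a
      have "continuous_on (B \<times> cbox 0 1) (\<lambda>y. snd y ^ Suc m *\<^sub>R frechet_derivative f (at (a + snd y *\<^sub>R (fst y - a))) i)"
        by (intro continuous_intros continuous_on_compose2[OF C0]) (use inB in \<open>auto simp: cbox_interval\<close>)
      then show "continuous_on (B \<times> cbox 0 1) (\<lambda>x. blinfun_apply (F (fst x) (snd x)) i)"
        by (subst continuous_on_cong[OF refl, where g = "(\<lambda>y. snd y ^ Suc m *\<^sub>R frechet_derivative f (at (a + snd y *\<^sub>R (fst y - a))) i)"])
           (auto simp: F cbox_interval)
    qed
    have cf: "continuous_on B f" using D has_derivative_continuous continuous_at_imp_continuous_on by blast
    have int: "(\<lambda>t. t ^ m *\<^sub>R f (a + t *\<^sub>R (x - a))) integrable_on cbox 0 1" if "x \<in> B" for x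
      by (intro integrable_continuous continuous_intros continuous_on_compose2[OF cf]) (use inB that in \<open>auto simp: cbox_interval\<close>)
    show ?case
    proof (rule Ck_on_SucI[OF assms(1)])
      fix x assume x: "x \<in> B"
      have iF: "F x integrable_on cbox 0 1"
        by (rule integrable_continuous, rule continuous_on_compose2[OF cF, of _ "\<lambda>t. (x, t)", simplified])
          (use x in \<open>auto intro!: continuous_intros\<close>)
      have "((\<lambda>x. integral (cbox 0 1) (\<lambda>t. t ^ m *\<^sub>R f (a + t *\<^sub>R (x - a)))) has_derivative blinfun_apply (integral (cbox 0 1) (F x))) (at x within B)"
        by (rule leibniz_rule[OF hd int cF x assms(2)])
      moreover have "blinfun_apply (integral (cbox 0 1) (F x)) v = integral (cbox 0 1) (\<lambda>t. t ^ Suc m *\<^sub>R frechet_derivative f (at (a + t *\<^sub>R (x - a))) v)" for v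
        unfolding blinfun_apply_integral[OF iF]
        by (rule integral_cong) (simp add: F[OF x] cbox_interval)
      ultimately have "((\<lambda>x. integral (cbox 0 1) (\<lambda>t. t ^ m *\<^sub>R f (a + t *\<^sub>R (x - a)))) has_derivative (\<lambda>v. integral (cbox 0 1) (\<lambda>t. t ^ Suc m *\<^sub>R frechet_derivative f (at (a + t *\<^sub>R (x - a))) v))) (at x)"
        by (metis (no_types, lifting) ext at_within_open assms(1) x)
      then show "((\<lambda>x. integral {0..1} (\<lambda>t. t ^ m *\<^sub>R f (a + t *\<^sub>R (x - a)))) has_derivative (\<lambda>v. integral {0..1} (\<lambda>t. t ^ Suc m *\<^sub>R frechet_derivative f (at (a + t *\<^sub>R (x - a))) v))) (at x)"
        by (simp add: cbox_interval)
    next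
      show "Ck_on n (\<lambda>x. integral {0..1} (\<lambda>t. t ^ Suc m *\<^sub>R frechet_derivative f (at (a + t *\<^sub>R (x - a))) v)) B" for v
        by (rule Suc.IH[OF C])
    qed
  }
qed

text \<open>The function \<open>h i\<close> is the mean of the partial derivative in direction \<open>i\<close> over the segment
  from \<open>a\<close> to \<open>x\<close>, so the expansion is the fundamental theorem of calculus on this segment.\<close>

lemma hadamard:
  fixes f :: "'a::euclidean_space \<Rightarrow> real"
  assumes B: "open B" "convex B" "a \<in> B" and f: "smooth_on f B"
  obtains h where "\<And>i. smooth_on (h i) B" "\<And>x. x \<in> B \<Longrightarrow> f x = f a + (\<Sum>i\<in>Basis. ((x - a) \<bullet> i) * h i x)"
    "\<And>i. h i a = frechet_derivative f (at a) i"
proof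
  define h where "h = (\<lambda>i x. integral {0..1} (\<lambda>t. t ^ 0 *\<^sub>R frechet_derivative f (at (a + t *\<^sub>R (x - a))) i))"
  show "smooth_on (h i) B" for i
    unfolding smooth_on_def h_def
    using Ck_on_moment[OF B, of _ "\<lambda>x. frechet_derivative f (at x) i" 0] smooth_on_derivative[OF f, of i]
    unfolding smooth_on_def by blast
  show "h i a = frechet_derivative f (at a) i" for i by (simp add: h_def)
  show "f x = f a + (\<Sum>i\<in>Basis. ((x - a) \<bullet> i) * h i x)" if x: "x \<in> B" for x
  proof -
    have inB: "a + t *\<^sub>R (x - a) \<in> B" if "t \<in> {0..1}" for t
      by (rule segment_in_convex[OF B(2,3) x that])
    let ?D = "\<lambda>t. frechet_derivative f (at (a + t *\<^sub>R (x - a)))"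
    have D: "(f has_derivative ?D t) (at (a + t *\<^sub>R (x - a)))" if "t \<in> {0..1}" for t
      using smooth_on_has_derivative[OF f inB[OF that]] .
    have ci: "continuous_on {0..1} (\<lambda>t. ?D t i)" for i
      by (rule continuous_on_compose2[OF smooth_on_imp_continuous_on[OF smooth_on_derivative[OF f, of i]]])
        (use inB in \<open>auto intro!: continuous_intros\<close>)
    have exp: "?D t (x - a) = (\<Sum>i\<in>Basis. ((x - a) \<bullet> i) * ?D t i)" if "t \<in> {0..1}" for t
    proof -
      have lin: "linear (?D t)" using D[OF that] has_derivative_linear by blast
      show ?thesis
        by (subst euclidean_representation[of "x - a", symmetric])
          (simp only: linear_sum[OF lin] linear_scale[OF lin] real_scaleR_def)
    qed
    have "((\<lambda>t. ?D t (x - a)) has_integral (f (a + 1 *\<^sub>R (x - a)) - f (a + 0 *\<^sub>R (x - a)))) {0..1}"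
    proof (rule fundamental_theorem_of_calculus)
      fix t :: real assume t: "t \<in> {0..1}"
      have lin: "linear (?D t)" using D[OF t] has_derivative_linear by blast
      have "((\<lambda>t. f (a + t *\<^sub>R (x - a))) has_derivative (\<lambda>s. ?D t (s *\<^sub>R (x - a)))) (at t within {0..1})"
        by (rule has_derivative_compose[where f = "\<lambda>t. a + t *\<^sub>R (x - a)" and g = f, OF _ D[OF t]])
          (auto intro!: derivative_eq_intros)
      then show "((\<lambda>t. f (a + t *\<^sub>R (x - a))) has_vector_derivative ?D t (x - a)) (at t within {0..1})"
        by (simp add: has_vector_derivative_def linear_scale[OF lin])
    qed simp
    then have "f x - f a = integral {0..1} (\<lambda>t. ?D t (x - a))"
      by (simp add: integral_unique)
    also have "\<dots> = integral {0..1} (\<lambda>t. \<Sum>i\<in>Basis. ((x - a) \<bullet> i) * ?D t i)"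
      by (rule integral_cong) (rule exp)
    also have "\<dots> = (\<Sum>i\<in>Basis. ((x - a) \<bullet> i) * h i x)"
      unfolding h_def
      by (subst integral_sum) (auto intro!: integrable_continuous_real continuous_intros ci)
    finally show ?thesis by simp
  qed
qed

section \<open>Vector fields as derivations\<close>

definition chart_deriv ::
    "'m set \<Rightarrow> ('m \<Rightarrow> 'e::euclidean_space) \<Rightarrow> 'e \<Rightarrow> ('m \<Rightarrow> real) \<Rightarrow> 'm \<Rightarrow> real" where
  "chart_deriv U \<phi> v f p = frechet_derivative (f \<circ> inv_into U \<phi>) (at (\<phi> p)) v"

locale smooth_manifold =
  fixes A :: "('m::{t2_space,second_countable_topology}, 'e::euclidean_space) atlas"
  assumes atlas: "smooth_atlas A"
begin

abbreviation "VF \<equiv> vector_fields A"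

lemma chart_homeo:
  assumes "(U, \<phi>) \<in> A"
  shows "open U" "open (\<phi> ` U)" "homeomorphism U (\<phi> ` U) \<phi> (inv_into U \<phi>)"
  using atlas assms unfolding smooth_atlas_def by auto

lemma chart_inv:
  assumes "(U, \<phi>) \<in> A"
  shows "q \<in> U \<Longrightarrow> inv_into U \<phi> (\<phi> q) = q" "x \<in> \<phi> ` U \<Longrightarrow> \<phi> (inv_into U \<phi> x) = x"
    "x \<in> \<phi> ` U \<Longrightarrow> inv_into U \<phi> x \<in> U"
  using chart_homeo(3)[OF assms] by (auto simp: homeomorphism_def inv_into_into)

lemma chart_cont:
  assumes "(U, \<phi>) \<in> A"
  shows "continuous_on U \<phi>" "continuous_on (\<phi> ` U) (inv_into U \<phi>)"
  using chart_homeo(3)[OF assms] by (auto simp: homeomorphism_def)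

lemma chart_at: obtains U \<phi> where "(U, \<phi>) \<in> A" "p \<in> U"
  using atlas unfolding smooth_atlas_def by blast

lemma chart_open_image:
  assumes "(U, \<phi>) \<in> A" "open V"
  shows "open (\<phi> ` (U \<inter> V))"
proof -
  have "\<phi> ` (U \<inter> V) = \<phi> ` U \<inter> inv_into U \<phi> -` V"
    using chart_inv[OF assms(1)] by (auto simp: image_iff)
  then show ?thesis
    using continuous_open_preimage[OF chart_cont(2)[OF assms(1)] chart_homeo(2)[OF assms(1)] assms(2)] by simp
qed

lemma smooth_fun_chart: "smooth_fun A f \<Longrightarrow> (U, \<phi>) \<in> A \<Longrightarrow> smooth_on (f \<circ> inv_into U \<phi>) (\<phi> ` U)"
  unfolding smooth_fun_def by auto

text \<open>Smoothness is required in every chart of the atlas, but the transition maps carry it over from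
  one chart around each point.\<close>

lemma smooth_fun_local:
  assumes loc: "\<And>p. \<exists>U \<phi> N. (U, \<phi>) \<in> A \<and> p \<in> U \<and> open N \<and> N \<subseteq> \<phi> ` U \<and> \<phi> p \<in> N \<and> smooth_on (f \<circ> inv_into U \<phi>) N"
  shows "smooth_fun A f"
  unfolding smooth_fun_def
proof clarify
  fix V \<psi> assume V: "(V, \<psi>) \<in> A"
  have "\<exists>W. open W \<and> y \<in> W \<and> W \<subseteq> \<psi> ` V \<and> smooth_on (f \<circ> inv_into V \<psi>) W" if y: "y \<in> \<psi> ` V" for y
  proof -
    obtain U \<phi> N where U: "(U, \<phi>) \<in> A" and p: "inv_into V \<psi> y \<in> U" and N: "open N" "N \<subseteq> \<phi> ` U"
      "\<phi> (inv_into V \<psi> y) \<in> N" and sm: "smooth_on (f \<circ> inv_into U \<phi>) N"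
      using loc[of "inv_into V \<psi> y"] by blast
    have oVU: "open (\<psi> ` (V \<inter> U))" by (rule chart_open_image[OF V chart_homeo(1)[OF U]])
    have tr: "smooth_on (\<phi> \<circ> inv_into V \<psi>) (\<psi> ` (V \<inter> U))"
      using atlas U V unfolding smooth_atlas_def by fast
    define W where "W = \<psi> ` (V \<inter> U) \<inter> (\<phi> \<circ> inv_into V \<psi>) -` N"
    have W: "open W" unfolding W_def
      by (rule continuous_open_preimage[OF smooth_on_imp_continuous_on[OF tr] oVU N(1)])
    have yW: "y \<in> W" unfolding W_def using y p N(3) chart_inv[OF V] by (auto simp: image_iff intro!: bexI[of _ "inv_into V \<psi> y"])
    have "smooth_on (\<lambda>x. (f \<circ> inv_into U \<phi>) ((\<phi> \<circ> inv_into V \<psi>) x)) W"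
      by (rule smooth_on_compose[OF W N(1) smooth_on_subset[OF tr] sm]) (auto simp: W_def)
    then have "smooth_on (f \<circ> inv_into V \<psi>) W"
      by (rule smooth_on_cong[OF W, rotated]) (use chart_inv[OF U] chart_inv[OF V] in \<open>auto simp: W_def\<close>)
    then show ?thesis using W yW unfolding W_def by blast
  qed
  then obtain W where W: "\<And>y. y \<in> \<psi> ` V \<Longrightarrow> open (W y) \<and> y \<in> W y \<and> W y \<subseteq> \<psi> ` V \<and> smooth_on (f \<circ> inv_into V \<psi>) (W y)"
    by metis
  have "smooth_on (f \<circ> inv_into V \<psi>) (\<Union>y\<in>\<psi> ` V. W y)"
    by (rule smooth_on_UN) (use W in auto)
  moreover have "(\<Union>y\<in>\<psi> ` V. W y) = \<psi> ` V" using W by blast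
  ultimately show "smooth_on (f \<circ> inv_into V \<psi>) (\<psi> ` V)" by simp
qed

lemma smooth_fun_const: "smooth_fun A (\<lambda>p. c)"
  unfolding smooth_fun_def comp_def
proof clarify
  fix U \<phi> assume "(U, \<phi>) \<in> A"
  then show "smooth_on (\<lambda>x. c) (\<phi> ` U)" by (intro smooth_on_const chart_homeo(2))
qed

lemma smooth_fun_add: "smooth_fun A f \<Longrightarrow> smooth_fun A h \<Longrightarrow> smooth_fun A (\<lambda>p. f p + h p)"
  unfolding smooth_fun_def comp_def using smooth_on_add chart_homeo by fast

lemma smooth_fun_mult: "smooth_fun A f \<Longrightarrow> smooth_fun A h \<Longrightarrow> smooth_fun A (\<lambda>p. f p * h p)"
  unfolding smooth_fun_def comp_def using smooth_on_mult chart_homeo by fast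

lemma smooth_fun_uminus: "smooth_fun A f \<Longrightarrow> smooth_fun A (\<lambda>p. - f p)"
  using smooth_fun_mult[OF smooth_fun_const[of "-1"], of f] by simp

lemma smooth_fun_diff: "smooth_fun A f \<Longrightarrow> smooth_fun A h \<Longrightarrow> smooth_fun A (\<lambda>p. f p - h p)"
  using smooth_fun_add[OF _ smooth_fun_uminus, of f h] by simp

lemma smooth_fun_sum: "(\<And>i. i \<in> I \<Longrightarrow> smooth_fun A (f i)) \<Longrightarrow> smooth_fun A (\<lambda>p. \<Sum>i\<in>I. f i p)"
  by (induction I rule: infinite_finite_induct) (auto intro: smooth_fun_const smooth_fun_add)

lemma smooth_fun_exp: "smooth_fun A f \<Longrightarrow> smooth_fun A (\<lambda>p. exp (f p))"
  unfolding smooth_fun_def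
  by (auto simp: comp_def intro!: smooth_on_compose[OF chart_homeo(2) open_UNIV _ smooth_on_exp[OF open_UNIV]])

definition extend_zero :: "'m set \<Rightarrow> ('m \<Rightarrow> 'e) \<Rightarrow> 'e set \<Rightarrow> ('e \<Rightarrow> real) \<Rightarrow> 'm \<Rightarrow> real" where
  "extend_zero U \<phi> N h = (\<lambda>q. if q \<in> U \<and> \<phi> q \<in> N then h (\<phi> q) else 0)"

text \<open>The preimage of \<open>K\<close> in the manifold is compact, hence closed because the manifold is Hausdorff.
  So a point outside the chart has a neighbourhood on which the extension vanishes.\<close>

lemma smooth_fun_extend_zero:
  assumes U: "(U, \<phi>) \<in> A" and N: "open N" "N \<subseteq> \<phi> ` U" and K: "compact K" "K \<subseteq> N"
    and h: "smooth_on h N" and z: "\<And>x. x \<in> N - K \<Longrightarrow> h x = 0"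
  shows "smooth_fun A (extend_zero U \<phi> N h)" (is "smooth_fun A ?f")
proof (rule smooth_fun_local)
  fix p
  define K' where "K' = inv_into U \<phi> ` K"
  have "compact K'" unfolding K'_def
    by (rule compact_continuous_image[OF continuous_on_subset[OF chart_cont(2)[OF U]] K(1)]) (use K N in auto)
  then have oK: "open (- K')" by (simp add: compact_imp_closed open_Compl)
  show "\<exists>U \<phi> N. (U, \<phi>) \<in> A \<and> p \<in> U \<and> open N \<and> N \<subseteq> \<phi> ` U \<and> \<phi> p \<in> N \<and> smooth_on (?f \<circ> inv_into U \<phi>) N"
  proof (cases "p \<in> U \<and> \<phi> p \<in> N")
    case True
    have "smooth_on (?f \<circ> inv_into U \<phi>) N"
      by (rule smooth_on_cong[OF N(1) _ h]) (use chart_inv[OF U] N in \<open>auto simp: subset_iff extend_zero_def\<close>)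
    then show ?thesis using U True N by blast
  next
    case False
    then have pK: "p \<in> - K'" unfolding K'_def using K N chart_inv[OF U] by (auto simp: subset_iff)
    obtain V \<psi> where V: "(V, \<psi>) \<in> A" "p \<in> V" using chart_at .
    have o: "open (\<psi> ` (V \<inter> - K'))" by (rule chart_open_image[OF V(1) oK])
    have "?f q = 0" if "q \<in> - K'" for q
      using that z[of "\<phi> q"] chart_inv(1)[OF U, of q] unfolding K'_def by (auto simp: image_iff extend_zero_def) metis
    then have "smooth_on (?f \<circ> inv_into V \<psi>) (\<psi> ` (V \<inter> - K'))"
      by (intro smooth_on_cong[OF o _ smooth_on_const[OF o, of 0]]) (use chart_inv(1)[OF V(1)] in \<open>force simp del: ComplD\<close>)
    then show ?thesis using V o pK by blast
  qed
qed

lemma chart_has_derivative: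
  assumes "(U, \<phi>) \<in> A" "p \<in> U" "smooth_fun A f"
  shows "((f \<circ> inv_into U \<phi>) has_derivative (\<lambda>v. chart_deriv U \<phi> v f p)) (at (\<phi> p))"
  unfolding chart_deriv_def
  using smooth_on_has_derivative[OF smooth_fun_chart[OF assms(3,1)]] assms(2) by blast

lemma chart_deriv_eqI:
  assumes "((f \<circ> inv_into U \<phi>) has_derivative D) (at (\<phi> p))"
  shows "chart_deriv U \<phi> v f p = D v"
  using frechet_derivative_at[OF assms] by (simp add: chart_deriv_def)

lemma chart_deriv_linear:
  assumes "(U, \<phi>) \<in> A" "p \<in> U" "smooth_fun A f"
  shows "linear (\<lambda>v. chart_deriv U \<phi> v f p)"
  using chart_has_derivative[OF assms] has_derivative_linear by blast

lemma chart_deriv_basis: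
  assumes "(U, \<phi>) \<in> A" "p \<in> U" "smooth_fun A f"
  shows "chart_deriv U \<phi> v f p = (\<Sum>i\<in>Basis. (v \<bullet> i) * chart_deriv U \<phi> i f p)"
  by (subst euclidean_representation[of v, symmetric])
    (simp only: linear_sum[OF chart_deriv_linear[OF assms]] linear_scale[OF chart_deriv_linear[OF assms]] real_scaleR_def)

lemma chart_deriv_add:
  assumes "(U, \<phi>) \<in> A" "p \<in> U" "smooth_fun A f" "smooth_fun A h"
  shows "chart_deriv U \<phi> v (\<lambda>p. f p + h p) p = chart_deriv U \<phi> v f p + chart_deriv U \<phi> v h p"
  by (rule chart_deriv_eqI)
    (use has_derivative_add[OF chart_has_derivative[OF assms(1,2,3)] chart_has_derivative[OF assms(1,2,4)]] in \<open>simp add: comp_def\<close>)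

lemma chart_deriv_mult:
  assumes "(U, \<phi>) \<in> A" "p \<in> U" "smooth_fun A f" "smooth_fun A h"
  shows "chart_deriv U \<phi> v (\<lambda>p. f p * h p) p = chart_deriv U \<phi> v f p * h p + f p * chart_deriv U \<phi> v h p"
  using chart_deriv_eqI[of "\<lambda>p. f p * h p" U \<phi>, unfolded comp_def,
      OF has_derivative_mult[OF chart_has_derivative[OF assms(1,2,3), unfolded comp_def]
        chart_has_derivative[OF assms(1,2,4), unfolded comp_def]], of v]
    chart_inv(1)[OF assms(1,2)] by simp

lemma chart_deriv_const: "chart_deriv U \<phi> v (\<lambda>p. c) p = 0"
  by (rule chart_deriv_eqI) (simp add: comp_def)

lemma chart_deriv_cmult:
  assumes "(U, \<phi>) \<in> A" "p \<in> U" "smooth_fun A f"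
  shows "chart_deriv U \<phi> v (\<lambda>p. c * f p) p = c * chart_deriv U \<phi> v f p"
  using chart_deriv_mult[OF assms(1,2) smooth_fun_const assms(3), of v c] by (simp add: chart_deriv_const)

lemma vf_nonsmooth: "X \<in> VF \<Longrightarrow> \<not> smooth_fun A f \<Longrightarrow> X f p = 0"
  unfolding vector_fields_def by auto
lemma vf_smooth: "X \<in> VF \<Longrightarrow> smooth_fun A (X f)"
  unfolding vector_fields_def using smooth_fun_const[of 0] by auto
lemma vf_add: "X \<in> VF \<Longrightarrow> smooth_fun A f \<Longrightarrow> smooth_fun A h \<Longrightarrow> X (\<lambda>p. f p + h p) p = X f p + X h p"
  unfolding vector_fields_def by auto
lemma vf_mult: "X \<in> VF \<Longrightarrow> smooth_fun A f \<Longrightarrow> smooth_fun A h \<Longrightarrow> X (\<lambda>p. f p * h p) p = X f p * h p + f p * X h p"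
  unfolding vector_fields_def by auto
lemma vf_cmult: "X \<in> VF \<Longrightarrow> smooth_fun A f \<Longrightarrow> X (\<lambda>p. c * f p) p = c * X f p"
  unfolding vector_fields_def by auto
text \<open>As for every derivation: \<open>1 = 1 * 1\<close> gives \<open>X 1 = 2 * X 1\<close>.\<close>

lemma vf_const: "X \<in> VF \<Longrightarrow> X (\<lambda>p. c) p = 0"
  using vf_mult[of X "\<lambda>p. 1" "\<lambda>p. 1" p] vf_cmult[of X "\<lambda>p. 1" c p] smooth_fun_const by simp
lemma vf_diff: "X \<in> VF \<Longrightarrow> smooth_fun A f \<Longrightarrow> smooth_fun A h \<Longrightarrow> X (\<lambda>p. f p - h p) p = X f p - X h p"
  using vf_add[of X f "\<lambda>p. (-1) * h p" p] vf_cmult[of X h "-1"] smooth_fun_mult[OF smooth_fun_const[of "-1"], of h] by simp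
lemma vf_sum: "X \<in> VF \<Longrightarrow> (\<And>i. i \<in> I \<Longrightarrow> smooth_fun A (f i)) \<Longrightarrow> X (\<lambda>p. \<Sum>i\<in>I. f i p) p = (\<Sum>i\<in>I. X (f i) p)"
proof (induction I rule: infinite_finite_induct)
  case (insert i I)
  have "X (\<lambda>p. f i p + (\<Sum>i\<in>I. f i p)) p = X (f i) p + X (\<lambda>p. \<Sum>i\<in>I. f i p) p"
    using insert.prems by (intro vf_add smooth_fun_sum) auto
  then show ?case using insert by simp
qed (simp_all add: vf_const)

lemma vector_fieldI:
  assumes "\<And>f p. \<not> smooth_fun A f \<Longrightarrow> X f p = 0" "\<And>f. smooth_fun A f \<Longrightarrow> smooth_fun A (X f)"
    and "\<And>f h p. smooth_fun A f \<Longrightarrow> smooth_fun A h \<Longrightarrow> X (\<lambda>p. f p + h p) p = X f p + X h p"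
    and m: "\<And>f h p. smooth_fun A f \<Longrightarrow> smooth_fun A h \<Longrightarrow> X (\<lambda>p. f p * h p) p = X f p * h p + f p * X h p"
    and "\<And>c f p. smooth_fun A f \<Longrightarrow> X (\<lambda>p. c * f p) p = c * X f p"
  shows "X \<in> VF"
  unfolding vector_fields_def using assms by auto

lemma vadd_vf: "X \<in> VF \<Longrightarrow> Y \<in> VF \<Longrightarrow> vadd X Y \<in> VF"
  unfolding vadd_def
  by (rule vector_fieldI) (auto simp: vf_nonsmooth vf_add vf_mult vf_cmult algebra_simps intro: smooth_fun_add vf_smooth)

lemma vmult_vf: "X \<in> VF \<Longrightarrow> smooth_fun A h \<Longrightarrow> vmult h X \<in> VF"
  unfolding vmult_def
  by (rule vector_fieldI) (auto simp: vf_nonsmooth vf_add vf_mult vf_cmult algebra_simps intro: smooth_fun_mult vf_smooth)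

lemma zero_vf: "(\<lambda>f p. 0) \<in> VF"
  by (rule vector_fieldI) (auto intro: smooth_fun_const)

lemma vdiff_eq: "vdiff X Y = vadd X (vmult (\<lambda>p. -1) Y)"
  by (simp add: vdiff_def vadd_def vmult_def)

lemma vdiff_vf: "X \<in> VF \<Longrightarrow> Y \<in> VF \<Longrightarrow> vdiff X Y \<in> VF"
  unfolding vdiff_eq by (intro vadd_vf vmult_vf smooth_fun_const)

lemma vbracket_vf:
  assumes X: "X \<in> VF" and Y: "Y \<in> VF"
  shows "vbracket X Y \<in> VF"
  unfolding vbracket_def
proof (rule vector_fieldI)
  note [simp] = vf_add[OF X] vf_add[OF Y] vf_mult[OF X] vf_mult[OF Y] vf_cmult[OF X] vf_cmult[OF Y]
    vf_smooth[OF X] vf_smooth[OF Y] vf_const[OF X] vf_const[OF Y] smooth_fun_add smooth_fun_mult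
  show "X (Y f) p - Y (X f) p = 0" if "\<not> smooth_fun A f" for f p
  proof -
    have "X f = (\<lambda>p. 0)" "Y f = (\<lambda>p. 0)" using that vf_nonsmooth X Y by blast+
    then show ?thesis by simp
  qed
  show "smooth_fun A (\<lambda>p. X (Y f) p - Y (X f) p)" for f
    by (intro smooth_fun_diff) simp_all
  fix f h p assume f: "smooth_fun A f"
  have c: "X (\<lambda>p. c * f p) = (\<lambda>p. c * X f p)" "Y (\<lambda>p. c * f p) = (\<lambda>p. c * Y f p)" for c using f by auto
  show "X (Y (\<lambda>p. c * f p)) p - Y (X (\<lambda>p. c * f p)) p = c * (X (Y f) p - Y (X f) p)" for c
    unfolding c by (simp add: algebra_simps)
  assume h: "smooth_fun A h"
  have a: "X (\<lambda>p. f p + h p) = (\<lambda>p. X f p + X h p)" "Y (\<lambda>p. f p + h p) = (\<lambda>p. Y f p + Y h p)" using f h by auto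
  show "X (Y (\<lambda>p. f p + h p)) p - Y (X (\<lambda>p. f p + h p)) p = X (Y f) p - Y (X f) p + (X (Y h) p - Y (X h) p)"
    unfolding a by simp
  have m: "X (\<lambda>p. f p * h p) = (\<lambda>p. X f p * h p + f p * X h p)" "Y (\<lambda>p. f p * h p) = (\<lambda>p. Y f p * h p + f p * Y h p)"
    using f h by auto
  show "X (Y (\<lambda>p. f p * h p)) p - Y (X (\<lambda>p. f p * h p)) p =
      (X (Y f) p - Y (X f) p) * h p + f p * (X (Y h) p - Y (X h) p)"
    unfolding m using f h by (simp add: algebra_simps)
qed

lemma sum_vf: "(\<And>i. i \<in> I \<Longrightarrow> X i \<in> VF) \<Longrightarrow> (\<lambda>f p. \<Sum>i\<in>I. X i f p) \<in> VF"
proof (induction I rule: infinite_finite_induct)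
  case (insert i I)
  then show ?case using vadd_vf[of "X i" "\<lambda>f p. \<Sum>i\<in>I. X i f p"] by (simp add: vadd_def)
qed (simp_all add: zero_vf)

lemma combination_vf:
  assumes "\<And>i. i \<in> I \<Longrightarrow> smooth_fun A (h i)" "\<And>i. i \<in> I \<Longrightarrow> Y i \<in> VF"
  shows "(\<lambda>f q. \<Sum>i\<in>I. h i q * Y i f q) \<in> VF"
  using sum_vf[of I "\<lambda>i. vmult (h i) (Y i)"] vmult_vf assms by (simp add: vmult_def)

text \<open>Used for tensors at a point, where \<open>c i\<close> is the value of \<open>h i\<close> there, and for
  covariant derivatives of combinations with constant coefficients.\<close>

lemma additive_combination:
  fixes T :: "'m vfield \<Rightarrow> real"
  assumes add: "\<And>X Y. X \<in> VF \<Longrightarrow> Y \<in> VF \<Longrightarrow> T (vadd X Y) = T X + T Y"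
    and "finite I" "\<And>i. i \<in> I \<Longrightarrow> smooth_fun A (h i)" "\<And>i. i \<in> I \<Longrightarrow> Y i \<in> VF"
    and "\<And>i. i \<in> I \<Longrightarrow> T (vmult (h i) (Y i)) = c i * T (Y i)"
  shows "T (\<lambda>f q. \<Sum>i\<in>I. h i q * Y i f q) = (\<Sum>i\<in>I. c i * T (Y i))"
  using assms(2-)
proof (induction I)
  case empty
  then show ?case using add[OF zero_vf zero_vf] by (simp add: vadd_def)
next
  case (insert i I)
  have "T (vadd (vmult (h i) (Y i)) (\<lambda>f q. \<Sum>i\<in>I. h i q * Y i f q)) =
      T (vmult (h i) (Y i)) + T (\<lambda>f q. \<Sum>i\<in>I. h i q * Y i f q)"
    using insert.prems by (intro add vmult_vf combination_vf) auto
  moreover have "vadd (vmult (h i) (Y i)) (\<lambda>f q. \<Sum>i\<in>I. h i q * Y i f q) = (\<lambda>f q. \<Sum>i\<in>insert i I. h i q * Y i f q)"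
    using insert.hyps by (simp add: vadd_def vmult_def)
  ultimately show ?case using insert by simp
qed

lemma chart_ball:
  assumes "(U, \<phi>) \<in> A" "p \<in> U"
  obtains r where "r > 0" "ball (\<phi> p) r \<subseteq> \<phi> ` U"
  using chart_homeo(2)[OF assms(1)] assms(2) by (metis imageI open_contains_ball)

text \<open>Global smooth functions are made from functions in one chart by multiplication with a bump
  function. The arguments below multiply whole identities by the bump function and divide by its
  value at the point, so what counts is that this value is positive.\<close>

lemma cutoff:
  assumes U: "(U, \<phi>) \<in> A" and p: "p \<in> U"
  obtains B :: "'e set" and b :: "'e \<Rightarrow> real"
  where "open B" "convex B" "\<phi> p \<in> B" "B \<subseteq> \<phi> ` U" "b (\<phi> p) > 0" "smooth_on b B"
    "\<And>h. smooth_on h B \<Longrightarrow> smooth_fun A (extend_zero U \<phi> B (\<lambda>x. b x * h x))"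
proof -
  obtain r where r: "r > 0" "ball (\<phi> p) r \<subseteq> \<phi> ` U" using chart_ball[OF U p] .
  define B where "B = ball (\<phi> p) r"
  define K where "K = cball (\<phi> p) (r / 2)"
  have B: "open B" "convex B" "\<phi> p \<in> B" "B \<subseteq> \<phi> ` U" using r by (auto simp: B_def)
  have K: "compact K" "K \<subseteq> B" using r by (auto simp: K_def B_def)
  obtain b where b: "smooth_on b UNIV" "\<And>x. dist (\<phi> p) x < r / 2 \<Longrightarrow> b x > (0::real)" "\<And>x. dist (\<phi> p) x \<ge> r / 2 \<Longrightarrow> b x = 0"
    by (rule smooth_bump[of "r / 2" "\<phi> p"]) (use r in auto)
  have bB: "smooth_on b B" using b(1) smooth_on_subset by blast
  have "smooth_fun A (extend_zero U \<phi> B (\<lambda>x. b x * h x))" if "smooth_on h B" for h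
    by (rule smooth_fun_extend_zero[OF U B(1,4) K smooth_on_mult[OF B(1) bB that]])
      (auto simp: K_def b(3))
  moreover have "b (\<phi> p) > 0" using b(2)[of "\<phi> p"] r by simp
  ultimately show thesis using that[OF B _ bB] by blast
qed

text \<open>Hadamard's expansion of \<open>f\<close> at \<open>p\<close>, multiplied by the square of a cutoff function \<open>\<gamma>\<close>, is
  an identity between global smooth functions. Its remainder is a sum of products
  \<open>u i * k i\<close> in which \<open>u i\<close>, the product of \<open>\<gamma>\<close> and a coordinate centred at \<open>p\<close>, vanishes at \<open>p\<close>. So
  \<open>X\<close> at \<open>p\<close> gives the values of \<open>X\<close> on the functions \<open>u i\<close> times the partial derivatives of \<open>f\<close>.\<close>

lemma vector_field_at:
  assumes X: "X \<in> VF" and U: "(U, \<phi>) \<in> A" and p: "p \<in> U"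
  obtains v where "\<And>f. smooth_fun A f \<Longrightarrow> X f p = chart_deriv U \<phi> v f p"
proof -
  obtain B b where B: "open B" "convex B" "\<phi> p \<in> B" "B \<subseteq> \<phi> ` U" and b: "b (\<phi> p) > 0"
    and ext: "\<And>h. smooth_on h B \<Longrightarrow> smooth_fun A (extend_zero U \<phi> B (\<lambda>x. b x * h x))"
    by (rule cutoff[OF U p]) blast
  define \<gamma> where "\<gamma> = extend_zero U \<phi> B (\<lambda>x. b x * 1)"
  define u where "u = (\<lambda>i. extend_zero U \<phi> B (\<lambda>x. b x * ((x + (- \<phi> p)) \<bullet> i)))"
  have sm\<gamma>: "smooth_fun A \<gamma>" unfolding \<gamma>_def by (rule ext[OF smooth_on_const[OF B(1)]])
  have smu: "smooth_fun A (u i)" for i unfolding u_def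
    by (rule ext) (intro smooth_on_linear[OF B(1) bounded_linear_inner_left] smooth_on_add[OF B(1)] smooth_on_ident[OF B(1)] smooth_on_const[OF B(1)])
  define \<beta> where "\<beta> = b (\<phi> p)"
  have \<beta>: "\<beta> > 0" using b by (simp add: \<beta>_def)
  have \<gamma>p: "\<gamma> p = \<beta>" using p B by (simp add: \<gamma>_def extend_zero_def \<beta>_def)
  have up: "u i p = 0" for i by (simp add: u_def extend_zero_def)
  have "X f p = chart_deriv U \<phi> (\<Sum>i\<in>Basis. (X (u i) p / \<beta>) *\<^sub>R i) f p" if f: "smooth_fun A f" for f
  proof -
    have F: "smooth_on (f \<circ> inv_into U \<phi>) B" using smooth_fun_chart[OF f U] B(4) smooth_on_subset by blast
    obtain h where h: "\<And>i. smooth_on (h i) B"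
      "\<And>x. x \<in> B \<Longrightarrow> (f \<circ> inv_into U \<phi>) x = (f \<circ> inv_into U \<phi>) (\<phi> p) + (\<Sum>i\<in>Basis. ((x - \<phi> p) \<bullet> i) * h i x)"
      "\<And>i. h i (\<phi> p) = frechet_derivative (f \<circ> inv_into U \<phi>) (at (\<phi> p)) i"
      by (rule hadamard[OF B(1-3) F]) blast
    define k where "k = (\<lambda>i. extend_zero U \<phi> B (\<lambda>x. b x * h i x))"
    have smk: "smooth_fun A (k i)" for i unfolding k_def by (rule ext[OF h(1)])
    have kp: "k i p = \<beta> * chart_deriv U \<phi> i f p" for i
      using p B by (simp add: k_def extend_zero_def \<beta>_def h(3) chart_deriv_def)
    have smg2: "smooth_fun A (\<lambda>q. \<gamma> q * \<gamma> q)" by (intro smooth_fun_mult sm\<gamma>)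
    have id: "(\<gamma> q * \<gamma> q) * f q = f p * (\<gamma> q * \<gamma> q) + (\<Sum>i\<in>Basis. u i q * k i q)" for q
    proof (cases "q \<in> U \<and> \<phi> q \<in> B")
      case True
      then have "f q = f p + (\<Sum>i\<in>Basis. ((\<phi> q - \<phi> p) \<bullet> i) * h i (\<phi> q))"
        using h(2)[of "\<phi> q"] chart_inv(1)[OF U] p by simp
      then show ?thesis using True
        by (simp add: \<gamma>_def u_def k_def extend_zero_def algebra_simps sum_distrib_left)
    next
      case False
      then show ?thesis by (auto simp: \<gamma>_def u_def k_def extend_zero_def)
    qed
    have "X (\<lambda>q. (\<gamma> q * \<gamma> q) * f q) p = X (\<lambda>q. f p * (\<gamma> q * \<gamma> q) + (\<Sum>i\<in>Basis. u i q * k i q)) p"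
      using id by simp
    also have "\<dots> = f p * X (\<lambda>q. \<gamma> q * \<gamma> q) p + (\<Sum>i\<in>Basis. X (\<lambda>q. u i q * k i q) p)"
    proof -
      have s: "smooth_fun A (\<lambda>q. u i q * k i q)" for i by (rule smooth_fun_mult[OF smu smk])
      have "X (\<lambda>q. f p * (\<gamma> q * \<gamma> q) + (\<Sum>i\<in>Basis. u i q * k i q)) p
          = X (\<lambda>q. f p * (\<gamma> q * \<gamma> q)) p + X (\<lambda>q. \<Sum>i\<in>Basis. u i q * k i q) p"
        by (rule vf_add[OF X smooth_fun_mult[OF smooth_fun_const smg2] smooth_fun_sum[OF s]])
      then show ?thesis using vf_cmult[OF X smg2] vf_sum[where I = Basis and f = "\<lambda>i q. u i q * k i q", OF X s] by simp
    qed
    also have "(\<Sum>i\<in>Basis. X (\<lambda>q. u i q * k i q) p) = (\<Sum>i\<in>Basis. X (u i) p * (\<beta> * chart_deriv U \<phi> i f p))"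
      by (simp add: vf_mult[OF X smu smk] up kp)
    finally have "\<beta> * \<beta> * X f p = (\<Sum>i\<in>Basis. X (u i) p * (\<beta> * chart_deriv U \<phi> i f p))"
      using vf_mult[OF X smg2 f, of p] \<gamma>p by simp
    also have "\<dots> = \<beta> * \<beta> * (\<Sum>i\<in>Basis. (X (u i) p / \<beta>) * chart_deriv U \<phi> i f p)"
      unfolding sum_distrib_left by (rule sum.cong) (use \<beta> in auto)
    finally have "X f p = (\<Sum>i\<in>Basis. (X (u i) p / \<beta>) * chart_deriv U \<phi> i f p)" using \<beta> by simp
    also have "\<dots> = chart_deriv U \<phi> (\<Sum>i\<in>Basis. (X (u i) p / \<beta>) *\<^sub>R i) f p"
      by (simp add: linear_sum[OF chart_deriv_linear[OF U p f]] linear_scale[OF chart_deriv_linear[OF U p f]])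
    finally show ?thesis .
  qed
  then show thesis using that by blast
qed

text \<open>The cutoff function \<open>\<gamma>\<close>, the cut-off coordinates \<open>u i\<close> and the cut-off coordinate fields \<open>Z i\<close>.
  By the last property \<open>\<gamma> * Y (u i) - u i * Y \<gamma>\<close> is \<open>\<gamma>\<^sup>2\<close> times the \<open>i\<close>-th component of a vector
  field \<open>Y\<close>: the derivative of \<open>\<gamma>\<close> itself cancels. So the components of a vector field are
  smooth, and \<open>\<gamma>\<^sup>3\<close> times the field is a combination of the fields \<open>Z i\<close> on the whole manifold.\<close>

lemma chart_coordinates:
  assumes U: "(U, \<phi>) \<in> A" and p: "p \<in> U"
  obtains B b \<gamma> u Z where "open B" "\<phi> p \<in> B" "B \<subseteq> \<phi> ` U" "b (\<phi> p) > 0"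
    "smooth_fun A \<gamma>" "\<And>i. smooth_fun A (u i)" "\<gamma> p = b (\<phi> p)" "\<And>i. u i p = 0"
    "\<And>i. Z i \<in> VF"
    "\<And>q. \<not> (q \<in> U \<and> \<phi> q \<in> B) \<Longrightarrow> \<gamma> q = 0"
    "\<And>i q. \<not> (q \<in> U \<and> \<phi> q \<in> B) \<Longrightarrow> u i q = 0"
    "\<And>i q f. smooth_fun A f \<Longrightarrow> q \<in> U \<Longrightarrow> \<phi> q \<in> B \<Longrightarrow> Z i f q = \<gamma> q * chart_deriv U \<phi> i f q"
    "\<And>i q v. q \<in> U \<Longrightarrow> \<phi> q \<in> B \<Longrightarrow> \<gamma> q * chart_deriv U \<phi> v (u i) q - u i q * chart_deriv U \<phi> v \<gamma> q = \<gamma> q * \<gamma> q * (v \<bullet> i)"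
proof -
  obtain B b where B: "open B" "convex B" "\<phi> p \<in> B" "B \<subseteq> \<phi> ` U" and b: "b (\<phi> p) > 0" "smooth_on b B"
    and ext: "\<And>h. smooth_on h B \<Longrightarrow> smooth_fun A (extend_zero U \<phi> B (\<lambda>x. b x * h x))"
    by (rule cutoff[OF U p]) blast
  define c :: "'e \<Rightarrow> 'e \<Rightarrow> real" where "c = (\<lambda>i x. (x + (- \<phi> p)) \<bullet> i)"
  have c: "smooth_on (c i) B" for i unfolding c_def
    by (intro smooth_on_linear[OF B(1) bounded_linear_inner_left] smooth_on_add[OF B(1)] smooth_on_ident[OF B(1)] smooth_on_const[OF B(1)])
  define \<gamma> where "\<gamma> = extend_zero U \<phi> B (\<lambda>x. b x * 1)"
  define u where "u = (\<lambda>i. extend_zero U \<phi> B (\<lambda>x. b x * c i x))"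
  define Z where "Z = (\<lambda>i f. if smooth_fun A f then extend_zero U \<phi> B (\<lambda>x. b x * frechet_derivative (f \<circ> inv_into U \<phi>) (at x) i) else (\<lambda>p. 0))"
  have sm\<gamma>: "smooth_fun A \<gamma>" unfolding \<gamma>_def by (rule ext[OF smooth_on_const[OF B(1)]])
  have smu: "smooth_fun A (u i)" for i unfolding u_def by (rule ext[OF c])
  have Zin: "Z i f q = \<gamma> q * chart_deriv U \<phi> i f q" if "smooth_fun A f" "q \<in> U" "\<phi> q \<in> B" for i f q
    using that by (simp add: Z_def \<gamma>_def extend_zero_def chart_deriv_def)
  have Zout: "Z i f q = 0" if "\<not> (q \<in> U \<and> \<phi> q \<in> B)" for i f q
    using that by (auto simp: Z_def extend_zero_def)
  have Z: "Z i \<in> VF" for i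
  proof (rule vector_fieldI)
    show "Z i f p = 0" if "\<not> smooth_fun A f" for f p using that by (simp add: Z_def)
    show "smooth_fun A (Z i f)" if f: "smooth_fun A f" for f
    proof -
      have "smooth_on (f \<circ> inv_into U \<phi>) B" using smooth_fun_chart[OF f U] B(4) smooth_on_subset by blast
      then have "smooth_fun A (extend_zero U \<phi> B (\<lambda>x. b x * frechet_derivative (f \<circ> inv_into U \<phi>) (at x) i))"
        by (intro ext smooth_on_derivative)
      then show ?thesis using f by (simp add: Z_def)
    qed
    fix f q assume f: "smooth_fun A f"
    show "Z i (\<lambda>p. k * f p) q = k * Z i f q" for k
      using f smooth_fun_mult[OF smooth_fun_const f, of k]
      by (cases "q \<in> U \<and> \<phi> q \<in> B") (auto simp: Zout Zin chart_deriv_cmult[OF U _ f])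
    fix h assume h: "smooth_fun A h"
    show "Z i (\<lambda>p. f p + h p) q = Z i f q + Z i h q"
      using f h smooth_fun_add[OF f h]
      by (cases "q \<in> U \<and> \<phi> q \<in> B") (auto simp: Zout Zin chart_deriv_add[OF U _ f h] algebra_simps)
    show "Z i (\<lambda>p. f p * h p) q = Z i f q * h q + f q * Z i h q"
      using f h smooth_fun_mult[OF f h]
      by (cases "q \<in> U \<and> \<phi> q \<in> B") (auto simp: Zout Zin chart_deriv_mult[OF U _ f h] algebra_simps)
  qed
  have eq: "\<gamma> q * chart_deriv U \<phi> v (u i) q - u i q * chart_deriv U \<phi> v \<gamma> q = \<gamma> q * \<gamma> q * (v \<bullet> i)"
    if q: "q \<in> U" "\<phi> q \<in> B" for i q v
  proof -
    have g: "((\<gamma> \<circ> inv_into U \<phi>) has_derivative (\<lambda>v. chart_deriv U \<phi> v \<gamma> q)) (at (\<phi> q))"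
      by (rule chart_has_derivative[OF U q(1) sm\<gamma>])
    have "((\<lambda>x. (\<gamma> \<circ> inv_into U \<phi>) x * c i x) has_derivative (\<lambda>v. (\<gamma> \<circ> inv_into U \<phi>) (\<phi> q) * (v \<bullet> i) + chart_deriv U \<phi> v \<gamma> q * c i (\<phi> q))) (at (\<phi> q))"
      by (rule has_derivative_mult[OF g]) (auto simp: c_def intro!: derivative_eq_intros)
    then have "((u i \<circ> inv_into U \<phi>) has_derivative (\<lambda>v. (\<gamma> \<circ> inv_into U \<phi>) (\<phi> q) * (v \<bullet> i) + chart_deriv U \<phi> v \<gamma> q * c i (\<phi> q))) (at (\<phi> q))"
      by (rule has_derivative_transform_within_open[OF _ B(1) q(2)])
        (use B(4) chart_inv[OF U] in \<open>auto simp: u_def \<gamma>_def extend_zero_def subset_iff\<close>)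
    then have "chart_deriv U \<phi> v (u i) q = (\<gamma> \<circ> inv_into U \<phi>) (\<phi> q) * (v \<bullet> i) + chart_deriv U \<phi> v \<gamma> q * c i (\<phi> q)"
      by (rule chart_deriv_eqI)
    moreover have "u i q = \<gamma> q * c i (\<phi> q)" using q by (simp add: u_def \<gamma>_def extend_zero_def)
    ultimately show ?thesis using chart_inv(1)[OF U q(1)] by (simp add: algebra_simps)
  qed
  have "\<gamma> q = 0" "u i q = 0" if "\<not> (q \<in> U \<and> \<phi> q \<in> B)" for i q
    using that by (auto simp: u_def \<gamma>_def extend_zero_def)
  moreover have "\<gamma> p = b (\<phi> p)" "u i p = 0" for i
    using p B by (auto simp: u_def \<gamma>_def extend_zero_def c_def)
  ultimately show thesis
    using that[of B b \<gamma> u Z] B b(1) sm\<gamma> smu Z Zin eq by blast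
qed

lemma chart_deriv_nonzero:
  assumes U: "(U, \<phi>) \<in> A" and p: "p \<in> U" and z: "\<And>f. smooth_fun A f \<Longrightarrow> chart_deriv U \<phi> v f p = 0"
  shows "v = 0"
proof -
  obtain B b \<gamma> u where c: "\<phi> p \<in> B" "b (\<phi> p) > 0" "smooth_fun A \<gamma>" "\<And>i. smooth_fun A (u i)" "\<gamma> p = b (\<phi> p)"
    and e: "\<And>i q v. q \<in> U \<Longrightarrow> \<phi> q \<in> B \<Longrightarrow> \<gamma> q * chart_deriv U \<phi> v (u i) q - u i q * chart_deriv U \<phi> v \<gamma> q = \<gamma> q * \<gamma> q * (v \<bullet> i)"
    by (rule chart_coordinates[OF U p]) blast
  have "v \<bullet> i = 0" for i
    using e[OF p c(1), of v i] z[OF c(3)] z[OF c(4)] c(2,5) by simp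
  then show ?thesis by (simp add: euclidean_eq_iff[where 'a='e])
qed

text \<open>Multiplied by \<open>\<gamma>\<^sup>3\<close>, the field \<open>Y\<close> is a global combination of the fields \<open>Z i\<close> with coefficients \<open>w i\<close>
  that vanish at \<open>p\<close> together with \<open>Y\<close>.\<close>

lemma tensor_at:
  fixes T :: "'m vfield \<Rightarrow> real"
  assumes add: "\<And>X Y. X \<in> VF \<Longrightarrow> Y \<in> VF \<Longrightarrow> T (vadd X Y) = T X + T Y"
    and mult: "\<And>h X. smooth_fun A h \<Longrightarrow> X \<in> VF \<Longrightarrow> T (vmult h X) = h p * T X"
    and Y: "Y \<in> VF" and Y0: "\<And>f. Y f p = 0"
  shows "T Y = 0"
proof -
  obtain U \<phi> where U: "(U, \<phi>) \<in> A" and p: "p \<in> U" using chart_at .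
  obtain B b \<gamma> u Z where c: "\<phi> p \<in> B" "b (\<phi> p) > 0" "smooth_fun A \<gamma>" "\<And>i. smooth_fun A (u i)" "\<gamma> p = b (\<phi> p)" "\<And>i. u i p = 0"
    and Z: "\<And>i. Z i \<in> VF"
    and out: "\<And>q. \<not> (q \<in> U \<and> \<phi> q \<in> B) \<Longrightarrow> \<gamma> q = 0" "\<And>i q. \<not> (q \<in> U \<and> \<phi> q \<in> B) \<Longrightarrow> u i q = 0"
    and Zin: "\<And>i q f. smooth_fun A f \<Longrightarrow> q \<in> U \<Longrightarrow> \<phi> q \<in> B \<Longrightarrow> Z i f q = \<gamma> q * chart_deriv U \<phi> i f q"
    and e: "\<And>i q v. q \<in> U \<Longrightarrow> \<phi> q \<in> B \<Longrightarrow> \<gamma> q * chart_deriv U \<phi> v (u i) q - u i q * chart_deriv U \<phi> v \<gamma> q = \<gamma> q * \<gamma> q * (v \<bullet> i)"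
    by (rule chart_coordinates[OF U p]) blast
  define w where "w = (\<lambda>i q. \<gamma> q * Y (u i) q - u i q * Y \<gamma> q)"
  have w: "smooth_fun A (w i)" for i
    unfolding w_def by (intro smooth_fun_diff smooth_fun_mult vf_smooth[OF Y] c)
  \<comment> \<open>Two factors \<open>\<gamma>\<close> belong to \<open>w\<close>, the third to \<open>Z\<close>.\<close>
  have id: "\<gamma> q * \<gamma> q * \<gamma> q * Y f q = (\<Sum>i\<in>Basis. w i q * Z i f q)" for f q
  proof (cases "smooth_fun A f \<and> q \<in> U \<and> \<phi> q \<in> B")
    case True
    then obtain v where v: "\<And>f. smooth_fun A f \<Longrightarrow> Y f q = chart_deriv U \<phi> v f q"
      using vector_field_at[OF Y U, of q] by blast
    have "w i q = \<gamma> q * \<gamma> q * (v \<bullet> i)" for i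
      using e[of q v i] True by (simp add: w_def v c)
    then show ?thesis using True
      by (simp add: v chart_deriv_basis[OF U, of q f v] Zin sum_distrib_left algebra_simps)
  next
    case False
    then show ?thesis
      using vf_nonsmooth[OF Y, of f q] vf_nonsmooth[OF Z, of f _ q] out by (auto simp: w_def)
  qed
  have Tsum: "T (\<lambda>f q. \<Sum>i\<in>Basis. w i q * Z i f q) = (\<Sum>i\<in>Basis. w i p * T (Z i))"
    by (rule additive_combination[OF add]) (auto simp: w Z mult)
  have "vmult (\<lambda>q. \<gamma> q * \<gamma> q * \<gamma> q) Y = (\<lambda>f q. \<Sum>i\<in>Basis. w i q * Z i f q)"
    by (intro ext) (simp add: vmult_def id)
  then have "\<gamma> p * \<gamma> p * \<gamma> p * T Y = (\<Sum>i\<in>Basis. w i p * T (Z i))"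
    using mult[of "\<lambda>q. \<gamma> q * \<gamma> q * \<gamma> q" Y] Tsum Y c by (simp add: smooth_fun_mult)
  moreover have "w i p = 0" for i using Y0 by (simp add: w_def c)
  ultimately show ?thesis using c by simp
qed

lemma vf_exp:
  assumes "X \<in> VF" "smooth_fun A u"
  shows "X (\<lambda>p. exp (u p)) p = exp (u p) * X u p"
proof -
  obtain U \<phi> where U: "(U, \<phi>) \<in> A" "p \<in> U" using chart_at .
  obtain v where v: "\<And>f. smooth_fun A f \<Longrightarrow> X f p = chart_deriv U \<phi> v f p"
    by (rule vector_field_at[OF assms(1) U]) blast
  have "((\<lambda>x. exp ((u \<circ> inv_into U \<phi>) x)) has_derivative (\<lambda>v. chart_deriv U \<phi> v u p * exp ((u \<circ> inv_into U \<phi>) (\<phi> p)))) (at (\<phi> p))"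
    by (rule has_derivative_exp[OF chart_has_derivative[OF U assms(2)]])
  then have "chart_deriv U \<phi> v (\<lambda>p. exp (u p)) p = chart_deriv U \<phi> v u p * exp ((u \<circ> inv_into U \<phi>) (\<phi> p))"
    by (intro chart_deriv_eqI) (simp add: comp_def)
  then show ?thesis using v[OF assms(2)] v[OF smooth_fun_exp[OF assms(2)]] chart_inv(1)[OF U] by simp
qed

end

section \<open>Left-invariant vector fields\<close>

locale lie_grp =
  fixes A :: "('g::{t2_space,second_countable_topology,group_add}, 'e::euclidean_space) atlas"
  assumes lie: "lie_group A"

sublocale lie_grp \<subseteq> smooth_manifold A
  using lie by unfold_locales (simp add: lie_group_def)

context lie_grp
begin

abbreviation "LI \<equiv> left_invariant_fields A"

text \<open>On the open set where the product lies in a chart \<open>W\<close>, the function is \<open>f\<close> in that chart composed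
  with the group law in charts. These sets cover the product of the two chart images.\<close>

lemma smooth_on_product:
  assumes U: "(U, \<phi>) \<in> A" and V: "(V, \<psi>) \<in> A" and f: "smooth_fun A f"
  shows "smooth_on (\<lambda>z. f (inv_into U \<phi> (fst z) + inv_into V \<psi> (snd z))) (\<phi> ` U \<times> \<psi> ` V)"
proof -
  define m where "m = (\<lambda>z. inv_into U \<phi> (fst z) + inv_into V \<psi> (snd z))"
  define S where "S = (\<lambda>W. (\<phi> ` U \<times> \<psi> ` V) \<inter> m -` W)"
  have sm: "smooth_map (product_atlas A A) A (\<lambda>(a, b). a + b)" using lie by (simp add: lie_group_def)
  have "continuous_on UNIV (\<lambda>(a::'g, b). a + b)" using sm by (simp add: smooth_map_def)
  then have cm: "continuous_on (\<phi> ` U \<times> \<psi> ` V) m"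
  proof -
    assume c: "continuous_on UNIV (\<lambda>(a::'g, b). a + b)"
    have "continuous_on (\<phi> ` U \<times> \<psi> ` V) (\<lambda>z. (inv_into U \<phi> (fst z), inv_into V \<psi> (snd z)))"
      by (intro continuous_on_Pair continuous_on_compose2[OF chart_cont(2)[OF U]] continuous_on_compose2[OF chart_cont(2)[OF V]]
          continuous_on_fst continuous_on_snd continuous_on_id) auto
    from continuous_on_compose2[OF c this] show ?thesis by (simp add: m_def)
  qed
  have o: "open (\<phi> ` U \<times> \<psi> ` V)" by (intro open_Times chart_homeo(2) U V)
  have oS: "open (S W)" if "open W" for W
    unfolding S_def by (rule continuous_open_preimage[OF cm o that])
  have inv: "inv_into (U \<times> V) (map_prod \<phi> \<psi>) z = (inv_into U \<phi> (fst z), inv_into V \<psi> (snd z))"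
    if "z \<in> \<phi> ` U \<times> \<psi> ` V" for z
  proof -
    have "inj_on (map_prod \<phi> \<psi>) (U \<times> V)"
      using inj_on_inverseI[of U "inv_into U \<phi>" \<phi>] inj_on_inverseI[of V "inv_into V \<psi>" \<psi>]
        chart_inv(1)[OF U] chart_inv(1)[OF V] by (intro map_prod_inj_on) auto
    moreover have "map_prod \<phi> \<psi> (inv_into U \<phi> (fst z), inv_into V \<psi> (snd z)) = z"
      using that chart_inv(2)[OF U] chart_inv(2)[OF V] by auto
    moreover have "(inv_into U \<phi> (fst z), inv_into V \<psi> (snd z)) \<in> U \<times> V"
      using that chart_inv(3)[OF U] chart_inv(3)[OF V] by auto
    ultimately show ?thesis by (metis inv_into_f_f)
  qed
  have SW: "smooth_on (\<lambda>z. f (m z)) (S (fst c))" if c: "c \<in> A" for c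
  proof -
    obtain W \<eta> where W: "c = (W, \<eta>)" "(W, \<eta>) \<in> A" using c by (cases c) auto
    have "map_prod \<phi> \<psi> ` ((U \<times> V) \<inter> (\<lambda>(a, b). a + b) -` W) = S W"
    proof (intro equalityI subsetI)
      fix z assume "z \<in> map_prod \<phi> \<psi> ` ((U \<times> V) \<inter> (\<lambda>(a, b). a + b) -` W)"
      then show "z \<in> S W" using chart_inv(1)[OF U] chart_inv(1)[OF V] by (auto simp: S_def m_def)
    next
      fix z assume "z \<in> S W"
      then show "z \<in> map_prod \<phi> \<psi> ` ((U \<times> V) \<inter> (\<lambda>(a, b). a + b) -` W)"
        using chart_inv(2,3)[OF U] chart_inv(2,3)[OF V]
        by (intro image_eqI[of _ _ "(inv_into U \<phi> (fst z), inv_into V \<psi> (snd z))"]) (auto simp: S_def m_def)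
    qed
    moreover have "(U \<times> V, map_prod \<phi> \<psi>) \<in> product_atlas A A"
      using U V unfolding product_atlas_def by blast
    ultimately have "smooth_on (\<eta> \<circ> (\<lambda>(a, b). a + b) \<circ> inv_into (U \<times> V) (map_prod \<phi> \<psi>)) (S W)"
      using sm W(2) unfolding smooth_map_def by fastforce
    then have 1: "smooth_on (\<lambda>z. \<eta> (m z)) (S W)"
      by (rule smooth_on_cong[OF oS[OF chart_homeo(1)[OF W(2)]], rotated]) (auto simp: inv S_def m_def)
    have "smooth_on (\<lambda>z. (f \<circ> inv_into W \<eta>) (\<eta> (m z))) (S W)"
      by (rule smooth_on_compose[OF oS[OF chart_homeo(1)[OF W(2)]] chart_homeo(2)[OF W(2)] 1 smooth_fun_chart[OF f W(2)]])
        (auto simp: S_def)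
    then show ?thesis unfolding W(1) fst_conv
      by (rule smooth_on_cong[OF oS[OF chart_homeo(1)[OF W(2)]], rotated]) (use chart_inv(1)[OF W(2)] in \<open>auto simp: S_def\<close>)
  qed
  have oc: "open (S (fst c))" if c: "c \<in> A" for c
    using oS[OF chart_homeo(1)[of "fst c" "snd c"]] c by simp
  have "smooth_on (\<lambda>z. f (m z)) (\<Union>c\<in>A. S (fst c))"
    by (rule smooth_on_UN[OF oc SW])
  moreover have "(\<Union>c\<in>A. S (fst c)) = \<phi> ` U \<times> \<psi> ` V"
  proof -
    have "\<exists>c\<in>A. m z \<in> fst c" for z using chart_at[of "m z"] by (metis fst_conv)
    then show ?thesis unfolding S_def by blast
  qed
  ultimately show ?thesis by (simp add: m_def)
qed

lemma smooth_fun_translate: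
  assumes "smooth_fun A f"
  shows "smooth_fun A (\<lambda>q. f (a + q))"
  unfolding smooth_fun_def
proof clarify
  fix V \<psi> assume V: "(V, \<psi>) \<in> A"
  obtain U \<phi> where U: "(U, \<phi>) \<in> A" "a \<in> U" using chart_at .
  have "smooth_on (\<lambda>y. (\<lambda>z. f (inv_into U \<phi> (fst z) + inv_into V \<psi> (snd z))) (\<phi> a, y)) (\<psi> ` V)"
    by (rule smooth_on_compose[OF chart_homeo(2)[OF V] open_Times[OF chart_homeo(2)[OF U(1)] chart_homeo(2)[OF V]] _ smooth_on_product[OF U(1) V assms]])
      (use U(2) in \<open>auto intro!: smooth_on_Pair smooth_on_const smooth_on_ident chart_homeo(2)[OF V]\<close>)
  then show "smooth_on ((\<lambda>q. f (a + q)) \<circ> inv_into V \<psi>) (\<psi> ` V)"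
    using chart_inv(1)[OF U] by (simp add: comp_def)
qed

lemma smooth_fun_translate_iff: "smooth_fun A (\<lambda>q. f (a + q)) \<longleftrightarrow> smooth_fun A f"
proof
  assume "smooth_fun A (\<lambda>q. f (a + q))"
  from smooth_fun_translate[OF this, of "- a"] show "smooth_fun A f" by simp
qed (rule smooth_fun_translate)

lemma left_invariant_iff:
  "X \<in> LI \<longleftrightarrow> X \<in> VF \<and> (\<forall>a f p. X (\<lambda>q. f (a + q)) p = X f (a + p))"
proof -
  have "(\<forall>a. push_left a X = X) \<longleftrightarrow> (\<forall>a f p. X (\<lambda>q. f (a + q)) (- a + p) = X f p)"
    by (simp add: push_left_def fun_eq_iff)
  also have "\<dots> \<longleftrightarrow> (\<forall>a f p. X (\<lambda>q. f (a + q)) p = X f (a + p))"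
  proof (intro iffI allI)
    fix a f p assume *: "\<forall>a f p. X (\<lambda>q. f (a + q)) (- a + p) = X f p"
    show "X (\<lambda>q. f (a + q)) p = X f (a + p)" using *[rule_format, of f a "a + p"] by simp
  next
    fix a f p assume *: "\<forall>a f p. X (\<lambda>q. f (a + q)) p = X f (a + p)"
    show "X (\<lambda>q. f (a + q)) (- a + p) = X f p" using *[rule_format, of f a "- a + p"] by simp
  qed
  finally show ?thesis by (simp add: left_invariant_fields_def)
qed

lemma left_invariant_vf: "X \<in> LI \<Longrightarrow> X \<in> VF"
  by (simp add: left_invariant_iff)

lemma vadd_left_invariant:
  "X \<in> LI \<Longrightarrow> Y \<in> LI \<Longrightarrow> vadd X Y \<in> LI"
  by (auto simp: left_invariant_iff vadd_vf) (simp add: vadd_def)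

lemma vscale_left_invariant: "X \<in> LI \<Longrightarrow> vmult (\<lambda>p. c) X \<in> LI"
  by (auto simp: left_invariant_iff vmult_vf smooth_fun_const) (simp add: vmult_def)

lemma vbracket_left_invariant:
  assumes X: "X \<in> LI" and Y: "Y \<in> LI"
  shows "vbracket X Y \<in> LI"
proof -
  have "X (\<lambda>q. f (a + q)) = (\<lambda>p. X f (a + p))" "Y (\<lambda>q. f (a + q)) = (\<lambda>p. Y f (a + p))" for f a
    using X Y by (auto simp: left_invariant_iff)
  then show ?thesis
    using X Y unfolding left_invariant_iff by (auto simp: vbracket_vf) (simp add: vbracket_def)
qed

definition base_chart where "base_chart = (SOME c. c \<in> A \<and> (0::'g) \<in> fst c)"

lemma base_chart: "(fst base_chart, snd base_chart) \<in> A" "0 \<in> fst base_chart"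
proof -
  have "\<exists>c. c \<in> A \<and> (0::'g) \<in> fst c" using chart_at[of 0] by (metis fst_conv)
  then have "base_chart \<in> A \<and> 0 \<in> fst base_chart" unfolding base_chart_def by (rule someI_ex)
  then show "(fst base_chart, snd base_chart) \<in> A" "0 \<in> fst base_chart" by auto
qed

text \<open>The left-invariant field whose value at the identity element has the coordinates \<open>v\<close> in a fixed
  chart.\<close>

definition lfield :: "'e \<Rightarrow> 'g vfield" where
  "lfield v = (\<lambda>f p. if smooth_fun A f
     then chart_deriv (fst base_chart) (snd base_chart) v (\<lambda>q. f (p + q)) 0 else 0)"

text \<open>In charts this is a partial derivative, with respect to the second argument, of the function
  \<open>f (p + q)\<close> of two variables.\<close>

lemma lfield_smooth:
  assumes f: "smooth_fun A f"
  shows "smooth_fun A (lfield v f)"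
  unfolding smooth_fun_def
proof clarify
  fix V \<psi> assume V: "(V, \<psi>) \<in> A"
  define U where "U = fst base_chart"
  define \<phi> where "\<phi> = snd base_chart"
  have U: "(U, \<phi>) \<in> A" "0 \<in> U" using base_chart by (simp_all add: U_def \<phi>_def)
  define H where "H = (\<lambda>z. f (inv_into V \<psi> (fst z) + inv_into U \<phi> (snd z)))"
  have H: "smooth_on H (\<psi> ` V \<times> \<phi> ` U)" unfolding H_def by (rule smooth_on_product[OF V U(1) f])
  have *: "smooth_on (\<lambda>x. (\<lambda>z. frechet_derivative H (at z) (0, v)) (x, \<phi> 0)) (\<psi> ` V)"
    by (rule smooth_on_compose[OF chart_homeo(2)[OF V] open_Times[OF chart_homeo(2)[OF V] chart_homeo(2)[OF U(1)]] _ smooth_on_derivative[OF H]])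
      (use U(2) in \<open>auto intro!: smooth_on_Pair smooth_on_const smooth_on_ident chart_homeo(2)[OF V]\<close>)
  have "lfield v f (inv_into V \<psi> x) = frechet_derivative H (at (x, \<phi> 0)) (0, v)" if x: "x \<in> \<psi> ` V" for x
  proof -
    have 1: "(H has_derivative frechet_derivative H (at (x, \<phi> 0))) (at (x, \<phi> 0))"
      by (rule smooth_on_has_derivative[OF H]) (use x U in auto)
    have "((\<lambda>y. H (x, y)) has_derivative (\<lambda>v. frechet_derivative H (at (x, \<phi> 0)) (0, v))) (at (\<phi> 0))"
      by (rule has_derivative_compose[where f = "\<lambda>y. (x, y)" and g = H, OF _ 1]) (auto intro!: derivative_eq_intros)
    then have "chart_deriv U \<phi> v (\<lambda>q. f (inv_into V \<psi> x + q)) 0 = frechet_derivative H (at (x, \<phi> 0)) (0, v)"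
      by (intro chart_deriv_eqI) (simp add: H_def comp_def)
    then show ?thesis using f by (simp add: lfield_def U_def \<phi>_def)
  qed
  then show "smooth_on (lfield v f \<circ> inv_into V \<psi>) (\<psi> ` V)"
    by (intro smooth_on_cong[OF chart_homeo(2)[OF V] _ *]) simp
qed

lemma lfield_vf: "lfield v \<in> VF"
proof (rule vector_fieldI)
  note b = base_chart
  show "lfield v f p = 0" if "\<not> smooth_fun A f" for f p using that by (simp add: lfield_def)
  show "smooth_fun A (lfield v f)" if "smooth_fun A f" for f using lfield_smooth[OF that] .
  fix f p assume f: "smooth_fun A f"
  show "lfield v (\<lambda>p. c * f p) p = c * lfield v f p" for c
    using f smooth_fun_mult[OF smooth_fun_const f, of c] chart_deriv_cmult[OF b smooth_fun_translate[OF f]]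
    by (simp add: lfield_def)
  fix h assume h: "smooth_fun A h"
  show "lfield v (\<lambda>p. f p + h p) p = lfield v f p + lfield v h p"
    using f h smooth_fun_add[OF f h] chart_deriv_add[OF b smooth_fun_translate[OF f] smooth_fun_translate[OF h]]
    by (simp add: lfield_def)
  show "lfield v (\<lambda>p. f p * h p) p = lfield v f p * h p + f p * lfield v h p"
    using f h smooth_fun_mult[OF f h] chart_deriv_mult[OF b smooth_fun_translate[OF f] smooth_fun_translate[OF h]]
    by (simp add: lfield_def)
qed

lemma lfield_left_invariant: "lfield v \<in> LI"
  unfolding left_invariant_iff
proof (intro conjI allI lfield_vf)
  fix a f p
  show "lfield v (\<lambda>q. f (a + q)) p = lfield v f (a + p)"
    using smooth_fun_translate_iff[of f a] by (simp add: lfield_def add.assoc)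
qed

text \<open>By invariance \<open>X f p\<close> is the value of \<open>X\<close> at the identity element on the translate of \<open>f\<close> by \<open>p\<close>.\<close>

lemma left_invariant_eq_lfield:
  assumes X: "X \<in> LI"
  obtains v where "X = lfield v"
proof -
  obtain v where v: "\<And>f. smooth_fun A f \<Longrightarrow> X f 0 = chart_deriv (fst base_chart) (snd base_chart) v f 0"
    by (rule vector_field_at[OF left_invariant_vf[OF X] base_chart]) blast
  have "X f p = lfield v f p" for f p
  proof (cases "smooth_fun A f")
    case True
    have "X f p = X (\<lambda>q. f (p + q)) 0" using X by (simp add: left_invariant_iff)
    then show ?thesis using v[OF smooth_fun_translate[OF True]] True by (simp add: lfield_def)
  next
    case False
    then show ?thesis using vf_nonsmooth[OF left_invariant_vf[OF X]] by (simp add: lfield_def)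
  qed
  then show thesis using that by blast
qed

lemma lfield_add: "lfield (u + v) = vadd (lfield u) (lfield v)"
  by (intro ext) (simp add: lfield_def vadd_def linear_add[OF chart_deriv_linear[OF base_chart smooth_fun_translate]])

lemma lfield_scale: "lfield (c *\<^sub>R v) = vmult (\<lambda>p. c) (lfield v)"
  by (intro ext) (simp add: lfield_def vmult_def linear_scale[OF chart_deriv_linear[OF base_chart smooth_fun_translate]])

lemma lfield_nonzero:
  assumes "v \<noteq> 0"
  shows "\<exists>f. lfield v f 0 \<noteq> 0"
proof -
  obtain f where "smooth_fun A f" "chart_deriv (fst base_chart) (snd base_chart) v f 0 \<noteq> 0"
    using chart_deriv_nonzero[OF base_chart] assms by blast
  then show ?thesis by (auto simp: lfield_def intro!: exI[of _ f])
qed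

end

lemma (in lie_grp) lfield_zero: "lfield 0 = (\<lambda>f p. 0)"
  using lfield_scale[of 0 0] by (simp add: vmult_def)

lemma (in lie_grp) lfield_inj: "inj lfield"
proof (rule injI)
  fix u v assume "lfield u = lfield v"
  then have "lfield (u - v) f 0 = 0" for f
    using lfield_add[of u "(-1) *\<^sub>R v"] lfield_scale[of "-1" v] by (simp add: vadd_def vmult_def)
  then show "u = v" using lfield_nonzero[of "u - v"] by auto
qed

lemma (in lie_grp) lfield_bij: "bij_betw lfield UNIV LI"
  using lfield_inj lfield_left_invariant left_invariant_eq_lfield
  by (auto simp: bij_betw_def) blast

locale lie_grp_metric = lie_grp A
  for A :: "('g::{t2_space,second_countable_topology,group_add}, 'e::euclidean_space) atlas" +
  fixes g :: "'g vfield \<Rightarrow> 'g vfield \<Rightarrow> 'g \<Rightarrow> real"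
  assumes metric: "left_invariant_metric A g"
begin

lemma metric_smooth: "X \<in> VF \<Longrightarrow> Y \<in> VF \<Longrightarrow> smooth_fun A (g X Y)"
  using metric unfolding left_invariant_metric_def riemannian_metric_def one_form_def by blast
lemma metric_sym: "X \<in> VF \<Longrightarrow> Y \<in> VF \<Longrightarrow> g X Y p = g Y X p"
  using metric unfolding left_invariant_metric_def riemannian_metric_def by simp
lemma metric_add_right:
  "X \<in> VF \<Longrightarrow> Y \<in> VF \<Longrightarrow> Z \<in> VF \<Longrightarrow> g X (vadd Y Z) p = g X Y p + g X Z p"
  using metric unfolding left_invariant_metric_def riemannian_metric_def one_form_def by simp
lemma metric_mult_right:
  "X \<in> VF \<Longrightarrow> Y \<in> VF \<Longrightarrow> smooth_fun A h \<Longrightarrow> g X (vmult h Y) p = h p * g X Y p"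
  using metric unfolding left_invariant_metric_def riemannian_metric_def one_form_def by simp
lemma metric_add_left:
  "X \<in> VF \<Longrightarrow> Y \<in> VF \<Longrightarrow> Z \<in> VF \<Longrightarrow> g (vadd X Y) Z p = g X Z p + g Y Z p"
  using metric_add_right[of Z X Y p] metric_sym[of _ Z p] vadd_vf by simp
lemma metric_mult_left:
  "X \<in> VF \<Longrightarrow> Y \<in> VF \<Longrightarrow> smooth_fun A h \<Longrightarrow> g (vmult h X) Y p = h p * g X Y p"
  using metric_mult_right[of Y X h p] metric_sym[of _ Y p] vmult_vf by simp
lemma metric_diff_left:
  "X \<in> VF \<Longrightarrow> Y \<in> VF \<Longrightarrow> Z \<in> VF \<Longrightarrow> g (vdiff X Y) Z p = g X Z p - g Y Z p"
  unfolding vdiff_eq by (simp add: metric_add_left metric_mult_left smooth_fun_const vmult_vf)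
lemma metric_pos: "X \<in> VF \<Longrightarrow> X f p \<noteq> 0 \<Longrightarrow> g X X p > 0"
  using metric unfolding left_invariant_metric_def riemannian_metric_def by blast

lemma metric_left_invariant:
  assumes "X \<in> LI" "Y \<in> LI"
  shows "g X Y p = g X Y 0"
proof -
  have "g (push_left p X) (push_left p Y) (p + 0) = g X Y 0"
    using metric assms unfolding left_invariant_metric_def left_invariant_fields_def by blast
  then show ?thesis using assms by (simp add: left_invariant_fields_def)
qed

text \<open>A metric is only assumed to be linear over the smooth functions; that its value at a point depends
  only on the values of the fields there comes from \<open>tensor_at\<close>.\<close>

lemma metric_zero_at:
  assumes "X \<in> VF" "Y \<in> VF" "\<And>f. X f p = 0"
  shows "g X Y p = 0"
  by (rule tensor_at[of "\<lambda>X. g X Y p"]) (use assms in \<open>auto simp: metric_add_left metric_mult_left\<close>)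

end

lemma (in lie_grp) push_left_vf:
  assumes X: "X \<in> VF"
  shows "push_left a X \<in> VF"
  unfolding push_left_def
proof (rule vector_fieldI)
  show "X (\<lambda>q. f (a + q)) (- a + p) = 0" if "\<not> smooth_fun A f" for f p
    using that smooth_fun_translate_iff[of f a] vf_nonsmooth[OF X] by simp
  show "smooth_fun A (\<lambda>p. X (\<lambda>q. f (a + q)) (- a + p))" for f
    by (rule smooth_fun_translate[OF vf_smooth[OF X]])
  fix f p assume f: "smooth_fun A f"
  show "X (\<lambda>q. c * f (a + q)) (- a + p) = c * X (\<lambda>q. f (a + q)) (- a + p)" for c
    by (rule vf_cmult[OF X smooth_fun_translate[OF f]])
  fix h assume h: "smooth_fun A h"
  show "X (\<lambda>q. f (a + q) + h (a + q)) (- a + p) = X (\<lambda>q. f (a + q)) (- a + p) + X (\<lambda>q. h (a + q)) (- a + p)"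
    by (rule vf_add[OF X smooth_fun_translate[OF f] smooth_fun_translate[OF h]])
  show "X (\<lambda>q. f (a + q) * h (a + q)) (- a + p) = X (\<lambda>q. f (a + q)) (- a + p) * h p + f p * X (\<lambda>q. h (a + q)) (- a + p)"
    using vf_mult[OF X smooth_fun_translate[OF f, of a] smooth_fun_translate[OF h, of a], of "- a + p"] by simp
qed

text \<open>Translation to the identity element turns the value of \<open>X\<close> at \<open>p\<close> into a tangent vector there.\<close>

lemma (in lie_grp) vector_field_at_eq_lfield:
  assumes X: "X \<in> VF"
  obtains v where "\<And>f. X f p = lfield v f p"
proof -
  obtain v where v: "\<And>f. smooth_fun A f \<Longrightarrow> push_left (- p) X f 0 = chart_deriv (fst base_chart) (snd base_chart) v f 0"
    by (rule vector_field_at[OF push_left_vf[OF X] base_chart]) blast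
  have "X f p = lfield v f p" for f
  proof (cases "smooth_fun A f")
    case True
    then show ?thesis using v[OF smooth_fun_translate[OF True, of p]] by (simp add: lfield_def push_left_def)
  next
    case False
    then show ?thesis using vf_nonsmooth[OF X] by (simp add: lfield_def)
  qed
  then show thesis using that by blast
qed

section \<open>Orthonormal left-invariant frames\<close>

lemma enumerate_Basis:
  obtains b :: "nat \<Rightarrow> 'e::euclidean_space" where
    "\<And>i j. i < DIM('e) \<Longrightarrow> j < DIM('e) \<Longrightarrow> b i \<bullet> b j = (if i = j then 1 else 0)"
    "\<And>x. x = (\<Sum>i<DIM('e). (x \<bullet> b i) *\<^sub>R b i)"
proof -
  obtain b where b: "bij_betw b {..<DIM('e)} (Basis :: 'e set)"
    using ex_bij_betw_nat_finite[of "Basis :: 'e set"] by (auto simp: atLeast0LessThan)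
  have "b i \<bullet> b j = (if i = j then 1 else 0)" if "i < DIM('e)" "j < DIM('e)" for i j
  proof -
    have "b i \<in> Basis" "b j \<in> Basis" "b i = b j \<longleftrightarrow> i = j"
      using that b by (auto simp: bij_betw_def inj_on_def)
    then show ?thesis by (simp add: inner_Basis)
  qed
  moreover have "x = (\<Sum>i<DIM('e). (x \<bullet> b i) *\<^sub>R b i)" for x
    using sum.reindex_bij_betw[OF b, of "\<lambda>i. (x \<bullet> i) *\<^sub>R i"] by (simp add: euclidean_representation)
  ultimately show thesis using that by blast
qed

lemma sum_delta_less:
  fixes k n :: nat
  shows "k < n \<Longrightarrow> (\<Sum>i<n. f i * (if i = k then 1 else 0)) = (f k :: real)"
  "k < n \<Longrightarrow> (\<Sum>i<n. f i * (if k = i then 1 else 0)) = f k"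
  "k < n \<Longrightarrow> (\<Sum>i<n. (if i = k then 1 else 0) * f i) = f k"
  "k < n \<Longrightarrow> (\<Sum>i<n. (if k = i then 1 else 0) * f i) = f k"
proof -
  assume k: "k < n"
  have d: "(\<Sum>i<n. if i = k then f i else 0) = f k" using k by (simp add: sum.delta)
  show "(\<Sum>i<n. f i * (if i = k then 1 else 0)) = f k" by (rule trans[OF sum.cong d]) auto
  show "(\<Sum>i<n. f i * (if k = i then 1 else 0)) = f k" by (rule trans[OF sum.cong d]) auto
  show "(\<Sum>i<n. (if i = k then 1 else 0) * f i) = f k" by (rule trans[OF sum.cong d]) auto
  show "(\<Sum>i<n. (if k = i then 1 else 0) * f i) = f k" by (rule trans[OF sum.cong d]) auto
qed

text \<open>The first hypothesis makes \<open>P\<close> injective, so it has a two-sided inverse \<open>Q\<close>, and \<open>a = Q M P\<close>. The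
  type \<open>'e\<close> supplies a vector space of dimension \<open>n\<close> on which \<open>P\<close> acts.\<close>

lemma trace_of_similar:
  fixes P a M :: "nat \<Rightarrow> nat \<Rightarrow> real"
  assumes n: "n = DIM('e::euclidean_space)"
    and inj: "\<And>c. (\<And>k. k < n \<Longrightarrow> (\<Sum>i<n. P k i * c i) = 0) \<Longrightarrow> (\<And>i. i < n \<Longrightarrow> c i = 0)"
    and sim: "\<And>k j. k < n \<Longrightarrow> j < n \<Longrightarrow> (\<Sum>i<n. P k i * a i j) = (\<Sum>i<n. M k i * P i j)"
  shows "(\<Sum>i<n. a i i) = (\<Sum>i<n. M i i)"
proof -
  obtain b :: "nat \<Rightarrow> 'e" where b: "\<And>i j. i < n \<Longrightarrow> j < n \<Longrightarrow> b i \<bullet> b j = (if i = j then 1 else 0)"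
    and bx: "\<And>x. x = (\<Sum>i<n. (x \<bullet> b i) *\<^sub>R b i)"
    unfolding n by (rule enumerate_Basis) blast
  define L :: "'e \<Rightarrow> 'e" where "L x = (\<Sum>k<n. (\<Sum>i<n. P k i * (x \<bullet> b i)) *\<^sub>R b k)" for x
  have Lb: "L x \<bullet> b k = (\<Sum>i<n. P k i * (x \<bullet> b i))" if "k < n" for x k
    using that by (simp add: L_def inner_sum_left b sum_delta_less)
  have lin: "linear L"
    by (rule linearI) (simp_all add: L_def inner_add_left distrib_left sum.distrib scaleR_add_left
        scaleR_sum_right sum_distrib_left mult.left_commute)
  have "inj L"
    unfolding linear_injective_0[OF lin]
  proof (intro allI impI)
    fix x assume "L x = 0"
    then have "x \<bullet> b i = 0" if "i < n" for i
      using inj[of "\<lambda>i. x \<bullet> b i"] Lb[of _ x] that by auto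
    then show "x = 0" using bx[of x] by simp
  qed
  then have "surj L" using linear_injective_imp_surjective[OF lin] by blast
  define Q where "Q i j = inv L (b j) \<bullet> b i" for i j
  have PQ: "(\<Sum>i<n. P k i * Q i j) = (if k = j then 1 else 0)" if "k < n" "j < n" for k j
  proof -
    have "L (inv L (b j)) \<bullet> b k = (if k = j then 1 else 0)"
      using \<open>surj L\<close> that b[of j k] by (simp add: surj_f_inv_f)
    then show ?thesis using Lb[OF that(1)] by (simp add: Q_def)
  qed
  have QP: "(\<Sum>i<n. Q k i * P i j) = (if k = j then 1 else 0)" if "k < n" "j < n" for k j
  proof -
    have "(\<Sum>k<n. P l k * ((\<Sum>i<n. Q k i * P i j) - (if k = j then 1 else 0))) = 0" if l: "l < n" for l
    proof -
      have "(\<Sum>k<n. P l k * (\<Sum>i<n. Q k i * P i j)) = (\<Sum>i<n. (\<Sum>k<n. P l k * Q k i) * P i j)"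
        unfolding sum_distrib_left sum_distrib_right by (subst sum.swap) (simp add: mult.assoc)
      also have "\<dots> = P l j" using PQ[OF l] l by (simp add: sum_delta_less)
      finally show ?thesis using \<open>j < n\<close> by (simp add: right_diff_distrib sum_subtractf sum_delta_less)
    qed
    from inj[OF this \<open>k < n\<close>] show ?thesis by simp
  qed
  have "(\<Sum>j<n. a j j) = (\<Sum>j<n. \<Sum>i<n. (if j = i then 1 else 0) * a i j)"
    by (rule sum.cong) (simp_all add: sum_delta_less)
  also have "\<dots> = (\<Sum>j<n. \<Sum>i<n. (\<Sum>k<n. Q j k * P k i) * a i j)"
    by (intro sum.cong refl) (simp add: QP)
  also have "\<dots> = (\<Sum>j<n. \<Sum>k<n. Q j k * (\<Sum>i<n. P k i * a i j))"
    unfolding sum_distrib_left sum_distrib_right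
    by (rule sum.cong[OF refl]) (subst sum.swap, simp add: mult.assoc)
  also have "\<dots> = (\<Sum>j<n. \<Sum>k<n. Q j k * (\<Sum>i<n. M k i * P i j))"
    by (intro sum.cong refl) (simp add: sim)
  also have "\<dots> = (\<Sum>k<n. \<Sum>i<n. M k i * (\<Sum>j<n. P i j * Q j k))"
  proof -
    have "(\<Sum>j<n. \<Sum>k<n. Q j k * (\<Sum>i<n. M k i * P i j)) = (\<Sum>k<n. \<Sum>j<n. \<Sum>i<n. Q j k * (M k i * P i j))"
      unfolding sum_distrib_left by (rule sum.swap)
    also have "\<dots> = (\<Sum>k<n. \<Sum>i<n. \<Sum>j<n. Q j k * (M k i * P i j))"
      by (rule sum.cong[OF refl]) (rule sum.swap)
    finally show ?thesis unfolding sum_distrib_left by (simp add: mult_ac)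
  qed
  also have "\<dots> = (\<Sum>k<n. M k k)"
    by (intro sum.cong refl) (simp add: PQ sum_delta_less)
  finally show ?thesis .
qed

locale orthonormal_frame = lie_grp_metric A g
  for A :: "('g::{t2_space,second_countable_topology,group_add}, 'e::euclidean_space) atlas" and g +
  fixes E :: "nat \<Rightarrow> 'g vfield"
  assumes E_li: "i < DIM('e) \<Longrightarrow> E i \<in> LI"
    and E_on: "i < DIM('e) \<Longrightarrow> j < DIM('e) \<Longrightarrow> g (E i) (E j) 0 = (if i = j then 1 else 0)"
begin


lemma E_vf: "i < DIM('e) \<Longrightarrow> E i \<in> VF" using E_li left_invariant_vf by blast

lemma E_onp: "i < DIM('e) \<Longrightarrow> j < DIM('e) \<Longrightarrow> g (E i) (E j) p = (if i = j then 1 else 0)"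
  using metric_left_invariant[OF E_li E_li, of i j p] E_on by simp

lemma metric_sum_left:
  assumes "finite I" "\<And>i. i \<in> I \<Longrightarrow> Y i \<in> VF" "\<And>i. i \<in> I \<Longrightarrow> smooth_fun A (h i)" "Z \<in> VF"
  shows "g (\<lambda>f q. \<Sum>i\<in>I. h i q * Y i f q) Z p = (\<Sum>i\<in>I. h i p * g (Y i) Z p)"
  using assms by (intro additive_combination[of "\<lambda>X. g X Z p"]) (auto simp: metric_add_left metric_mult_left)

lemma frame_sum_vf:
  assumes "\<And>i. i < DIM('e) \<Longrightarrow> smooth_fun A (h i)"
  shows "(\<lambda>f q. \<Sum>i<DIM('e). h i q * E i f q) \<in> VF"
  by (rule combination_vf) (auto simp: assms E_vf)

lemma metric_frame_sum:
  assumes "\<And>i. i < DIM('e) \<Longrightarrow> smooth_fun A (h i)" "j < DIM('e)"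
  shows "g (\<lambda>f q. \<Sum>i<DIM('e). h i q * E i f q) (E j) p = h j p"
  using assms E_vf by (subst metric_sum_left) (auto simp: E_onp sum_delta_less)

text \<open>Orthonormal left-invariant fields are linearly independent at the identity element and hence form
  a basis there; left translation carries this to every point.\<close>

lemma frame_span:
  assumes X: "X \<in> VF"
  obtains c where "\<And>f. X f p = (\<Sum>i<DIM('e). c i * E i f p)"
proof -
  have "\<forall>i. \<exists>v. i < DIM('e) \<longrightarrow> E i = lfield v" using left_invariant_eq_lfield[OF E_li] by metis
  then obtain e where e: "\<And>i. i < DIM('e) \<Longrightarrow> E i = lfield (e i)" by metis
  obtain b :: "nat \<Rightarrow> 'e" where b: "\<And>i j. i < DIM('e) \<Longrightarrow> j < DIM('e) \<Longrightarrow> b i \<bullet> b j = (if i = j then 1 else 0)"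
    and bx: "\<And>x. x = (\<Sum>i<DIM('e). (x \<bullet> b i) *\<^sub>R b i)"
    by (rule enumerate_Basis) blast
  define L :: "'e \<Rightarrow> 'e" where "L x = (\<Sum>i<DIM('e). (x \<bullet> b i) *\<^sub>R e i)" for x
  have lin: "linear L"
    by (rule linearI) (simp_all add: L_def inner_add_left scaleR_add_left sum.distrib scaleR_sum_right)
  have Lf: "lfield (L x) f q = (\<Sum>i<DIM('e). (x \<bullet> b i) * E i f q)" for x f q
  proof -
    have "lfield (\<Sum>i\<in>I. (x \<bullet> b i) *\<^sub>R e i) f q = (\<Sum>i\<in>I. (x \<bullet> b i) * lfield (e i) f q)" if "finite I" for I
      using that by (induction I) (simp_all add: lfield_zero lfield_add lfield_scale vadd_def vmult_def)
    then show ?thesis by (simp add: L_def e)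
  qed
  have "inj L"
    unfolding linear_injective_0[OF lin]
  proof (intro allI impI)
    fix x assume "L x = 0"
    then have "(\<lambda>f q. \<Sum>i<DIM('e). (x \<bullet> b i) * E i f q) = (\<lambda>f q. 0)"
      using Lf[of x] by (simp add: lfield_zero)
    then have "x \<bullet> b j = 0" if "j < DIM('e)" for j
      using metric_frame_sum[of "\<lambda>i q. x \<bullet> b i" j 0] that metric_zero_at[OF zero_vf E_vf[OF that]]
      by (simp add: smooth_fun_const)
    then show "x = 0" using bx[of x] by simp
  qed
  then have "surj L" using linear_injective_imp_surjective[OF lin] by blast
  obtain v where v: "\<And>f. X f p = lfield v f p" by (rule vector_field_at_eq_lfield[OF X]) blast
  obtain x where "v = L x" using \<open>surj L\<close> by (metis surjD)
  then show thesis using that[of "\<lambda>i. x \<bullet> b i"] v Lf by simp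
qed

text \<open>By \<open>tensor_at\<close> the field \<open>X\<close> may be replaced by the combination of the frame with constant
  coefficients that agrees with it at \<open>p\<close>; the metric reads off these coefficients.\<close>

lemma frame_tensor:
  fixes T :: "'g vfield \<Rightarrow> real"
  assumes add: "\<And>X Y. X \<in> VF \<Longrightarrow> Y \<in> VF \<Longrightarrow> T (vadd X Y) = T X + T Y"
    and mult: "\<And>h X. smooth_fun A h \<Longrightarrow> X \<in> VF \<Longrightarrow> T (vmult h X) = h p * T X"
    and X: "X \<in> VF"
  shows "T X = (\<Sum>i<DIM('e). g X (E i) p * T (E i))"
proof -
  obtain c where c: "\<And>f. X f p = (\<Sum>i<DIM('e). c i * E i f p)" by (rule frame_span[OF X]) blast
  define S where "S = (\<lambda>f q. \<Sum>i<DIM('e). c i * E i f q)"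
  have S: "S \<in> VF" unfolding S_def using frame_sum_vf[of "\<lambda>i q. c i"] smooth_fun_const by simp
  have TS: "T S = (\<Sum>i<DIM('e). c i * T (E i))"
    unfolding S_def by (rule additive_combination[OF add]) (auto simp: smooth_fun_const E_vf mult)
  have neg: "vmult (\<lambda>q. -1) S \<in> VF" by (intro vmult_vf S smooth_fun_const)
  have "T (vadd X (vmult (\<lambda>q. -1) S)) = 0"
    by (rule tensor_at[OF add mult vadd_vf[OF X neg]]) (simp_all add: c S_def vadd_def vmult_def)
  then have TX: "T X = T S" using add[OF X neg] mult[OF smooth_fun_const S, of "-1"] by simp
  have "g X (E j) p = c j" if j: "j < DIM('e)" for j
  proof -
    have "g (vadd X (vmult (\<lambda>q. -1) S)) (E j) p = 0"
      by (rule metric_zero_at[OF vadd_vf[OF X neg] E_vf[OF j]]) (simp add: c S_def vadd_def vmult_def)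
    moreover have "g S (E j) p = c j"
      unfolding S_def using metric_frame_sum[of "\<lambda>i q. c i" j p] j smooth_fun_const by simp
    ultimately show ?thesis
      by (simp add: metric_add_left[OF X neg E_vf[OF j]] metric_mult_left[OF S E_vf[OF j] smooth_fun_const])
  qed
  then show ?thesis using TX TS by simp
qed

lemma frame_expand:
  assumes X: "X \<in> VF"
  shows "X f p = (\<Sum>i<DIM('e). g X (E i) p * E i f p)"
  by (rule frame_tensor[of "\<lambda>X. X f p"]) (use X in \<open>auto simp: vadd_def vmult_def\<close>)

lemma vf_eqI:
  assumes "X \<in> VF" "Y \<in> VF" "\<And>i p. i < DIM('e) \<Longrightarrow> g X (E i) p = g Y (E i) p"
  shows "X = Y"
  by (intro ext) (simp add: frame_expand[OF assms(1)] frame_expand[OF assms(2)] assms(3))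

lemma metric_expand:
  assumes "X \<in> VF" "Y \<in> VF"
  shows "g X Y p = (\<Sum>i<DIM('e). g X (E i) p * g Y (E i) p)"
proof -
  have "g X Y p = (\<Sum>i<DIM('e). g X (E i) p * g (E i) Y p)"
    by (rule frame_tensor[of "\<lambda>X. g X Y p"]) (use assms in \<open>auto simp: metric_add_left metric_mult_left\<close>)
  then show ?thesis using metric_sym[OF E_vf assms(2)] by simp
qed

text \<open>The description in \<open>trace_at\<close> quantifies over all bases at \<open>p\<close>, so the point is that the matrix
  in an arbitrary basis is similar to the one in the frame.\<close>

lemma trace_at_eq:
  assumes T: "\<And>Z. Z \<in> VF \<Longrightarrow> T Z \<in> VF"
    and add: "\<And>X Y. X \<in> VF \<Longrightarrow> Y \<in> VF \<Longrightarrow> T (vadd X Y) = vadd (T X) (T Y)"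
    and mult: "\<And>h X. smooth_fun A h \<Longrightarrow> X \<in> VF \<Longrightarrow> T (vmult h X) = vmult h (T X)"
  shows "trace_at A p T = (\<Sum>i<DIM('e). g (T (E i)) (E i) p)"
  unfolding trace_at_def
proof (rule the_equality)
  have "basis_at A p E"
    unfolding basis_at_def
  proof (intro conjI allI impI E_vf)
    fix c j assume z: "\<forall>f. (\<Sum>i<DIM('e). c i * E i f p) = 0" and j: "j < DIM('e)"
    have "g (\<lambda>f q. \<Sum>i<DIM('e). c i * E i f q) (E j) p = 0"
      by (rule metric_zero_at[OF frame_sum_vf[of "\<lambda>i q. c i"] E_vf[OF j]]) (use z smooth_fun_const in auto)
    then show "c j = 0" using metric_frame_sum[of "\<lambda>i q. c i" j p] j smooth_fun_const by simp
  qed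
  moreover have "T (E j) f p = (\<Sum>i<DIM('e). g (T (E j)) (E i) p * E i f p)" if "j < DIM('e)" for j f
    by (rule frame_expand[OF T[OF E_vf[OF that]]])
  ultimately show "\<exists>F a. basis_at A p F \<and> (\<forall>j<DIM('e). \<forall>f. T (F j) f p = (\<Sum>i<DIM('e). a i j * F i f p)) \<and>
      (\<Sum>i<DIM('e). g (T (E i)) (E i) p) = (\<Sum>i<DIM('e). a i i)"
    by (intro exI[of _ E] exI[of _ "\<lambda>i j. g (T (E j)) (E i) p"]) auto
next
  fix t assume "\<exists>F a. basis_at A p F \<and> (\<forall>j<DIM('e). \<forall>f. T (F j) f p = (\<Sum>i<DIM('e). a i j * F i f p)) \<and> t = (\<Sum>i<DIM('e). a i i)"
  then obtain F a where F: "basis_at A p F" and a: "\<And>j f. j < DIM('e) \<Longrightarrow> T (F j) f p = (\<Sum>i<DIM('e). a i j * F i f p)"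
    and t: "t = (\<Sum>i<DIM('e). a i i)" by blast
  have Fv: "F i \<in> VF" if "i < DIM('e)" for i using F that by (simp add: basis_at_def)
  have "(\<Sum>i<DIM('e). a i i) = (\<Sum>i<DIM('e). g (T (E i)) (E i) p)"
  proof (rule trace_of_similar[where 'e = 'e and a = a and P = "\<lambda>k i. g (F i) (E k) p" and M = "\<lambda>k i. g (T (E i)) (E k) p"])
    fix c i assume z: "\<And>k. k < DIM('e) \<Longrightarrow> (\<Sum>i<DIM('e). g (F i) (E k) p * c i) = 0" and i: "i < DIM('e)"
    have "(\<Sum>i<DIM('e). c i * F i f p) = 0" for f
    proof -
      have "(\<Sum>i<DIM('e). c i * F i f p) = (\<Sum>i<DIM('e). c i * (\<Sum>k<DIM('e). g (F i) (E k) p * E k f p))"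
        by (rule sum.cong) (simp_all add: frame_expand[OF Fv])
      also have "\<dots> = (\<Sum>k<DIM('e). (\<Sum>i<DIM('e). g (F i) (E k) p * c i) * E k f p)"
        unfolding sum_distrib_left sum_distrib_right by (subst sum.swap) (simp add: mult_ac)
      finally show ?thesis using z by simp
    qed
    then show "c i = 0" using F i unfolding basis_at_def by blast
  next
    fix k j assume k: "k < DIM('e)" and j: "j < DIM('e)"
    have "g (T (F j)) (E k) p = (\<Sum>i<DIM('e). g (F j) (E i) p * g (T (E i)) (E k) p)"
      by (rule frame_tensor[of "\<lambda>X. g (T X) (E k) p"])
        (use Fv[OF j] E_vf[OF k] in \<open>auto simp: add mult T metric_add_left metric_mult_left\<close>)
    moreover have "g (T (F j)) (E k) p = (\<Sum>i<DIM('e). a i j * g (F i) (E k) p)"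
    proof -
      define S where "S = (\<lambda>f q. \<Sum>i<DIM('e). a i j * F i f q)"
      have S: "S \<in> VF" unfolding S_def
        by (rule combination_vf) (auto simp: smooth_fun_const Fv)
      have "g (vdiff (T (F j)) S) (E k) p = 0"
        by (rule metric_zero_at[OF vdiff_vf[OF T[OF Fv[OF j]] S] E_vf[OF k]]) (simp add: vdiff_def S_def a j)
      moreover have "g S (E k) p = (\<Sum>i<DIM('e). a i j * g (F i) (E k) p)"
        unfolding S_def by (subst metric_sum_left) (auto simp: Fv E_vf k smooth_fun_const)
      ultimately show ?thesis by (simp add: metric_diff_left[OF T[OF Fv[OF j]] S E_vf[OF k]])
    qed
    ultimately show "(\<Sum>i<DIM('e). g (F i) (E k) p * a i j) = (\<Sum>i<DIM('e). g (T (E i)) (E k) p * g (F j) (E i) p)"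
      by (simp add: mult.commute)
  qed simp
  then show "t = (\<Sum>i<DIM('e). g (T (E i)) (E i) p)" using t by simp
qed

definition br :: "nat \<Rightarrow> nat \<Rightarrow> nat \<Rightarrow> real" where
  "br i j k = g (vbracket (E i) (E j)) (E k) 0"

lemma bracket_metric: "i < DIM('e) \<Longrightarrow> j < DIM('e) \<Longrightarrow> k < DIM('e) \<Longrightarrow> g (vbracket (E i) (E j)) (E k) p = br i j k"
  unfolding br_def by (rule metric_left_invariant) (auto intro: vbracket_left_invariant E_li)

lemma bracket_frame:
  assumes "i < DIM('e)" "j < DIM('e)"
  shows "vbracket (E i) (E j) = (\<lambda>f p. \<Sum>k<DIM('e). br i j k * E k f p)"
  by (intro ext) (simp add: frame_expand[OF vbracket_vf[OF E_vf[OF assms(1)] E_vf[OF assms(2)]]] bracket_metric assms)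

end

section \<open>Curvature of a linear connection in the frame\<close>

locale connection = smooth_manifold A
  for A :: "('m::{t2_space,second_countable_topology}, 'e::euclidean_space) atlas" +
  fixes D :: "'m vfield \<Rightarrow> 'm vfield \<Rightarrow> 'm vfield"
  assumes conn: "linear_connection A D"
begin


lemma D_vf: "X \<in> VF \<Longrightarrow> Y \<in> VF \<Longrightarrow> D X Y \<in> VF"
  using conn by (simp add: linear_connection_def)
lemma D_add: "X \<in> VF \<Longrightarrow> Y \<in> VF \<Longrightarrow> Z \<in> VF \<Longrightarrow> D (vadd X Y) Z = vadd (D X Z) (D Y Z)"
  "X \<in> VF \<Longrightarrow> Y \<in> VF \<Longrightarrow> Z \<in> VF \<Longrightarrow> D X (vadd Y Z) = vadd (D X Y) (D X Z)"
  using conn by (simp_all add: linear_connection_def)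
lemma D_mult: "X \<in> VF \<Longrightarrow> Y \<in> VF \<Longrightarrow> smooth_fun A h \<Longrightarrow> D (vmult h X) Y = vmult h (D X Y)"
  "X \<in> VF \<Longrightarrow> Y \<in> VF \<Longrightarrow> smooth_fun A h \<Longrightarrow> D X (vmult h Y) = vadd (vmult (X h) Y) (vmult h (D X Y))"
  using conn by (simp_all add: linear_connection_def)

lemma D_cmult_right: "X \<in> VF \<Longrightarrow> Y \<in> VF \<Longrightarrow> D X (vmult (\<lambda>p. c) Y) = vmult (\<lambda>p. c) (D X Y)"
  by (simp add: D_mult smooth_fun_const) (simp add: vadd_def vmult_def vf_const)

lemma vbracket_add:
  assumes "X \<in> VF" "Y \<in> VF" "Z \<in> VF"
  shows "vbracket (vadd X Y) Z = vadd (vbracket X Z) (vbracket Y Z)"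
  using vf_add[OF assms(3) vf_smooth[OF assms(1)] vf_smooth[OF assms(2)]]
  by (intro ext) (simp add: vbracket_def vadd_def)

lemma vbracket_mult:
  assumes X: "X \<in> VF" and Y: "Y \<in> VF" and h: "smooth_fun A h"
  shows "vbracket (vmult h X) Y = vadd (vmult h (vbracket X Y)) (vmult (\<lambda>p. - Y h p) X)"
  using vf_mult[OF Y h vf_smooth[OF X]]
  by (intro ext) (simp add: vbracket_def vadd_def vmult_def algebra_simps)

lemma vbracket_swap: "vbracket Y X = vmult (\<lambda>p. -1) (vbracket X Y)"
  by (intro ext) (simp add: vbracket_def vmult_def)

lemma curvature_vf: "X \<in> VF \<Longrightarrow> Y \<in> VF \<Longrightarrow> Z \<in> VF \<Longrightarrow> curvature D X Y Z \<in> VF"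
  unfolding curvature_def by (intro vadd_vf vdiff_vf D_vf vbracket_vf)

lemma curvature_swap:
  assumes "X \<in> VF" "Y \<in> VF" "Z \<in> VF"
  shows "curvature D Y X Z = vmult (\<lambda>p. -1) (curvature D X Y Z)"
  unfolding curvature_def vbracket_swap[of Y X]
  by (simp add: D_mult(1)[OF vbracket_vf[OF assms(1,2)] assms(3) smooth_fun_const])
    (simp add: vadd_def vdiff_def vmult_def algebra_simps)

lemma curvature_add_1:
  assumes "X \<in> VF" "X' \<in> VF" "Y \<in> VF" "Z \<in> VF"
  shows "curvature D (vadd X X') Y Z = vadd (curvature D X Y Z) (curvature D X' Y Z)"
  unfolding curvature_def vbracket_add[OF assms(1,2,3)]
  by (simp add: D_add assms D_vf vbracket_vf) (simp add: vadd_def vdiff_def algebra_simps)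

lemma curvature_mult_1:
  assumes X: "X \<in> VF" and Y: "Y \<in> VF" and Z: "Z \<in> VF" and h: "smooth_fun A h"
  shows "curvature D (vmult h X) Y Z = vmult h (curvature D X Y Z)"
proof -
  have m: "smooth_fun A (\<lambda>p. - Y h p)" by (intro smooth_fun_uminus vf_smooth Y)
  show ?thesis
    unfolding curvature_def vbracket_mult[OF X Y h]
    by (simp add: D_add D_mult assms m D_vf vbracket_vf vmult_vf) (simp add: vadd_def vdiff_def vmult_def algebra_simps)
qed

lemma curvature_add_2:
  assumes "X \<in> VF" "Y \<in> VF" "Y' \<in> VF" "Z \<in> VF"
  shows "curvature D X (vadd Y Y') Z = vadd (curvature D X Y Z) (curvature D X Y' Z)"
  unfolding curvature_swap[OF vadd_vf[OF assms(2,3)] assms(1,4)] curvature_add_1[OF assms(2,3,1,4)]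
    curvature_swap[OF assms(2,1,4)] curvature_swap[OF assms(3,1,4)]
  by (simp add: vadd_def vmult_def)

lemma curvature_mult_2:
  assumes X: "X \<in> VF" and Y: "Y \<in> VF" and Z: "Z \<in> VF" and h: "smooth_fun A h"
  shows "curvature D X (vmult h Y) Z = vmult h (curvature D X Y Z)"
  unfolding curvature_swap[OF vmult_vf[OF Y h] X Z] curvature_mult_1[OF Y X Z h] curvature_swap[OF Y X Z]
  by (simp add: vmult_def)

lemma curvature_add_3:
  assumes "X \<in> VF" "Y \<in> VF" "Z \<in> VF" "Z' \<in> VF"
  shows "curvature D X Y (vadd Z Z') = vadd (curvature D X Y Z) (curvature D X Y Z')"
  unfolding curvature_def
  by (simp add: D_add assms D_vf vbracket_vf) (simp add: vadd_def vdiff_def algebra_simps)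

text \<open>The second derivatives of \<open>h\<close> cancel against its derivative along the bracket.\<close>

lemma curvature_mult_3:
  assumes X: "X \<in> VF" and Y: "Y \<in> VF" and Z: "Z \<in> VF" and h: "smooth_fun A h"
  shows "curvature D X Y (vmult h Z) = vmult h (curvature D X Y Z)"
  unfolding curvature_def
  by (simp add: D_add D_mult assms D_vf vbracket_vf vmult_vf vf_smooth)
    (simp add: vadd_def vdiff_def vmult_def vbracket_def algebra_simps)

lemma D_sum_right:
  assumes "finite I" "X \<in> VF" "\<And>i. i \<in> I \<Longrightarrow> Y i \<in> VF"
  shows "D X (\<lambda>f p. \<Sum>i\<in>I. c i * Y i f p) = (\<lambda>f p. \<Sum>i\<in>I. c i * D X (Y i) f p)"
proof (intro ext)
  fix f p
  show "D X (\<lambda>f p. \<Sum>i\<in>I. c i * Y i f p) f p = (\<Sum>i\<in>I. c i * D X (Y i) f p)"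
    by (rule additive_combination[of "\<lambda>Y. D X Y f p" I "\<lambda>i p. c i"])
      (use assms in \<open>auto simp: D_add D_cmult_right smooth_fun_const\<close>, simp_all add: vadd_def vmult_def)
qed

lemma D_sum_left:
  assumes "finite I" "X \<in> VF" "\<And>i. i \<in> I \<Longrightarrow> Y i \<in> VF"
  shows "D (\<lambda>f p. \<Sum>i\<in>I. c i * Y i f p) X = (\<lambda>f p. \<Sum>i\<in>I. c i * D (Y i) X f p)"
proof (intro ext)
  fix f p
  show "D (\<lambda>f p. \<Sum>i\<in>I. c i * Y i f p) X f p = (\<Sum>i\<in>I. c i * D (Y i) X f p)"
    by (rule additive_combination[of "\<lambda>Y. D Y X f p" I "\<lambda>i p. c i"])
      (use assms in \<open>auto simp: D_add D_mult smooth_fun_const\<close>, simp_all add: vadd_def vmult_def)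
qed

end

locale frame_connection = orthonormal_frame A g E + connection A D
  for A :: "('g::{t2_space,second_countable_topology,group_add}, 'e::euclidean_space) atlas" and g E D +
  fixes \<Gamma> :: "nat \<Rightarrow> nat \<Rightarrow> nat \<Rightarrow> real"
  assumes Christoffel: "i < DIM('e) \<Longrightarrow> j < DIM('e) \<Longrightarrow> D (E i) (E j) = (\<lambda>f p. \<Sum>k<DIM('e). \<Gamma> i j k * E k f p)"
begin

text \<open>The coefficients of the connection and of the brackets are constant, so no derivative of them
  appears.\<close>

lemma curvature_frame:
  assumes i: "i < DIM('e)" and l: "l < DIM('e)" and j: "j < DIM('e)"
  shows "curvature D (E i) (E l) (E j) =
    (\<lambda>f p. \<Sum>k<DIM('e). (\<Sum>m<DIM('e). br i l m * \<Gamma> m j k - \<Gamma> l j m * \<Gamma> i m k + \<Gamma> i j m * \<Gamma> l m k) * E k f p)"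
proof -
  have 1: "D (vbracket (E i) (E l)) (E j) = (\<lambda>f p. \<Sum>k<DIM('e). (\<Sum>m<DIM('e). br i l m * \<Gamma> m j k) * E k f p)"
  proof -
    have "D (vbracket (E i) (E l)) (E j) = (\<lambda>f p. \<Sum>m<DIM('e). br i l m * D (E m) (E j) f p)"
      unfolding bracket_frame[OF i l] by (rule D_sum_left) (auto simp: E_vf j)
    also have "\<dots> = (\<lambda>f p. \<Sum>m<DIM('e). br i l m * (\<Sum>k<DIM('e). \<Gamma> m j k * E k f p))"
      by (intro ext sum.cong) (auto simp: Christoffel j)
    also have "\<dots> = (\<lambda>f p. \<Sum>k<DIM('e). (\<Sum>m<DIM('e). br i l m * \<Gamma> m j k) * E k f p)"
      unfolding sum_distrib_left sum_distrib_right by (intro ext, subst sum.swap) (simp add: mult_ac)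
    finally show ?thesis .
  qed
  have 2: "D (E i) (D (E l) (E j)) = (\<lambda>f p. \<Sum>k<DIM('e). (\<Sum>m<DIM('e). \<Gamma> l j m * \<Gamma> i m k) * E k f p)"
    if i: "i < DIM('e)" and l: "l < DIM('e)" for i l
  proof -
    have "D (E i) (D (E l) (E j)) = (\<lambda>f p. \<Sum>m<DIM('e). \<Gamma> l j m * D (E i) (E m) f p)"
      unfolding Christoffel[OF l j] by (rule D_sum_right) (auto simp: E_vf i)
    also have "\<dots> = (\<lambda>f p. \<Sum>m<DIM('e). \<Gamma> l j m * (\<Sum>k<DIM('e). \<Gamma> i m k * E k f p))"
      by (intro ext sum.cong) (auto simp: Christoffel i)
    also have "\<dots> = (\<lambda>f p. \<Sum>k<DIM('e). (\<Sum>m<DIM('e). \<Gamma> l j m * \<Gamma> i m k) * E k f p)"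
      unfolding sum_distrib_left sum_distrib_right by (intro ext, subst sum.swap) (simp add: mult_ac)
    finally show ?thesis .
  qed
  show ?thesis
    unfolding curvature_def 1 2[OF i l] 2[OF l i] vadd_def vdiff_def
    by (intro ext) (simp add: sum.distrib sum_subtractf distrib_right left_diff_distrib)
qed

lemma ricci_eq_sum:
  assumes X: "X \<in> VF" and Y: "Y \<in> VF"
  shows "ricci A D X Y p = (\<Sum>l<DIM('e). g (curvature D X (E l) Y) (E l) p)"
  unfolding ricci_def
  by (rule trace_at_eq) (auto simp: curvature_vf X Y curvature_add_2 curvature_mult_2)

definition ric :: "nat \<Rightarrow> nat \<Rightarrow> real" where
  "ric i j = (\<Sum>l<DIM('e). \<Sum>m<DIM('e). br i l m * \<Gamma> m j l - \<Gamma> l j m * \<Gamma> i m l + \<Gamma> i j m * \<Gamma> l m l)"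

lemma ricci_frame:
  assumes i: "i < DIM('e)" and j: "j < DIM('e)"
  shows "ricci A D (E i) (E j) p = ric i j"
  unfolding ricci_eq_sum[OF E_vf[OF i] E_vf[OF j]] ric_def
proof (rule sum.cong[OF refl])
  fix l assume l: "l \<in> {..<DIM('e)}"
  then show "g (curvature D (E i) (E l) (E j)) (E l) p = (\<Sum>m<DIM('e). br i l m * \<Gamma> m j l - \<Gamma> l j m * \<Gamma> i m l + \<Gamma> i j m * \<Gamma> l m l)"
    using metric_frame_sum[of "\<lambda>k q. \<Sum>m<DIM('e). br i l m * \<Gamma> m j k - \<Gamma> l j m * \<Gamma> i m k + \<Gamma> i j m * \<Gamma> l m k" l p]
    by (simp add: curvature_frame i j smooth_fun_const)
qed

lemma ricci_expand:
  assumes X: "X \<in> VF" and Y: "Y \<in> VF"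
  shows "ricci A D X Y p = (\<Sum>i<DIM('e). \<Sum>j<DIM('e). g X (E i) p * g Y (E j) p * ric i j)"
proof -
  have 1: "ricci A D X Y p = (\<Sum>i<DIM('e). g X (E i) p * ricci A D (E i) Y p)"
  proof (rule frame_tensor[of "\<lambda>X. ricci A D X Y p", OF _ _ X])
    show "ricci A D (vadd X X') Y p = ricci A D X Y p + ricci A D X' Y p"
      if "X \<in> VF" "X' \<in> VF" for X X'
      using that Y unfolding ricci_eq_sum[OF vadd_vf[OF that] Y] ricci_eq_sum[OF that(1) Y] ricci_eq_sum[OF that(2) Y] sum.distrib[symmetric]
      by (intro sum.cong refl) (simp add: curvature_add_1 E_vf metric_add_left curvature_vf)
    show "ricci A D (vmult h X) Y p = h p * ricci A D X Y p" if "smooth_fun A h" "X \<in> VF" for h X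
      using that Y unfolding ricci_eq_sum[OF vmult_vf[OF that(2,1)] Y] ricci_eq_sum[OF that(2) Y] sum_distrib_left
      by (intro sum.cong refl) (simp add: curvature_mult_1 E_vf metric_mult_left curvature_vf)
  qed
  have 2: "ricci A D (E i) Y p = (\<Sum>j<DIM('e). g Y (E j) p * ricci A D (E i) (E j) p)" if i: "i < DIM('e)" for i
  proof (rule frame_tensor[of "\<lambda>Y. ricci A D (E i) Y p", OF _ _ Y])
    show "ricci A D (E i) (vadd X X') p = ricci A D (E i) X p + ricci A D (E i) X' p"
      if "X \<in> VF" "X' \<in> VF" for X X'
      using that i unfolding ricci_eq_sum[OF E_vf[OF i] vadd_vf[OF that]] ricci_eq_sum[OF E_vf[OF i] that(1)] ricci_eq_sum[OF E_vf[OF i] that(2)] sum.distrib[symmetric]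
      by (intro sum.cong refl) (simp add: curvature_add_3 E_vf metric_add_left curvature_vf)
    show "ricci A D (E i) (vmult h X) p = h p * ricci A D (E i) X p" if "smooth_fun A h" "X \<in> VF" for h X
      using that i unfolding ricci_eq_sum[OF E_vf[OF i] vmult_vf[OF that(2,1)]] ricci_eq_sum[OF E_vf[OF i] that(2)] sum_distrib_left
      by (intro sum.cong refl) (simp add: curvature_mult_3 E_vf metric_mult_left curvature_vf)
  qed
  show ?thesis unfolding 1 by (intro sum.cong refl) (simp add: 2 ricci_frame sum_distrib_left mult.assoc)
qed

end

section \<open>Left-invariant Weyl structures\<close>

text \<open>The coefficients of a Weyl connection in an orthonormal frame with bracket coefficients \<open>c\<close>. The first
  summand is the Levi-Civita connection, and the other three are
  \<open>\<theta>(X) Y + \<theta>(Y) X - g(X, Y) T\<close> on frame fields.\<close>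

definition weyl_coeff ::
    "(nat \<Rightarrow> nat \<Rightarrow> nat \<Rightarrow> real) \<Rightarrow> (nat \<Rightarrow> real) \<Rightarrow> nat \<Rightarrow> nat \<Rightarrow> nat \<Rightarrow> real" where
  "weyl_coeff c \<theta> i j k = (c i j k - c j k i + c k i j) / 2 +
     \<theta> i * (if j = k then 1 else 0) + \<theta> j * (if i = k then 1 else 0) - \<theta> k * (if i = j then 1 else 0)"

definition weyl_ric ::
    "nat \<Rightarrow> (nat \<Rightarrow> nat \<Rightarrow> nat \<Rightarrow> real) \<Rightarrow> (nat \<Rightarrow> real) \<Rightarrow> nat \<Rightarrow> nat \<Rightarrow> real" where
  "weyl_ric n c \<theta> i j = (\<Sum>l<n. \<Sum>m<n. c i l m * weyl_coeff c \<theta> m j l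
     - weyl_coeff c \<theta> l j m * weyl_coeff c \<theta> i m l + weyl_coeff c \<theta> i j m * weyl_coeff c \<theta> l m l)"

context orthonormal_frame
begin

lemma br_antisym: "br i j k = - br j i k" if "i < DIM('e)" "j < DIM('e)" "k < DIM('e)"
proof -
  have "vbracket (E j) (E i) = vmult (\<lambda>p. -1) (vbracket (E i) (E j))"
    by (intro ext) (simp add: vbracket_def vmult_def)
  then show ?thesis
    using metric_mult_left[OF vbracket_vf[OF E_vf[OF that(1)] E_vf[OF that(2)]] E_vf[OF that(3)] smooth_fun_const, of "-1" 0]
    by (simp add: br_def)
qed

lemma weyl_coeff_metric:
  assumes "i < DIM('e)" "j < DIM('e)" "k < DIM('e)"
  shows "weyl_coeff br \<theta> i j k + weyl_coeff br \<theta> i k j = 2 * \<theta> i * (if j = k then 1 else 0)"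
  using br_antisym[of i j k] br_antisym[of j k i] br_antisym[of k i j] assms
  by (simp add: weyl_coeff_def field_simps)

lemma weyl_coeff_torsion:
  assumes "i < DIM('e)" "j < DIM('e)" "k < DIM('e)"
  shows "weyl_coeff br \<theta> i j k - weyl_coeff br \<theta> j i k = br i j k"
  using br_antisym[of i j k] br_antisym[of j k i] br_antisym[of k i j] assms
  by (simp add: weyl_coeff_def field_simps)

text \<open>Combine the two equations for the three cyclic permutations of the indices.\<close>

lemma Koszul:
  assumes m: "\<And>i j k. i < DIM('e) \<Longrightarrow> j < DIM('e) \<Longrightarrow> k < DIM('e) \<Longrightarrow> G i j k + G i k j = 2 * \<theta> i * (if j = k then 1 else 0)"
    and t: "\<And>i j k. i < DIM('e) \<Longrightarrow> j < DIM('e) \<Longrightarrow> k < DIM('e) \<Longrightarrow> G i j k - G j i k = br i j k"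
    and "i < DIM('e)" "j < DIM('e)" "k < DIM('e)"
  shows "G i j k = weyl_coeff br \<theta> i j k"
proof -
  have e: "(if k = i then 1 else 0) = (if i = k then 1 else (0::real))" by auto
  show ?thesis
    using m[of i j k] m[of j k i] m[of k i j] t[of i j k] t[of j k i] t[of k i j] assms(3-5)
    unfolding weyl_coeff_def e by (simp add: field_simps)
qed

lemma self_conformal: "g \<in> conformal_class A g"
  unfolding conformal_class_def by (auto intro!: exI[of _ "\<lambda>p. 0"] smooth_fun_const)

lemma metric_E_const: "i < DIM('e) \<Longrightarrow> j < DIM('e) \<Longrightarrow> g (E i) (E j) = (\<lambda>p. if i = j then 1 else 0)"
  using E_onp by (intro ext) auto

lemma weyl_christoffel:
  assumes D: "linear_connection A D" and tf: "torsion_free A D" and lee: "lee_form A D g \<theta>"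
    and const: "\<And>i. i < DIM('e) \<Longrightarrow> \<theta> (E i) p = t i"
    and ijk: "i < DIM('e)" "j < DIM('e)" "k < DIM('e)"
  shows "g (D (E i) (E j)) (E k) p = weyl_coeff br t i j k"
proof (rule Koszul[where G = "\<lambda>i j k. g (D (E i) (E j)) (E k) p", OF _ _ ijk])
  interpret connection A D by unfold_locales (rule D)
  fix i j k assume i: "i < DIM('e)" and j: "j < DIM('e)" and k: "k < DIM('e)"
  have "E i (g (E j) (E k)) p - g (D (E i) (E j)) (E k) p - g (E j) (D (E i) (E k)) p = - 2 * \<theta> (E i) p * g (E j) (E k) p"
    using lee E_vf[OF i] E_vf[OF j] E_vf[OF k] unfolding lee_form_def by blast
  moreover have "E i (g (E j) (E k)) p = 0" unfolding metric_E_const[OF j k] by (rule vf_const[OF E_vf[OF i]])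
  moreover have "g (E j) (D (E i) (E k)) p = g (D (E i) (E k)) (E j) p"
    by (rule metric_sym[OF E_vf[OF j] D_vf[OF E_vf[OF i] E_vf[OF k]]])
  ultimately show "g (D (E i) (E j)) (E k) p + g (D (E i) (E k)) (E j) p = 2 * t i * (if j = k then 1 else 0)"
    using const[OF i] E_onp[OF j k, of p] by simp
  have "vdiff (D (E i) (E j)) (D (E j) (E i)) = vbracket (E i) (E j)"
    using tf E_vf[OF i] E_vf[OF j] unfolding torsion_free_def by blast
  then show "g (D (E i) (E j)) (E k) p - g (D (E j) (E i)) (E k) p = br i j k"
    using metric_diff_left[OF D_vf[OF E_vf[OF i] E_vf[OF j]] D_vf[OF E_vf[OF j] E_vf[OF i]] E_vf[OF k], of p]
      bracket_metric[OF i j k, of p] by simp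
qed

text \<open>The metric \<open>h\<close> in the definition of \<open>weyl_einstein\<close> may be any member of the conformal class. Its
  conformal factor and the trace with respect to it go into the number \<open>r\<close>.\<close>

lemma weyl_einstein_imp:
  assumes "admits_left_invariant_weyl_einstein A (conformal_class A g)"
  obtains t r where "\<And>i j. i < DIM('e) \<Longrightarrow> j < DIM('e) \<Longrightarrow>
    weyl_ric DIM('e) br t i j + weyl_ric DIM('e) br t j i = (if i = j then r else 0)"
proof -
  obtain D where D: "left_invariant_weyl A (conformal_class A g) D" "weyl_einstein A (conformal_class A g) D"
    using assms unfolding admits_left_invariant_weyl_einstein_def by blast
  then have lc: "linear_connection A D" and tf: "torsion_free A D"
    unfolding weyl_einstein_def weyl_structure_def by auto
  obtain \<theta> where lee: "lee_form A D g \<theta>"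
    using D self_conformal unfolding weyl_einstein_def weyl_structure_def by blast
  have li: "left_invariant_form A \<theta>"
    using D(1) self_conformal metric lee unfolding left_invariant_weyl_def by blast
  define t where "t i = \<theta> (E i) 0" for i
  have const: "\<theta> (E i) p = t i" if i: "i < DIM('e)" for i p
  proof -
    have "\<theta> (push_left p (E i)) (p + 0) = \<theta> (E i) 0"
      using li E_vf[OF i] unfolding left_invariant_form_def by blast
    moreover have "push_left p (E i) = E i" using E_li[OF i] by (simp add: left_invariant_fields_def)
    ultimately show ?thesis by (simp add: t_def)
  qed
  interpret C: connection A D by unfold_locales (rule lc)
  interpret F: frame_connection A g E D "weyl_coeff br t"
  proof unfold_locales
    fix i j assume i: "i < DIM('e)" and j: "j < DIM('e)"
    show "D (E i) (E j) = (\<lambda>f p. \<Sum>k<DIM('e). weyl_coeff br t i j k * E k f p)"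
      by (intro ext) (simp add: frame_expand[OF C.D_vf[OF E_vf[OF i] E_vf[OF j]]] weyl_christoffel[OF lc tf lee const i j])
  qed
  have ric: "ricci A D (E i) (E j) p = weyl_ric DIM('e) br t i j" if "i < DIM('e)" "j < DIM('e)" for i j p
    using F.ricci_frame[OF that] by (simp add: F.ric_def weyl_ric_def)
  obtain h where h: "h \<in> conformal_class A g"
    and z: "\<And>X Y p. X \<in> VF \<Longrightarrow> Y \<in> VF \<Longrightarrow> trace_free_part A h (symmetric_part (ricci A D)) X Y p = 0"
    using D(2) unfolding weyl_einstein_def by blast
  obtain u where u: "\<And>X Y. X \<in> VF \<Longrightarrow> Y \<in> VF \<Longrightarrow> h X Y = (\<lambda>p. exp (2 * u p) * g X Y p)"
    using h unfolding conformal_class_def by blast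
  define r where "r = 2 * (metric_trace_at A h 0 (symmetric_part (ricci A D)) / real DIM('e) * exp (2 * u 0))"
  have "weyl_ric DIM('e) br t i j + weyl_ric DIM('e) br t j i = (if i = j then r else 0)"
    if i: "i < DIM('e)" and j: "j < DIM('e)" for i j
    using z[OF E_vf[OF i] E_vf[OF j], of 0] E_on[OF i j]
    by (auto simp: trace_free_part_def symmetric_part_def ric i j u E_vf r_def)
  then show thesis using that by blast
qed

definition weyl_term :: "(nat \<Rightarrow> real) \<Rightarrow> 'g vfield \<Rightarrow> 'g vfield \<Rightarrow> nat \<Rightarrow> 'g \<Rightarrow> real" where
  "weyl_term t X Y k p = (\<Sum>i<DIM('e). \<Sum>j<DIM('e). g X (E i) p * g Y (E j) p * weyl_coeff br t i j k)"

definition weyl_connection :: "(nat \<Rightarrow> real) \<Rightarrow> 'g vfield \<Rightarrow> 'g vfield \<Rightarrow> 'g vfield" where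
  "weyl_connection t X Y = (\<lambda>f p. \<Sum>k<DIM('e). (X (g Y (E k)) p + weyl_term t X Y k p) * E k f p)"

lemma weyl_coefficient_smooth:
  assumes "X \<in> VF" "Y \<in> VF" "k < DIM('e)"
  shows "smooth_fun A (\<lambda>p. X (g Y (E k)) p + weyl_term t X Y k p)"
  unfolding weyl_term_def
  by (intro smooth_fun_add smooth_fun_sum smooth_fun_mult smooth_fun_const metric_smooth vf_smooth assms E_vf) auto

lemma weyl_connection_vf:
  assumes "X \<in> VF" "Y \<in> VF"
  shows "weyl_connection t X Y \<in> VF"
  unfolding weyl_connection_def
  by (rule frame_sum_vf[OF weyl_coefficient_smooth[OF assms]])

lemma weyl_connection_metric:
  assumes "X \<in> VF" "Y \<in> VF" "k < DIM('e)"
  shows "g (weyl_connection t X Y) (E k) p = X (g Y (E k)) p + weyl_term t X Y k p"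
  unfolding weyl_connection_def
  by (rule metric_frame_sum[OF weyl_coefficient_smooth[OF assms(1,2)] assms(3)])

lemma weyl_term_add:
  assumes "X \<in> VF" "Y \<in> VF" "Z \<in> VF"
  shows "weyl_term t (vadd X Y) Z k p = weyl_term t X Z k p + weyl_term t Y Z k p"
    "weyl_term t Z (vadd X Y) k p = weyl_term t Z X k p + weyl_term t Z Y k p"
  using assms unfolding weyl_term_def sum.distrib[symmetric]
  by (auto intro!: sum.cong simp: metric_add_left E_vf algebra_simps)

lemma weyl_term_mult:
  assumes "X \<in> VF" "Y \<in> VF" "smooth_fun A h"
  shows "weyl_term t (vmult h X) Y k p = h p * weyl_term t X Y k p"
    "weyl_term t X (vmult h Y) k p = h p * weyl_term t X Y k p"
  using assms unfolding weyl_term_def sum_distrib_left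
  by (auto intro!: sum.cong simp: metric_mult_left E_vf)

lemma weyl_connection_linear: "linear_connection A (weyl_connection t)"
  unfolding linear_connection_def
proof (intro conjI ballI allI impI)
  fix X Y assume X: "X \<in> VF" and Y: "Y \<in> VF"
  show "weyl_connection t X Y \<in> VF" by (rule weyl_connection_vf[OF X Y])
  { fix h assume h: "smooth_fun A h"
    show "weyl_connection t (vmult h X) Y = vmult h (weyl_connection t X Y)"
    proof (rule vf_eqI)
      fix k p assume k: "k < DIM('e)"
      show "g (weyl_connection t (vmult h X) Y) (E k) p = g (vmult h (weyl_connection t X Y)) (E k) p"
        by (simp add: weyl_connection_metric metric_mult_left weyl_term_mult X Y h k vmult_vf weyl_connection_vf E_vf)
          (simp add: vmult_def algebra_simps)
    qed (intro weyl_connection_vf vmult_vf X Y h)+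
    show "weyl_connection t X (vmult h Y) = vadd (vmult (X h) Y) (vmult h (weyl_connection t X Y))"
    proof (rule vf_eqI)
      fix k p assume k: "k < DIM('e)"
      have "g (vmult h Y) (E k) = (\<lambda>p. h p * g Y (E k) p)"
        by (intro ext metric_mult_left Y E_vf[OF k] h)
      then have "X (g (vmult h Y) (E k)) p = X h p * g Y (E k) p + h p * X (g Y (E k)) p"
        using vf_mult[OF X h metric_smooth[OF Y E_vf[OF k]]] by simp
      then show "g (weyl_connection t X (vmult h Y)) (E k) p = g (vadd (vmult (X h) Y) (vmult h (weyl_connection t X Y))) (E k) p"
        by (simp add: weyl_connection_metric metric_mult_left metric_add_left weyl_term_mult X Y h k vmult_vf weyl_connection_vf E_vf vf_smooth algebra_simps)
    qed (intro weyl_connection_vf vmult_vf vadd_vf X Y h vf_smooth)+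
  }
  fix Z assume Z: "Z \<in> VF"
  show "weyl_connection t (vadd X Y) Z = vadd (weyl_connection t X Z) (weyl_connection t Y Z)"
  proof (rule vf_eqI)
    fix k p assume k: "k < DIM('e)"
    show "g (weyl_connection t (vadd X Y) Z) (E k) p = g (vadd (weyl_connection t X Z) (weyl_connection t Y Z)) (E k) p"
      by (simp add: weyl_connection_metric metric_add_left weyl_term_add X Y Z k vadd_vf weyl_connection_vf E_vf)
        (simp add: vadd_def)
  qed (intro weyl_connection_vf vadd_vf X Y Z)+
  show "weyl_connection t X (vadd Y Z) = vadd (weyl_connection t X Y) (weyl_connection t X Z)"
  proof (rule vf_eqI)
    fix k p assume k: "k < DIM('e)"
    have "g (vadd Y Z) (E k) = (\<lambda>p. g Y (E k) p + g Z (E k) p)"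
      by (intro ext metric_add_left Y Z E_vf[OF k])
    then have "X (g (vadd Y Z) (E k)) p = X (g Y (E k)) p + X (g Z (E k)) p"
      using vf_add[OF X metric_smooth[OF Y E_vf[OF k]] metric_smooth[OF Z E_vf[OF k]]] by simp
    then show "g (weyl_connection t X (vadd Y Z)) (E k) p = g (vadd (weyl_connection t X Y) (weyl_connection t X Z)) (E k) p"
      by (simp add: weyl_connection_metric metric_add_left weyl_term_add X Y Z k vadd_vf weyl_connection_vf E_vf)
  qed (intro weyl_connection_vf vadd_vf X Y Z)+
qed

text \<open>Needed because \<open>vbracket\<close> is only known on frame fields. The second derivatives of \<open>f\<close> occur
  antisymmetrised and so reduce to brackets of the frame.\<close>

lemma bracket_expand:
  assumes X: "X \<in> VF" and Y: "Y \<in> VF"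
  shows "vbracket X Y f p = (\<Sum>k<DIM('e). (X (g Y (E k)) p - Y (g X (E k)) p +
    (\<Sum>i<DIM('e). \<Sum>j<DIM('e). g X (E i) p * g Y (E j) p * br i j k)) * E k f p)"
proof -
  have XY: "X (Y f) p = (\<Sum>k<DIM('e). X (g Y (E k)) p * E k f p) +
      (\<Sum>i<DIM('e). \<Sum>j<DIM('e). g X (E i) p * g Y (E j) p * E i (E j f) p)"
    if X: "X \<in> VF" and Y: "Y \<in> VF" for X Y
  proof -
    have "Y f = (\<lambda>q. \<Sum>k<DIM('e). g Y (E k) q * E k f q)" by (intro ext frame_expand Y)
    then have "X (Y f) p = X (\<lambda>q. \<Sum>k<DIM('e). g Y (E k) q * E k f q) p" by simp
    also have "\<dots> = (\<Sum>k<DIM('e). X (\<lambda>q. g Y (E k) q * E k f q) p)"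
      by (rule vf_sum[OF X]) (auto intro: smooth_fun_mult metric_smooth Y E_vf vf_smooth)
    also have "\<dots> = (\<Sum>k<DIM('e). X (g Y (E k)) p * E k f p + g Y (E k) p * X (E k f) p)"
      by (intro sum.cong refl vf_mult[OF X]) (auto intro: metric_smooth Y E_vf vf_smooth)
    also have "\<dots> = (\<Sum>k<DIM('e). X (g Y (E k)) p * E k f p) + (\<Sum>k<DIM('e). g Y (E k) p * (\<Sum>i<DIM('e). g X (E i) p * E i (E k f) p))"
      unfolding sum.distrib by (simp add: frame_expand[OF X, symmetric])
    also have "(\<Sum>k<DIM('e). g Y (E k) p * (\<Sum>i<DIM('e). g X (E i) p * E i (E k f) p))
      = (\<Sum>i<DIM('e). \<Sum>j<DIM('e). g X (E i) p * g Y (E j) p * E i (E j f) p)"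
      unfolding sum_distrib_left by (subst sum.swap) (simp add: mult_ac)
    finally show ?thesis .
  qed
  have b: "E i (E j f) p - E j (E i f) p = (\<Sum>k<DIM('e). br i j k * E k f p)" if "i < DIM('e)" "j < DIM('e)" for i j
    using bracket_frame[OF that] by (simp add: vbracket_def fun_eq_iff)
  have "vbracket X Y f p = (\<Sum>k<DIM('e). X (g Y (E k)) p * E k f p) - (\<Sum>k<DIM('e). Y (g X (E k)) p * E k f p)
    + ((\<Sum>i<DIM('e). \<Sum>j<DIM('e). g X (E i) p * g Y (E j) p * E i (E j f) p)
      - (\<Sum>j<DIM('e). \<Sum>i<DIM('e). g Y (E j) p * g X (E i) p * E j (E i f) p))"
    by (simp add: vbracket_def XY[OF X Y] XY[OF Y X])
  also have "(\<Sum>j<DIM('e). \<Sum>i<DIM('e). g Y (E j) p * g X (E i) p * E j (E i f) p)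
    = (\<Sum>i<DIM('e). \<Sum>j<DIM('e). g X (E i) p * g Y (E j) p * E j (E i f) p)"
    by (subst sum.swap) (simp add: mult_ac)
  also have "(\<Sum>i<DIM('e). \<Sum>j<DIM('e). g X (E i) p * g Y (E j) p * E i (E j f) p) -
      (\<Sum>i<DIM('e). \<Sum>j<DIM('e). g X (E i) p * g Y (E j) p * E j (E i f) p)
    = (\<Sum>i<DIM('e). \<Sum>j<DIM('e). g X (E i) p * g Y (E j) p * (\<Sum>k<DIM('e). br i j k * E k f p))"
    unfolding sum_subtractf[symmetric] right_diff_distrib[symmetric]
    by (intro sum.cong refl) (simp add: b)
  also have "\<dots> = (\<Sum>i<DIM('e). \<Sum>k<DIM('e). \<Sum>j<DIM('e). g X (E i) p * g Y (E j) p * br i j k * E k f p)"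
    unfolding sum_distrib_left by (rule sum.cong[OF refl], subst sum.swap) (simp add: mult_ac)
  also have "\<dots> = (\<Sum>k<DIM('e). (\<Sum>i<DIM('e). \<Sum>j<DIM('e). g X (E i) p * g Y (E j) p * br i j k) * E k f p)"
    unfolding sum_distrib_right by (rule sum.swap)
  finally show ?thesis by (simp add: sum.distrib sum_subtractf distrib_right left_diff_distrib)
qed

lemma weyl_term_swap:
  "weyl_term t X Y k p - weyl_term t Y X k p =
    (\<Sum>i<DIM('e). \<Sum>j<DIM('e). g X (E i) p * g Y (E j) p * br i j k)" if "k < DIM('e)"
proof -
  have "weyl_term t Y X k p = (\<Sum>i<DIM('e). \<Sum>j<DIM('e). g X (E i) p * g Y (E j) p * weyl_coeff br t j i k)"
    unfolding weyl_term_def by (subst sum.swap) (simp add: mult_ac)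
  then show ?thesis
    unfolding weyl_term_def using that
    by (auto simp: sum_subtractf[symmetric] right_diff_distrib[symmetric] weyl_coeff_torsion intro!: sum.cong)
qed

lemma weyl_connection_torsion_free: "torsion_free A (weyl_connection t)"
  unfolding torsion_free_def
proof (intro ballI ext)
  fix X Y f p assume X: "X \<in> VF" and Y: "Y \<in> VF"
  show "vdiff (weyl_connection t X Y) (weyl_connection t Y X) f p = vbracket X Y f p"
    unfolding bracket_expand[OF X Y] vdiff_def weyl_connection_def sum_subtractf[symmetric]
  proof (rule sum.cong[OF refl])
    fix k assume "k \<in> {..<DIM('e)}"
    then have "X (g Y (E k)) p + weyl_term t X Y k p - (Y (g X (E k)) p + weyl_term t Y X k p)
      = X (g Y (E k)) p - Y (g X (E k)) p + (\<Sum>i<DIM('e). \<Sum>j<DIM('e). g X (E i) p * g Y (E j) p * br i j k)"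
      using weyl_term_swap[of k t X Y p] by simp
    then show "(X (g Y (E k)) p + weyl_term t X Y k p) * E k f p - (Y (g X (E k)) p + weyl_term t Y X k p) * E k f p
      = (X (g Y (E k)) p - Y (g X (E k)) p + (\<Sum>i<DIM('e). \<Sum>j<DIM('e). g X (E i) p * g Y (E j) p * br i j k)) * E k f p"
      unfolding left_diff_distrib[symmetric] by simp
  qed
qed

lemma weyl_connection_compatible:
  assumes X: "X \<in> VF" and Y: "Y \<in> VF" and Z: "Z \<in> VF"
  shows "X (g Y Z) p - g (weyl_connection t X Y) Z p - g Y (weyl_connection t X Z) p =
    - 2 * (\<Sum>i<DIM('e). t i * g X (E i) p) * g Y Z p"
proof -
  have "g Y Z = (\<lambda>q. \<Sum>k<DIM('e). g Y (E k) q * g Z (E k) q)" by (intro ext metric_expand Y Z)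
  then have "X (g Y Z) p = X (\<lambda>q. \<Sum>k<DIM('e). g Y (E k) q * g Z (E k) q) p" by simp
  also have "\<dots> = (\<Sum>k<DIM('e). X (\<lambda>q. g Y (E k) q * g Z (E k) q) p)"
    by (rule vf_sum[OF X]) (auto intro: smooth_fun_mult metric_smooth Y Z E_vf)
  also have "\<dots> = (\<Sum>k<DIM('e). X (g Y (E k)) p * g Z (E k) p + g Y (E k) p * X (g Z (E k)) p)"
    by (intro sum.cong refl vf_mult[OF X]) (auto intro: metric_smooth Y Z E_vf)
  finally have 1: "X (g Y Z) p = (\<Sum>k<DIM('e). X (g Y (E k)) p * g Z (E k) p + g Y (E k) p * X (g Z (E k)) p)" .
  have 2: "g (weyl_connection t X Y) Z p = (\<Sum>k<DIM('e). (X (g Y (E k)) p + weyl_term t X Y k p) * g Z (E k) p)"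
    unfolding metric_expand[OF weyl_connection_vf[OF X Y] Z] by (intro sum.cong refl) (simp add: weyl_connection_metric X Y)
  have 3: "g Y (weyl_connection t X Z) p = (\<Sum>k<DIM('e). g Y (E k) p * (X (g Z (E k)) p + weyl_term t X Z k p))"
    unfolding metric_expand[OF Y weyl_connection_vf[OF X Z]] by (intro sum.cong refl) (simp add: weyl_connection_metric X Z)
  have "X (g Y Z) p - g (weyl_connection t X Y) Z p - g Y (weyl_connection t X Z) p =
    - ((\<Sum>k<DIM('e). weyl_term t X Y k p * g Z (E k) p) + (\<Sum>k<DIM('e). weyl_term t X Z k p * g Y (E k) p))"
    unfolding 1 2 3 by (simp add: sum.distrib algebra_simps)
  also have "(\<Sum>k<DIM('e). weyl_term t X Y k p * g Z (E k) p) =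
      (\<Sum>i<DIM('e). \<Sum>j<DIM('e). \<Sum>k<DIM('e). g X (E i) p * g Y (E j) p * g Z (E k) p * weyl_coeff br t i j k)"
    unfolding weyl_term_def sum_distrib_right
    by (subst sum.swap, rule sum.cong[OF refl], subst sum.swap) (simp add: mult_ac)
  also have "(\<Sum>k<DIM('e). weyl_term t X Z k p * g Y (E k) p) =
      (\<Sum>i<DIM('e). \<Sum>j<DIM('e). \<Sum>k<DIM('e). g X (E i) p * g Y (E j) p * g Z (E k) p * weyl_coeff br t i k j)"
    unfolding weyl_term_def sum_distrib_right
    by (subst sum.swap) (simp add: mult_ac)
  also have "(\<Sum>i<DIM('e). \<Sum>j<DIM('e). \<Sum>k<DIM('e). g X (E i) p * g Y (E j) p * g Z (E k) p * weyl_coeff br t i j k) +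
      (\<Sum>i<DIM('e). \<Sum>j<DIM('e). \<Sum>k<DIM('e). g X (E i) p * g Y (E j) p * g Z (E k) p * weyl_coeff br t i k j)
    = (\<Sum>i<DIM('e). \<Sum>j<DIM('e). \<Sum>k<DIM('e). 2 * (t i * g X (E i) p) * (g Y (E j) p * (g Z (E k) p * (if j = k then 1 else 0))))"
    unfolding sum.distrib[symmetric] distrib_left[symmetric]
    by (intro sum.cong refl) (simp add: weyl_coeff_metric)
  also have "\<dots> = 2 * (\<Sum>i<DIM('e). t i * g X (E i) p) * g Y Z p"
    unfolding metric_expand[OF Y Z] sum_distrib_left[symmetric] sum_distrib_right[symmetric]
    by (simp add: sum_delta_less)
  finally show ?thesis by simp
qed

text \<open>Rescaling the metric by \<open>exp (2 * u)\<close> subtracts the differential of \<open>u\<close> from the Lee form.\<close>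

lemma weyl_connection_lee_form:
  assumes u: "smooth_fun A u" and h: "\<And>X Y. X \<in> VF \<Longrightarrow> Y \<in> VF \<Longrightarrow> h X Y = (\<lambda>p. exp (2 * u p) * g X Y p)"
  shows "lee_form A (weyl_connection t) h (\<lambda>X p. (\<Sum>i<DIM('e). t i * g X (E i) p) - X u p)"
  unfolding lee_form_def one_form_def
proof (intro conjI ballI allI impI)
  fix X assume X: "X \<in> VF"
  show "smooth_fun A (\<lambda>p. (\<Sum>i<DIM('e). t i * g X (E i) p) - X u p)"
    by (intro smooth_fun_diff smooth_fun_sum smooth_fun_mult smooth_fun_const metric_smooth vf_smooth X E_vf) auto
  show "(\<lambda>p. (\<Sum>i<DIM('e). t i * g (vmult f X) (E i) p) - vmult f X u p) =
      (\<lambda>p. f p * ((\<Sum>i<DIM('e). t i * g X (E i) p) - X u p))" if f: "smooth_fun A f" for f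
  proof
    fix p
    have "(\<Sum>i<DIM('e). t i * g (vmult f X) (E i) p) = f p * (\<Sum>i<DIM('e). t i * g X (E i) p)"
      unfolding sum_distrib_left by (intro sum.cong refl) (simp add: metric_mult_left X E_vf f)
    then show "(\<Sum>i<DIM('e). t i * g (vmult f X) (E i) p) - vmult f X u p =
      f p * ((\<Sum>i<DIM('e). t i * g X (E i) p) - X u p)"
      by (simp add: vmult_def right_diff_distrib)
  qed
  fix Y assume Y: "Y \<in> VF"
  show "(\<lambda>p. (\<Sum>i<DIM('e). t i * g (vadd X Y) (E i) p) - vadd X Y u p) =
      (\<lambda>p. (\<Sum>i<DIM('e). t i * g X (E i) p) - X u p + ((\<Sum>i<DIM('e). t i * g Y (E i) p) - Y u p))"
  proof
    fix p
    have "(\<Sum>i<DIM('e). t i * g (vadd X Y) (E i) p) = (\<Sum>i<DIM('e). t i * g X (E i) p) + (\<Sum>i<DIM('e). t i * g Y (E i) p)"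
      unfolding sum.distrib[symmetric] by (intro sum.cong refl) (simp add: metric_add_left X Y E_vf distrib_left)
    then show "(\<Sum>i<DIM('e). t i * g (vadd X Y) (E i) p) - vadd X Y u p =
      (\<Sum>i<DIM('e). t i * g X (E i) p) - X u p + ((\<Sum>i<DIM('e). t i * g Y (E i) p) - Y u p)"
      by (simp add: vadd_def)
  qed
  fix Z p assume Z: "Z \<in> VF"
  have su: "smooth_fun A (\<lambda>p. 2 * u p)" by (intro smooth_fun_mult smooth_fun_const u)
  have "X (h Y Z) p = exp (2 * u p) * (2 * X u p) * g Y Z p + exp (2 * u p) * X (g Y Z) p"
    unfolding h[OF Y Z]
    using vf_mult[OF X smooth_fun_exp[OF su] metric_smooth[OF Y Z]] vf_exp[OF X su] vf_cmult[OF X u] by simp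
  moreover have "h (weyl_connection t X Y) Z p = exp (2 * u p) * g (weyl_connection t X Y) Z p"
    "h Y (weyl_connection t X Z) p = exp (2 * u p) * g Y (weyl_connection t X Z) p"
    "h Y Z p = exp (2 * u p) * g Y Z p"
    by (simp_all add: h weyl_connection_vf X Y Z)
  moreover have "exp (2 * u p) * (X (g Y Z) p - g (weyl_connection t X Y) Z p - g Y (weyl_connection t X Z) p) =
    exp (2 * u p) * (- 2 * (\<Sum>i<DIM('e). t i * g X (E i) p) * g Y Z p)"
    by (simp only: weyl_connection_compatible[OF X Y Z])
  ultimately show "X (h Y Z) p - h (weyl_connection t X Y) Z p - h Y (weyl_connection t X Z) p =
    - 2 * ((\<Sum>i<DIM('e). t i * g X (E i) p) - X u p) * h Y Z p"
    by (simp add: algebra_simps)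
qed

lemma weyl_connection_structure: "weyl_structure A (conformal_class A g) (weyl_connection t)"
  unfolding weyl_structure_def
proof (intro conjI ballI weyl_connection_linear weyl_connection_torsion_free)
  fix h assume "h \<in> conformal_class A g"
  then obtain u where "smooth_fun A u" "\<And>X Y. X \<in> VF \<Longrightarrow> Y \<in> VF \<Longrightarrow> h X Y = (\<lambda>p. exp (2 * u p) * g X Y p)"
    unfolding conformal_class_def by blast
  from weyl_connection_lee_form[OF this] show "\<exists>\<theta>. lee_form A (weyl_connection t) h \<theta>" by blast
qed

text \<open>A conformal factor between two left-invariant metrics is constant, so all of them have the same Lee form,
  whose values on the frame are the constants \<open>t i\<close>.\<close>

lemma weyl_connection_left_invariant: "left_invariant_weyl A (conformal_class A g) (weyl_connection t)"
  unfolding left_invariant_weyl_def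
proof (intro conjI ballI allI impI weyl_connection_structure)
  fix h \<theta> assume hc: "h \<in> conformal_class A g" and hl: "left_invariant_metric A h"
    and lee: "lee_form A (weyl_connection t) h \<theta>"
  interpret H: lie_grp_metric A h by unfold_locales (rule hl)
  obtain u where u: "smooth_fun A u" "\<And>X Y. X \<in> VF \<Longrightarrow> Y \<in> VF \<Longrightarrow> h X Y = (\<lambda>p. exp (2 * u p) * g X Y p)"
    using hc unfolding conformal_class_def by blast
  have E0: "E 0 \<in> VF" and n0: "0 < DIM('e)" by (auto intro: E_vf)
  have uc: "u p = u 0" for p
    using H.metric_left_invariant[OF E_li[OF n0] E_li[OF n0], of p] E_onp[OF n0 n0] by (simp add: u(2) E0)
  have l0: "lee_form A (weyl_connection t) h (\<lambda>X p. (\<Sum>i<DIM('e). t i * g X (E i) p) - X u p)"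
    by (rule weyl_connection_lee_form[OF u])
  have th: "\<theta> X p = (\<Sum>i<DIM('e). t i * g X (E i) p)" if X: "X \<in> VF" for X p
  proof -
    have "- 2 * \<theta> X p * h (E 0) (E 0) p = - 2 * ((\<Sum>i<DIM('e). t i * g X (E i) p) - X u p) * h (E 0) (E 0) p"
    proof -
      have "X (h (E 0) (E 0)) p - h (weyl_connection t X (E 0)) (E 0) p - h (E 0) (weyl_connection t X (E 0)) p
          = - 2 * \<theta> X p * h (E 0) (E 0) p"
        using lee X E0 unfolding lee_form_def by blast
      moreover have "X (h (E 0) (E 0)) p - h (weyl_connection t X (E 0)) (E 0) p - h (E 0) (weyl_connection t X (E 0)) p
          = - 2 * ((\<Sum>i<DIM('e). t i * g X (E i) p) - X u p) * h (E 0) (E 0) p"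
        using l0 X E0 unfolding lee_form_def by blast
      ultimately show ?thesis by (rule trans[OF sym])
    qed
    moreover have "h (E 0) (E 0) p \<noteq> 0" using E_onp[OF n0 n0, of p] by (simp add: u(2) E0)
    moreover have "X u p = 0"
    proof -
      have "u = (\<lambda>p. u 0)" using uc by (rule ext)
      then show ?thesis using vf_const[OF X, of "u 0" p] by metis
    qed
    ultimately show ?thesis by simp
  qed
  show "left_invariant_form A \<theta>"
    unfolding left_invariant_form_def
  proof (intro conjI allI ballI)
    show "one_form A \<theta>" using lee by (simp add: lee_form_def)
    fix a X p assume X: "X \<in> VF"
    have "g (push_left a X) (E i) (a + p) = g X (E i) p" if i: "i < DIM('e)" for i
    proof -
      have "g (push_left a X) (push_left a (E i)) (a + p) = g X (E i) p"
        using metric X E_vf[OF i] unfolding left_invariant_metric_def by blast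
      moreover have "push_left a (E i) = E i" using E_li[OF i] by (simp add: left_invariant_fields_def)
      ultimately show ?thesis by simp
    qed
    then show "\<theta> (push_left a X) (a + p) = \<theta> X p" by (simp add: th X push_left_vf)
  qed
qed

lemma weyl_connection_frame:
  assumes i: "i < DIM('e)" and j: "j < DIM('e)"
  shows "weyl_connection t (E i) (E j) = (\<lambda>f p. \<Sum>k<DIM('e). weyl_coeff br t i j k * E k f p)"
  unfolding weyl_connection_def weyl_term_def
proof (intro ext sum.cong refl)
  fix f p k assume "k \<in> {..<DIM('e)}"
  then have k: "k < DIM('e)" by simp
  have "E i (g (E j) (E k)) p = 0" unfolding metric_E_const[OF j k] by (rule vf_const[OF E_vf[OF i]])
  moreover have "(\<Sum>i'<DIM('e). \<Sum>j'<DIM('e). g (E i) (E i') p * g (E j) (E j') p * weyl_coeff br t i' j' k)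
      = (\<Sum>i'<DIM('e). (if i = i' then 1 else 0) * (\<Sum>j'<DIM('e). (if j = j' then 1 else 0) * weyl_coeff br t i' j' k))"
    unfolding sum_distrib_left by (intro sum.cong refl) (simp add: E_onp i j)
  ultimately show "(E i (g (E j) (E k)) p + (\<Sum>i'<DIM('e). \<Sum>j'<DIM('e). g (E i) (E i') p * g (E j) (E j') p * weyl_coeff br t i' j' k)) * E k f p
    = weyl_coeff br t i j k * E k f p"
    by (simp add: sum_delta_less i j)
qed

text \<open>For a multiple of the metric every orthonormal basis gives the same sum, so the description in
  \<open>metric_trace_at\<close> denotes it.\<close>

lemma metric_trace_proportional:
  assumes "\<And>X Y. X \<in> VF \<Longrightarrow> Y \<in> VF \<Longrightarrow> B X Y p = r * g X Y p"
  shows "metric_trace_at A g p B = r * real DIM('e)"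
  unfolding metric_trace_at_def
proof (rule the_equality)
  show "\<exists>F. (\<forall>i<DIM('e). F i \<in> VF) \<and> (\<forall>i<DIM('e). \<forall>j<DIM('e). g (F i) (F j) p = (if i = j then 1 else 0)) \<and>
      r * real DIM('e) = (\<Sum>i<DIM('e). B (F i) (F i) p)"
    by (rule exI[of _ E]) (auto simp: E_vf E_onp assms)
qed (auto simp: assms)

lemma weyl_einstein_if:
  assumes W: "\<And>i j. i < DIM('e) \<Longrightarrow> j < DIM('e) \<Longrightarrow>
    weyl_ric DIM('e) br t i j + weyl_ric DIM('e) br t j i = (if i = j then r else 0)"
  shows "admits_left_invariant_weyl_einstein A (conformal_class A g)"
proof -
  let ?D = "weyl_connection t"
  interpret F: frame_connection A g E ?D "weyl_coeff br t"
    by unfold_locales (auto simp: weyl_connection_linear weyl_connection_frame)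
  have ric: "F.ric i j = weyl_ric DIM('e) br t i j" for i j by (simp add: F.ric_def weyl_ric_def)
  have einstein: "symmetric_part (ricci A ?D) X Y p = r / 2 * g X Y p" if X: "X \<in> VF" and Y: "Y \<in> VF" for X Y p
  proof -
    have "ricci A ?D X Y p + ricci A ?D Y X p =
      (\<Sum>i<DIM('e). \<Sum>j<DIM('e). g X (E i) p * g Y (E j) p * F.ric i j) + (\<Sum>i<DIM('e). \<Sum>j<DIM('e). g X (E i) p * g Y (E j) p * F.ric j i)"
      unfolding F.ricci_expand[OF X Y] F.ricci_expand[OF Y X]
      by (subst (4) sum.swap) (simp add: mult_ac)
    also have "\<dots> = (\<Sum>i<DIM('e). g X (E i) p * (\<Sum>j<DIM('e). (r * g Y (E j) p) * (if i = j then 1 else 0)))"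
      unfolding sum.distrib[symmetric] distrib_left[symmetric] sum_distrib_left
      by (intro sum.cong refl) (simp add: ric W)
    also have "\<dots> = (\<Sum>i<DIM('e). r * (g X (E i) p * g Y (E i) p))"
      by (intro sum.cong refl) (simp add: sum_delta_less)
    also have "\<dots> = r * g X Y p"
      unfolding metric_expand[OF X Y] sum_distrib_left ..
    finally show ?thesis by (simp add: symmetric_part_def)
  qed
  have "weyl_einstein A (conformal_class A g) ?D"
    unfolding weyl_einstein_def
  proof (intro conjI weyl_connection_structure bexI[OF _ self_conformal] ballI allI)
    fix X Y p assume X: "X \<in> VF" and Y: "Y \<in> VF"
    show "trace_free_part A g (symmetric_part (ricci A ?D)) X Y p = 0"
    proof -
      have m: "metric_trace_at A g p (symmetric_part (ricci A ?D)) = r / 2 * real DIM('e)"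
        by (rule metric_trace_proportional) (rule einstein)
      show ?thesis unfolding trace_free_part_def einstein[OF X Y] m by simp
    qed
  qed
  then show ?thesis
    unfolding admits_left_invariant_weyl_einstein_def using weyl_connection_left_invariant by blast
qed

end

section \<open>The Einstein equation for a semidirect product\<close>

text \<open>The coefficients of the brackets \<open>[E 0, E 1] = 0\<close>, \<open>[E 2, E 0] = \<alpha> E 0 - \<gamma> E 1\<close> and
  \<open>[E 2, E 1] = \<gamma> E 0 + \<beta> E 1\<close>.\<close>

definition adapted_coeff :: "real \<Rightarrow> real \<Rightarrow> real \<Rightarrow> nat \<Rightarrow> nat \<Rightarrow> nat \<Rightarrow> real" where
  "adapted_coeff \<alpha> \<beta> \<gamma> i j k =
     (if i = 2 \<and> j = 0 then (if k = 0 then \<alpha> else if k = 1 then - \<gamma> else 0)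
      else if i = 0 \<and> j = 2 then (if k = 0 then - \<alpha> else if k = 1 then \<gamma> else 0)
      else if i = 2 \<and> j = 1 then (if k = 0 then \<gamma> else if k = 1 then \<beta> else 0)
      else if i = 1 \<and> j = 2 then (if k = 0 then - \<gamma> else if k = 1 then - \<beta> else 0)
      else 0)"

lemma weyl_ric_cong:
  assumes "\<And>i j k. i < n \<Longrightarrow> j < n \<Longrightarrow> k < n \<Longrightarrow> c i j k = c' i j k" "i < n" "j < n"
  shows "weyl_ric n c \<theta> i j = weyl_ric n c' \<theta> i j"
  unfolding weyl_ric_def weyl_coeff_def using assms by (intro sum.cong refl) simp

lemma sum_less_3: "sum f {..<(3::nat)} = f 0 + f 1 + f 2"
  by (simp add: eval_nat_numeral)

text \<open>A finite computation. These five quantities vanish exactly if the symmetrised matrix is a multiple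
  of the identity matrix.\<close>

lemma weyl_ric_adapted:
  fixes \<alpha> \<beta> \<gamma> t defines "W \<equiv> \<lambda>i j. weyl_ric 3 (adapted_coeff \<alpha> \<beta> \<gamma>) t i j"
  shows "W 0 1 + W 1 0 = 2 * (t 0 * t 1 - \<gamma> * (\<alpha> - \<beta>))"
    "W 0 2 + W 2 0 = 2 * t 0 * t 2 - \<alpha> * t 0 - \<gamma> * t 1"
    "W 1 2 + W 2 1 = 2 * t 1 * t 2 - \<beta> * t 1 + \<gamma> * t 0"
    "W 0 0 - W 1 1 = - (\<alpha> + \<beta>) * (\<alpha> - \<beta>) + (\<alpha> - \<beta>) * t 2 + (t 0)\<^sup>2 - (t 1)\<^sup>2"
    "W 1 1 - W 2 2 = - (\<alpha> + \<beta>) * \<beta> + \<beta> * t 2 + (t 1)\<^sup>2 + \<alpha>\<^sup>2 + \<beta>\<^sup>2 - (t 2)\<^sup>2"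
  unfolding W_def weyl_ric_def sum_less_3 weyl_coeff_def adapted_coeff_def
  by (simp_all add: algebra_simps power2_eq_square)


text \<open>Here \<open>k\<close>, \<open>l\<close>, \<open>s\<close> are the values of the Lee form on the frame. If \<open>a \<noteq> b\<close>, the first three equations
  combine to \<open>c\<close> times a positive number, so \<open>c = 0\<close> and one of \<open>k\<close>, \<open>l\<close> vanishes. If the other did not,
  the last two equations would make its square nonpositive; so \<open>k = l = 0\<close>, then
  \<open>s = a + b\<close>, and the last equation becomes \<open>a * b = 0\<close>.\<close>

lemma adapted_system:
  fixes a b c k l s :: real
  assumes e1: "k * l - c * (a - b) = 0"
    and e2: "2 * k * s - a * k - c * l = 0"
    and e3: "2 * l * s - b * l + c * k = 0"
    and e4: "- (a + b) * (a - b) + (a - b) * s + k\<^sup>2 - l\<^sup>2 = 0"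
    and e5: "- (a + b) * b + b * s + l\<^sup>2 + a\<^sup>2 + b\<^sup>2 - s\<^sup>2 = 0"
  shows "a = b \<or> c = 0 \<and> a * b = 0"
proof (rule disjCI)
  assume n: "\<not> (c = 0 \<and> a * b = 0)"
  show "a = b"
  proof (rule ccontr)
    assume ab: "a \<noteq> b"
    have "c * ((a - b)\<^sup>2 + k\<^sup>2 + l\<^sup>2) = 0" using e1 e2 e3 by algebra
    moreover have "(a - b)\<^sup>2 + k\<^sup>2 + l\<^sup>2 > 0" using ab by (simp add: add_pos_nonneg)
    ultimately have c: "c = 0" by simp
    then have kl: "k = 0 \<or> l = 0" using e1 by simp
    have pos: "x = 0" if "x\<^sup>2 + y\<^sup>2 = 0" for x y :: real using that by (simp add: sum_power2_eq_zero_iff)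
    have k: "k = 0"
    proof (rule ccontr)
      assume k: "k \<noteq> 0"
      then have l: "l = 0" using kl by simp
      have a: "a = 2 * s" using e2 k c by auto
      have "s * (3 * s - b) = 0" using e5 l unfolding a by algebra
      then consider "s = 0" | "b = 3 * s" by auto
      then show False
      proof cases
        case 1
        then have "k\<^sup>2 + b\<^sup>2 = 0" using e4 l unfolding a by algebra
        then show False using pos k by blast
      next
        case 2
        then have "k\<^sup>2 + (2 * s)\<^sup>2 = 0" using e4 l unfolding a by algebra
        then show False using pos k by blast
      qed
    qed
    have l: "l = 0"
    proof (rule ccontr)
      assume l: "l \<noteq> 0"
      have b: "b = 2 * s" using e3 l c by auto
      have "s * (3 * s - a) = 0" using e4 e5 k unfolding b by algebra
      then consider "s = 0" | "a = 3 * s" by auto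
      then show False
      proof cases
        case 1
        then have "l\<^sup>2 + a\<^sup>2 = 0" using e4 k unfolding b by algebra
        then show False using pos l by blast
      next
        case 2
        then have "l\<^sup>2 + (2 * s)\<^sup>2 = 0" using e4 k unfolding b by algebra
        then show False using pos l by blast
      qed
    qed
    have "(a - b) * (s - (a + b)) = 0" using e4 k l by algebra
    then have "s = a + b" using ab by simp
    then have "a * b = 0" using e5 l by algebra
    then show False using n c by simp
  qed
qed

lemma (in orthonormal_frame) adapted_weyl_einstein_iff:
  assumes n: "DIM('e) = 3"
    and br: "\<And>i j k. i < 3 \<Longrightarrow> j < 3 \<Longrightarrow> k < 3 \<Longrightarrow> br i j k = adapted_coeff \<alpha> \<beta> \<gamma> i j k"
  shows "admits_left_invariant_weyl_einstein A (conformal_class A g) \<longleftrightarrow> \<alpha> = \<beta> \<or> \<gamma> = 0 \<and> \<alpha> * \<beta> = 0"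
proof
  let ?W = "\<lambda>t i j. weyl_ric 3 (adapted_coeff \<alpha> \<beta> \<gamma>) t i j"
  have W: "weyl_ric DIM('e) br t i j = ?W t i j" if "i < 3" "j < 3" for t i j
    unfolding n by (rule weyl_ric_cong[OF br that])
  {
    assume "admits_left_invariant_weyl_einstein A (conformal_class A g)"
    then obtain t r where "\<And>i j. i < DIM('e) \<Longrightarrow> j < DIM('e) \<Longrightarrow>
      weyl_ric DIM('e) br t i j + weyl_ric DIM('e) br t j i = (if i = j then r else 0)"
      by (rule weyl_einstein_imp) blast
    then have e: "?W t i j + ?W t j i = (if i = j then r else 0)" if "i < 3" "j < 3" for i j
      using W that n by metis
    show "\<alpha> = \<beta> \<or> \<gamma> = 0 \<and> \<alpha> * \<beta> = 0"
      by (rule adapted_system[of "t 0" "t 1" \<gamma> \<alpha> \<beta> "t 2"])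
        (use weyl_ric_adapted[of \<alpha> \<beta> \<gamma> t] e[of 0 1] e[of 0 2] e[of 1 2] e[of 0 0] e[of 1 1] e[of 2 2] in simp_all)
  }
  assume c: "\<alpha> = \<beta> \<or> \<gamma> = 0 \<and> \<alpha> * \<beta> = 0"
  \<comment> \<open>The Lee form vanishes on the ideal; its value on \<open>E 2\<close> is 0 if \<open>\<alpha> = \<beta>\<close> and \<open>\<alpha> + \<beta>\<close> otherwise.\<close>
  obtain s where s: "- (\<alpha> + \<beta>) * (\<alpha> - \<beta>) + (\<alpha> - \<beta>) * s = 0" "- (\<alpha> + \<beta>) * \<beta> + \<beta> * s + \<alpha>\<^sup>2 + \<beta>\<^sup>2 - s\<^sup>2 = 0"
  proof (cases "\<alpha> = \<beta>")
    case True
    then show thesis using that[of 0] by (simp add: power2_eq_square)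
  next
    case False
    then have "\<alpha> * \<beta> = 0" using c by blast
    then show thesis using that[of "\<alpha> + \<beta>"] by (simp add: power2_eq_square algebra_simps)
  qed
  define t where "t = (\<lambda>i. if i = (2::nat) then s else 0)"
  have "\<gamma> * (\<alpha> - \<beta>) = 0" using c by auto
  then have "?W t 0 1 + ?W t 1 0 = 0" "?W t 0 2 + ?W t 2 0 = 0" "?W t 1 2 + ?W t 2 1 = 0"
    "?W t 0 0 = ?W t 1 1" "?W t 1 1 = ?W t 2 2"
    using weyl_ric_adapted[of \<alpha> \<beta> \<gamma> t] s by (simp_all add: t_def)
  then have e: "?W t i j + ?W t j i = (if i = j then 2 * ?W t 0 0 else 0)" if "i < 3" "j < 3" for i j
  proof -
    have "i = 0 \<or> i = 1 \<or> i = 2" "j = 0 \<or> j = 1 \<or> j = 2" using that by auto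
    then show ?thesis using \<open>?W t 0 1 + ?W t 1 0 = 0\<close> \<open>?W t 0 2 + ?W t 2 0 = 0\<close> \<open>?W t 1 2 + ?W t 2 1 = 0\<close>
        \<open>?W t 0 0 = ?W t 1 1\<close> \<open>?W t 1 1 = ?W t 2 2\<close> by (elim disjE) (simp_all add: add.commute)
  qed
  show "admits_left_invariant_weyl_einstein A (conformal_class A g)"
  proof (rule weyl_einstein_if)
    fix i j assume "i < DIM('e)" "j < DIM('e)"
    then have "i < 3" "j < 3" by (simp_all add: n)
    then show "weyl_ric DIM('e) br t i j + weyl_ric DIM('e) br t j i = (if i = j then 2 * ?W t 0 0 else 0)"
      unfolding W[OF \<open>i < 3\<close> \<open>j < 3\<close>] W[OF \<open>j < 3\<close> \<open>i < 3\<close>] by (rule e)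
  qed
qed

section \<open>Adapted frames of solvable metric Lie algebras of dimension three\<close>

text \<open>An orthonormal basis in which \<open>u\<close> and \<open>v\<close> span an abelian ideal and the bracket with \<open>w\<close> acts on it
  with symmetric part diagonal, with entries \<open>\<alpha>\<close> and \<open>\<beta>\<close>, and with antisymmetric part given by \<open>\<gamma>\<close>.\<close>

definition adapted ::
    "('v::real_vector \<Rightarrow> 'v \<Rightarrow> 'v) \<Rightarrow> ('v \<Rightarrow> 'v \<Rightarrow> real) \<Rightarrow> real \<Rightarrow> real \<Rightarrow> real \<Rightarrow> 'v \<Rightarrow> 'v \<Rightarrow> 'v \<Rightarrow> bool" where
  "adapted br ip \<alpha> \<beta> \<gamma> u v w \<longleftrightarrow>
     ip u u = 1 \<and> ip v v = 1 \<and> ip w w = 1 \<and> ip u v = 0 \<and> ip u w = 0 \<and> ip v w = 0 \<and>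
     br u v = 0 \<and> br w u = \<alpha> *\<^sub>R u - \<gamma> *\<^sub>R v \<and> br w v = \<gamma> *\<^sub>R u + \<beta> *\<^sub>R v"

lemma anticommutative_self:
  fixes br :: "'v::real_vector \<Rightarrow> 'v \<Rightarrow> 'v"
  assumes "\<And>x y. br x y = - br y x"
  shows "br z z = 0"
proof -
  have "br z z + br z z = 0" using assms[of z z] by (simp only: eq_neg_iff_add_eq_0)
  then have "2 *\<^sub>R br z z = 0" by (simp only: scaleR_2)
  then show ?thesis by simp
qed

lemma expand_3: "(x :: real ^ 3) = x $ 1 *\<^sub>R axis 1 1 + x $ 2 *\<^sub>R axis 2 1 + x $ 3 *\<^sub>R axis 3 1"
  by (simp add: vec_eq_iff forall_3 axis_def)

lemma bilinear_expand_3: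
  fixes x y :: "real ^ 3"
  assumes "bilinear h"
  shows "h (x $ 1 *\<^sub>R a1 + x $ 2 *\<^sub>R a2 + x $ 3 *\<^sub>R a3) (y $ 1 *\<^sub>R b1 + y $ 2 *\<^sub>R b2 + y $ 3 *\<^sub>R b3) =
    (x $ 1 * y $ 1) *\<^sub>R h a1 b1 + (x $ 1 * y $ 2) *\<^sub>R h a1 b2 + (x $ 1 * y $ 3) *\<^sub>R h a1 b3 +
    (x $ 2 * y $ 1) *\<^sub>R h a2 b1 + (x $ 2 * y $ 2) *\<^sub>R h a2 b2 + (x $ 2 * y $ 3) *\<^sub>R h a2 b3 +
    (x $ 3 * y $ 1) *\<^sub>R h a3 b1 + (x $ 3 * y $ 2) *\<^sub>R h a3 b2 + (x $ 3 * y $ 3) *\<^sub>R h a3 b3"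
  by (simp add: bilinear_ladd[OF assms] bilinear_radd[OF assms] bilinear_lmul[OF assms] bilinear_rmul[OF assms] algebra_simps)

definition frame_map :: "real ^ 3 \<Rightarrow> real ^ 3 \<Rightarrow> real ^ 3 \<Rightarrow> real ^ 3 \<Rightarrow> real ^ 3" where
  "frame_map u v w x = x $ 1 *\<^sub>R u + x $ 2 *\<^sub>R v + x $ 3 *\<^sub>R w"

lemma frame_map_linear: "linear (frame_map u v w)"
  by (rule linearI) (simp_all add: frame_map_def algebra_simps)

lemma frame_map_inner:
  fixes ip :: "real ^ 3 \<Rightarrow> real ^ 3 \<Rightarrow> real"
  assumes "bilinear ip" "\<And>x y. ip x y = ip y x"
    and "ip u u = 1" "ip v v = 1" "ip w w = 1" "ip u v = 0" "ip u w = 0" "ip v w = 0"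
  shows "ip (frame_map u v w x) (frame_map u v w y) = x \<bullet> (y :: real ^ 3)"
  unfolding frame_map_def bilinear_expand_3[OF assms(1)]
  using assms(2)[of v u] assms(2)[of w u] assms(2)[of w v] assms(3-)
  by (simp add: inner_vec_def sum_3)

lemma frame_map_bij:
  fixes ip :: "real ^ 3 \<Rightarrow> real ^ 3 \<Rightarrow> real"
  assumes "bilinear ip" "\<And>x y. ip x y = ip y x"
    and "ip u u = 1" "ip v v = 1" "ip w w = 1" "ip u v = 0" "ip u w = 0" "ip v w = 0"
  shows "bij (frame_map u v w)"
proof -
  have "inj (frame_map u v w)"
    unfolding linear_injective_0[OF frame_map_linear]
  proof (intro allI impI)
    fix x assume z: "frame_map u v w x = 0"
    have "x \<bullet> x = ip (frame_map u v w x) (frame_map u v w x)"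
      using frame_map_inner[OF assms, of x x] by simp
    then show "x = 0" unfolding z using bilinear_lzero[OF assms(1)] by simp
  qed
  then show ?thesis using linear_injective_imp_surjective[OF frame_map_linear] by (simp add: bij_def)
qed

lemma frame_map_bracket:
  assumes "bilinear br" "\<And>x y. br x y = - br y x"
    and "br u v = 0" "br w u = \<alpha> *\<^sub>R u - \<gamma> *\<^sub>R v" "br w v = \<gamma> *\<^sub>R u + \<beta> *\<^sub>R v"
  shows "br (frame_map u v w x) (frame_map u v w y) =
    frame_map u v w (bracket3 0 (vector [\<alpha>, - \<gamma>, 0]) (vector [\<gamma>, \<beta>, 0]) x y)"
proof -
  have z: "br z z = 0" for z by (rule anticommutative_self[of br, OF assms(2)])
  show ?thesis
    unfolding frame_map_def bilinear_expand_3[OF assms(1)] bracket3_def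
    unfolding assms(2)[of v u] assms(2)[of u w] assms(2)[of v w] assms(3-) z
    by (simp add: algebra_simps)
qed

text \<open>The process applied to the standard basis; the vectors that are normalised have a coordinate 1 and
  so are nonzero.\<close>

lemma gram_schmidt_3:
  fixes ip :: "real ^ 3 \<Rightarrow> real ^ 3 \<Rightarrow> real"
  assumes bil: "bilinear ip" and sym: "\<And>x y. ip x y = ip y x" and pos: "\<And>x. x \<noteq> 0 \<Longrightarrow> ip x x > 0"
  obtains u v w where "ip u u = 1" "ip v v = 1" "ip w w = 1" "ip u v = 0" "ip u w = 0" "ip v w = 0"
proof -
  note b = bilinear_ladd[OF bil] bilinear_radd[OF bil] bilinear_lmul[OF bil] bilinear_rmul[OF bil]
    bilinear_lsub[OF bil] bilinear_rsub[OF bil]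
  define nrm where "nrm x = (1 / sqrt (ip x x)) *\<^sub>R x" for x
  have nrm: "ip (nrm x) (nrm x) = 1" if "x \<noteq> 0" for x
    using pos[OF that] by (simp add: nrm_def b)
  define u where "u = nrm (axis 1 1)"
  define v0 where "v0 = axis 2 1 - ip (axis 2 1) u *\<^sub>R u"
  define v where "v = nrm v0"
  define w0 where "w0 = axis 3 1 - ip (axis 3 1) u *\<^sub>R u - ip (axis 3 1) v *\<^sub>R v"
  define w where "w = nrm w0"
  have u: "u $ 2 = 0" "u $ 3 = 0" by (simp_all add: u_def nrm_def axis_def)
  have v0: "v0 $ 2 = 1" "v0 $ 3 = 0" by (simp_all add: v0_def u axis_def)
  have v: "v $ 3 = 0" by (simp add: v_def nrm_def v0)
  have w0: "w0 $ 3 = 1" by (simp add: w0_def u v axis_def)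
  have uu: "ip u u = 1" unfolding u_def by (rule nrm) (simp add: axis_eq_0_iff)
  have vv: "ip v v = 1" unfolding v_def by (rule nrm) (use v0 in auto)
  have ww: "ip w w = 1" unfolding w_def by (rule nrm) (use w0 in auto)
  have "ip u v0 = 0" by (simp add: v0_def b uu sym[of u "axis 2 1"])
  then have uv: "ip u v = 0" by (simp add: v_def nrm_def b)
  have "ip u w0 = 0" by (simp add: w0_def b uu uv sym[of u "axis 3 1"])
  then have uw: "ip u w = 0" by (simp add: w_def nrm_def b)
  have "ip v w0 = 0" by (simp add: w0_def b vv uv sym[of v u] sym[of v "axis 3 1"])
  then have vw: "ip v w = 0" by (simp add: w_def nrm_def b)
  show thesis by (rule that[OF uu vv ww uv uw vw])
qed

text \<open>In terms of the double angle the equation says that a unit vector is orthogonal to \<open>(p, q)\<close>; so the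
  double angle is taken a right angle ahead of the argument of \<open>p + i q\<close>.\<close>

lemma rotation_exists:
  fixes p q :: real
  obtains c s where "c\<^sup>2 + s\<^sup>2 = 1" "p * (c\<^sup>2 - s\<^sup>2) + q * (2 * c * s) = 0"
proof -
  define \<phi> where "\<phi> = (Arg (Complex p q) + pi / 2) / 2"
  have "p = cmod (Complex p q) * cos (Arg (Complex p q))" "q = cmod (Complex p q) * sin (Arg (Complex p q))"
    using rcis_cmod_Arg[of "Complex p q"] by (metis Re_rcis complex.sel(1), metis Im_rcis complex.sel(2))
  moreover have "(cos \<phi>)\<^sup>2 - (sin \<phi>)\<^sup>2 = - sin (Arg (Complex p q))" "2 * cos \<phi> * sin \<phi> = cos (Arg (Complex p q))"
  proof -
    have d: "2 * \<phi> = Arg (Complex p q) + pi / 2" by (simp add: \<phi>_def)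
    show "(cos \<phi>)\<^sup>2 - (sin \<phi>)\<^sup>2 = - sin (Arg (Complex p q))"
      unfolding cos_double[symmetric] d by (simp add: cos_add)
    have "sin (2 * \<phi>) = cos (Arg (Complex p q))" unfolding d by (simp add: sin_add)
    then show "2 * cos \<phi> * sin \<phi> = cos (Arg (Complex p q))" unfolding sin_double by (simp add: ac_simps)
  qed
  ultimately have "p * ((cos \<phi>)\<^sup>2 - (sin \<phi>)\<^sup>2) + q * (2 * cos \<phi> * sin \<phi>) = 0"
    by (metis (no_types, opaque_lifting) add.left_inverse mult.commute mult.left_commute mult_minus_right)
  then show thesis using that[of "cos \<phi>" "sin \<phi>"] by simp
qed


text \<open>An alternating bilinear map factors through the cross product, which sends the pairs of standard basis
  vectors to the standard basis.\<close>

lemma bracket_cross3: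
  fixes br :: "real ^ 3 \<Rightarrow> real ^ 3 \<Rightarrow> real ^ 3"
  assumes bil: "bilinear br" and anti: "\<And>x y. br x y = - br y x"
  shows "br x y = frame_map (br (axis 2 1) (axis 3 1)) (br (axis 3 1) (axis 1 1)) (br (axis 1 1) (axis 2 1)) (cross3 x y)"
proof -
  have z: "br z z = 0" for z by (rule anticommutative_self[of br, OF anti])
  have "br x y = br (x $ 1 *\<^sub>R axis 1 1 + x $ 2 *\<^sub>R axis 2 1 + x $ 3 *\<^sub>R axis 3 1)
      (y $ 1 *\<^sub>R axis 1 1 + y $ 2 *\<^sub>R axis 2 1 + y $ 3 *\<^sub>R axis 3 1)"
    using expand_3[of x] expand_3[of y] by simp
  also have "\<dots> = frame_map (br (axis 2 1) (axis 3 1)) (br (axis 3 1) (axis 1 1)) (br (axis 1 1) (axis 2 1)) (cross3 x y)"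
    unfolding bilinear_expand_3[OF bil] frame_map_def cross3_def
      anti[of "axis 2 1" "axis 1 1"] anti[of "axis 3 1" "axis 2 1"] anti[of "axis 1 1" "axis 3 1"] z
    by (simp add: algebra_simps)
  finally show ?thesis .
qed

text \<open>Write the bracket as \<open>L (cross3 x y)\<close>, where \<open>L\<close> has the columns \<open>L1\<close>, \<open>L2\<close>, \<open>L3\<close>. What is needed
  is a nonzero vector \<open>n\<close> in the kernel of \<open>L\<close> that is orthogonal to its image. The vector \<open>a\<close> of the antisymmetric part of
  \<open>L\<close> is in the kernel by the Jacobi identity, and then orthogonal to the columns because \<open>L\<close> and its
  transpose differ by the cross product with \<open>a\<close>. If \<open>a = 0\<close>, then \<open>L\<close> is symmetric, and the vector \<open>d\<close>
  orthogonal to the image is in the kernel.\<close>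

lemma unit_normal_exists:
  fixes br :: "real ^ 3 \<Rightarrow> real ^ 3 \<Rightarrow> real ^ 3"
  assumes bil: "bilinear br" and anti: "\<And>x y. br x y = - br y x"
    and Jac: "\<And>x y z. br (br x y) z + br (br y z) x + br (br z x) y = 0"
    and d: "d \<noteq> 0" "\<And>x y. d \<bullet> br x y = 0"
  obtains n where "norm n = 1" "\<And>x y. n \<bullet> br x y = 0" "\<And>x y. cross3 x y = n \<Longrightarrow> br x y = 0"
proof -
  define L1 where "L1 = br (axis 2 1) (axis 3 1)"
  define L2 where "L2 = br (axis 3 1) (axis 1 1)"
  define L3 where "L3 = br (axis 1 1) (axis 2 1)"
  define L where "L = frame_map L1 L2 L3"
  have lin: "linear L" unfolding L_def by (rule frame_map_linear)
  have br: "br x y = L (cross3 x y)" for x y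
    unfolding L_def L1_def L2_def L3_def by (rule bracket_cross3[OF bil anti])
  note intro = that
  have *: thesis if n: "n \<noteq> 0" "n \<bullet> L1 = 0" "n \<bullet> L2 = 0" "n \<bullet> L3 = 0" "L n = 0" for n
  proof (rule intro[of "(1 / norm n) *\<^sub>R n"])
    show "norm ((1 / norm n) *\<^sub>R n) = 1" using n(1) by simp
    show "((1 / norm n) *\<^sub>R n) \<bullet> br x y = 0" for x y
      unfolding br L_def frame_map_def by (simp add: inner_add_right n)
    show "br x y = 0" if "cross3 x y = (1 / norm n) *\<^sub>R n" for x y
      unfolding br that linear_scale[OF lin] n(5) by simp
  qed
  define a :: "real ^ 3" where "a = vector [L2 $ 3 - L3 $ 2, L3 $ 1 - L1 $ 3, L1 $ 2 - L2 $ 1]"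
  have "br (br (axis 1 1) (axis 2 1)) (axis 3 1) + br (br (axis 2 1) (axis 3 1)) (axis 1 1) + br (br (axis 3 1) (axis 1 1)) (axis 2 1) = L (- a)"
    unfolding L1_def[symmetric] L2_def[symmetric] L3_def[symmetric] br[of L1] br[of L2] br[of L3] linear_add[OF lin, symmetric]
    by (rule arg_cong[where f = L]) (simp add: cross3_def a_def vec_eq_iff forall_3 axis_def)
  then have La: "L a = 0" using Jac[of "axis 1 1" "axis 2 1" "axis 3 1"] by (simp add: linear_neg[OF lin])
  then have La3: "a $ 1 * L1 $ i + a $ 2 * L2 $ i + a $ 3 * L3 $ i = 0" for i
    unfolding L_def frame_map_def by (simp add: vec_eq_iff)
  show thesis
  proof (cases "a = 0")
    case False
    have "a \<bullet> L1 = 0" "a \<bullet> L2 = 0" "a \<bullet> L3 = 0"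
      using La3[of 1] La3[of 2] La3[of 3] by (simp_all add: inner_vec_def sum_3 a_def algebra_simps)
    then show thesis using *[OF False] La by blast
  next
    case True
    then have s: "L2 $ 3 = L3 $ 2" "L3 $ 1 = L1 $ 3" "L1 $ 2 = L2 $ 1"
      by (simp_all add: a_def vec_eq_iff forall_3)
    have dL: "d \<bullet> L1 = 0" "d \<bullet> L2 = 0" "d \<bullet> L3 = 0" unfolding L1_def L2_def L3_def by (rule d(2))+
    then have "L d = 0"
      unfolding L_def frame_map_def using s by (simp add: vec_eq_iff forall_3 inner_vec_def sum_3 algebra_simps)
    then show thesis using *[OF d(1) dL] by blast
  qed
qed

text \<open>For a positively oriented orthonormal basis \<open>u0, v0\<close> of the plane orthogonal to \<open>n\<close> the cross product is \<open>n\<close>, so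
  the plane is an abelian ideal. Rotating \<open>u0\<close> and \<open>v0\<close> changes the off-diagonal entry of the symmetric
  part by the formula solved in \<open>rotation_exists\<close>.\<close>

lemma adapted_exists_euclidean:
  fixes br :: "real ^ 3 \<Rightarrow> real ^ 3 \<Rightarrow> real ^ 3"
  assumes bil: "bilinear br" and anti: "\<And>x y. br x y = - br y x"
    and Jac: "\<And>x y z. br (br x y) z + br (br y z) x + br (br z x) y = 0"
    and d: "d \<noteq> 0" "\<And>x y. d \<bullet> br x y = 0"
  obtains \<alpha> \<beta> \<gamma> u v w where "adapted br (\<bullet>) \<alpha> \<beta> \<gamma> u v w"
proof -
  obtain n where n: "norm n = 1" "\<And>x y. n \<bullet> br x y = 0" and z: "\<And>x y. cross3 x y = n \<Longrightarrow> br x y = 0"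
    by (rule unit_normal_exists[OF assms]) blast
  have nn: "n \<bullet> n = 1" using n(1) by (simp add: norm_eq_1)
  obtain u0 where u0: "norm u0 = 1" "orthogonal n u0"
  proof -
    have "n \<noteq> 0" using n(1) by auto
    then obtain S where S: "n \<in> S" "0 \<notin> S" "pairwise orthogonal S" "finite S" "card S = DIM(real ^ 3)"
      by (rule vector_in_orthogonal_basis) blast
    have "card (S - {n}) \<noteq> 0" using S by (simp add: card_Diff_singleton)
    then obtain x where x: "x \<in> S" "x \<noteq> n" by (metis card.empty Diff_iff ex_in_conv insertCI)
    then have "orthogonal n x" "x \<noteq> 0" using S by (auto simp: pairwise_def)
    then show thesis using that[of "(1 / norm x) *\<^sub>R x"] by (simp add: orthogonal_def)
  qed
  have uu0: "u0 \<bullet> u0 = 1" and nu0: "n \<bullet> u0 = 0" using u0 by (auto simp: norm_eq_1 orthogonal_def)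
  define v0 where "v0 = cross3 n u0"
  have v0: "v0 \<bullet> v0 = 1" "n \<bullet> v0 = 0" "u0 \<bullet> v0 = 0"
    using nn uu0 nu0 by (simp_all add: v0_def dot_cross inner_commute dot_cross_self)
  have c0: "cross3 u0 v0 = n"
    unfolding v0_def using uu0 nu0 by (simp add: Lagrange inner_commute)
  define p q r s where "p = u0 \<bullet> br n u0" and "q = v0 \<bullet> br n u0" and "r = u0 \<bullet> br n v0" and "s = v0 \<bullet> br n v0"
  obtain k l where kl: "k\<^sup>2 + l\<^sup>2 = 1" and rot: "(q + r) * (k\<^sup>2 - l\<^sup>2) + (s - p) * (2 * k * l) = 0"
    by (rule rotation_exists) blast
  define u where "u = k *\<^sub>R u0 + l *\<^sub>R v0"
  define v where "v = k *\<^sub>R v0 - l *\<^sub>R u0"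
  have i: "v0 \<bullet> u0 = 0" "u0 \<bullet> n = 0" "v0 \<bullet> n = 0" using v0 nu0 by (simp_all add: inner_commute)
  have on: "u \<bullet> u = 1" "v \<bullet> v = 1" "n \<bullet> n = 1" "u \<bullet> v = 0" "u \<bullet> n = 0" "v \<bullet> n = 0"
    using kl uu0 v0 i nn
    by (simp_all add: u_def v_def inner_add_left inner_add_right inner_diff_left inner_diff_right power2_eq_square algebra_simps)
  have bij: "bij (frame_map u v n)"
    by (rule frame_map_bij[of "(\<bullet>)"]) (use on in \<open>auto simp: inner_commute bilinear_conv_bounded_bilinear bounded_bilinear_inner\<close>)
  have ex: "x = (u \<bullet> x) *\<^sub>R u + (v \<bullet> x) *\<^sub>R v + (n \<bullet> x) *\<^sub>R n" for x
  proof -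
    obtain y where y: "x = frame_map u v n y" using bij by (metis bij_pointE)
    have "u \<bullet> x = y $ 1" "v \<bullet> x = y $ 2" "n \<bullet> x = y $ 3"
      unfolding y frame_map_def using on by (simp_all add: inner_add_right inner_commute)
    then show ?thesis using y by (simp add: frame_map_def)
  qed
  have "cross3 u v = (k\<^sup>2 + l\<^sup>2) *\<^sub>R cross3 u0 v0"
    by (simp add: u_def v_def cross3_def vec_eq_iff forall_3 power2_eq_square algebra_simps)
  then have uv: "br u v = 0" using z c0 kl by simp
  have "u \<bullet> br n v + v \<bullet> br n u = 0"
    using rot unfolding p_def q_def r_def s_def
    by (simp add: u_def v_def bilinear_radd[OF bil] bilinear_rsub[OF bil] bilinear_rmul[OF bil]
        inner_add_left inner_add_right inner_diff_left inner_diff_right power2_eq_square algebra_simps)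
  then have g: "v \<bullet> br n u = - (u \<bullet> br n v)" by simp
  have "br n u = (u \<bullet> br n u) *\<^sub>R u - (u \<bullet> br n v) *\<^sub>R v"
    using ex[of "br n u"] n(2) g by simp
  moreover have "br n v = (u \<bullet> br n v) *\<^sub>R u + (v \<bullet> br n v) *\<^sub>R v"
    using ex[of "br n v"] n(2) by simp
  ultimately have "adapted br (\<bullet>) (u \<bullet> br n u) (v \<bullet> br n v) (u \<bullet> br n v) u v n"
    unfolding adapted_def using on uv by blast
  then show thesis by (rule that)
qed

text \<open>An orthonormal basis for \<open>ip\<close> carries the standard inner product to \<open>ip\<close>; the bracket is pulled back
  along it.\<close>

lemma adapted_exists:
  fixes br :: "real ^ 3 \<Rightarrow> real ^ 3 \<Rightarrow> real ^ 3"
  assumes bil: "bilinear br" and anti: "\<And>x y. br x y = - br y x"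
    and Jac: "\<And>x y z. br (br x y) z + br (br y z) x + br (br z x) y = 0"
    and ip: "bilinear ip" "\<And>x y. ip x y = ip y x" "\<And>x. x \<noteq> 0 \<Longrightarrow> ip x x > 0"
    and d: "d \<noteq> 0" "\<And>x y. d \<bullet> br x y = 0"
  obtains \<alpha> \<beta> \<gamma> u v w where "adapted br ip \<alpha> \<beta> \<gamma> u v w"
proof -
  obtain e1 e2 e3 where e: "ip e1 e1 = 1" "ip e2 e2 = 1" "ip e3 e3 = 1" "ip e1 e2 = 0" "ip e1 e3 = 0" "ip e2 e3 = 0"
    by (rule gram_schmidt_3[OF ip]) blast
  define T where "T = frame_map e1 e2 e3"
  have T: "bij T" "linear T" and Tip: "\<And>x y. ip (T x) (T y) = x \<bullet> y"
    unfolding T_def using frame_map_bij[OF ip(1,2) e] frame_map_linear frame_map_inner[OF ip(1,2) e] by blast+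
  define S where "S = inv T"
  have TS: "T (S x) = x" and ST: "S (T x) = x" for x
    using T(1) by (simp_all add: S_def bij_is_surj surj_f_inv_f bij_is_inj)
  have S: "linear S" unfolding S_def by (rule inj_linear_imp_inv_linear[OF T(2) bij_is_inj[OF T(1)]])
  define b where "b x y = S (br (T x) (T y))" for x y
  have "bilinear b"
    unfolding bilinear_def b_def
    by (auto intro!: linearI simp: linear_add[OF T(2)] linear_scale[OF T(2)] linear_add[OF S] linear_scale[OF S]
        bilinear_ladd[OF bil] bilinear_radd[OF bil] bilinear_lmul[OF bil] bilinear_rmul[OF bil])
  moreover have "b x y = - b y x" for x y
    unfolding b_def using anti[of "T x" "T y"] linear_neg[OF S] by metis
  moreover have "b (b x y) z + b (b y z) x + b (b z x) y = 0" for x y z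
    unfolding b_def TS linear_add[OF S, symmetric] Jac by (rule linear_0[OF S])
  moreover obtain d' where "d' \<noteq> 0" "\<And>x y. d' \<bullet> b x y = 0"
  proof -
    define d' :: "real ^ 3" where "d' = vector [d \<bullet> e1, d \<bullet> e2, d \<bullet> e3]"
    have dT: "d' \<bullet> x = d \<bullet> T x" for x
      by (simp add: d'_def T_def frame_map_def inner_vec_def sum_3 algebra_simps)
    have "d' \<bullet> S d \<noteq> 0" using d(1) by (simp add: dT TS)
    then have "d' \<noteq> 0" by auto
    moreover have "d' \<bullet> b x y = 0" for x y by (simp add: dT b_def TS d(2))
    ultimately show thesis by (rule that)
  qed
  ultimately obtain \<alpha> \<beta> \<gamma> u v w where a: "adapted b (\<bullet>) \<alpha> \<beta> \<gamma> u v w"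
    by (rule adapted_exists_euclidean)
  have brT: "br (T x) (T y) = T (b x y)" for x y by (simp add: b_def TS)
  have "adapted br ip \<alpha> \<beta> \<gamma> (T u) (T v) (T w)"
    using a unfolding adapted_def Tip brT
    by (auto simp: linear_add[OF T(2)] linear_diff[OF T(2)] linear_scale[OF T(2)] linear_0[OF T(2)])
  then show thesis by (rule that)
qed

section \<open>The metric Lie algebra in coordinates\<close>

context lie_grp
begin

definition coord_bracket :: "'e \<Rightarrow> 'e \<Rightarrow> 'e" where
  "coord_bracket u v = inv lfield (vbracket (lfield u) (lfield v))"

lemma lfield_bracket: "lfield (coord_bracket u v) = vbracket (lfield u) (lfield v)"
proof -
  have "vbracket (lfield u) (lfield v) \<in> range lfield"
    using vbracket_left_invariant[OF lfield_left_invariant lfield_left_invariant] lfield_bij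
    by (simp add: bij_betw_def)
  then show ?thesis unfolding coord_bracket_def by (rule f_inv_into_f)
qed

lemma lfield_eq_iff: "lfield u = lfield v \<longleftrightarrow> u = v"
  using lfield_inj by (auto dest: injD)

lemma lfield_smul: "lfield (c *\<^sub>R v) = (\<lambda>f p. c * lfield v f p)"
  by (simp add: lfield_scale vmult_def)

lemma lfield_plus: "lfield (u + v) = (\<lambda>f p. lfield u f p + lfield v f p)"
  by (simp add: lfield_add vadd_def)

lemma coord_bracket_anti: "coord_bracket u v = - coord_bracket v u"
proof -
  have "lfield (coord_bracket u v) = lfield ((-1) *\<^sub>R coord_bracket v u)"
    unfolding lfield_smul lfield_bracket by (intro ext) (simp add: vbracket_def)
  then show ?thesis by (simp add: lfield_eq_iff)
qed

lemma coord_bracket_bilinear: "bilinear coord_bracket"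
proof -
  have a: "coord_bracket (u + u') v = coord_bracket u v + coord_bracket u' v" for u u' v
  proof -
    have "lfield (coord_bracket (u + u') v) = lfield (coord_bracket u v + coord_bracket u' v)"
      unfolding lfield_plus lfield_bracket vbracket_def
      using vf_add[OF lfield_vf vf_smooth[OF lfield_vf] vf_smooth[OF lfield_vf]] by (intro ext) simp
    then show ?thesis by (simp add: lfield_eq_iff)
  qed
  have s: "coord_bracket (c *\<^sub>R u) v = c *\<^sub>R coord_bracket u v" for c u v
  proof -
    have "lfield (coord_bracket (c *\<^sub>R u) v) = lfield (c *\<^sub>R coord_bracket u v)"
      unfolding lfield_smul lfield_bracket vbracket_def
      using vf_cmult[OF lfield_vf vf_smooth[OF lfield_vf]] by (intro ext) (simp add: right_diff_distrib)
    then show ?thesis by (simp add: lfield_eq_iff)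
  qed
  have l: "linear (\<lambda>u. coord_bracket u v)" for v by (rule linearI) (simp_all add: a s)
  have "linear (coord_bracket v)" for v
    using linear_compose_neg[OF l[of v]] coord_bracket_anti[of v] by (metis (no_types, lifting) ext)
  then show ?thesis using l by (simp add: bilinear_def)
qed

lemma coord_bracket_Jacobi:
  "coord_bracket (coord_bracket x y) z + coord_bracket (coord_bracket y z) x + coord_bracket (coord_bracket z x) y = 0"
proof -
  have d: "lfield w (\<lambda>p. lfield u (lfield v f) p - lfield v (lfield u f) p) q
      = lfield w (lfield u (lfield v f)) q - lfield w (lfield v (lfield u f)) q" for u v w f q
    by (rule vf_diff[OF lfield_vf vf_smooth[OF lfield_vf] vf_smooth[OF lfield_vf]])
  have "lfield (coord_bracket (coord_bracket x y) z + coord_bracket (coord_bracket y z) x + coord_bracket (coord_bracket z x) y) = lfield 0"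
    unfolding lfield_plus lfield_bracket lfield_zero by (intro ext) (simp add: vbracket_def d)
  then show ?thesis by (simp add: lfield_eq_iff)
qed

text \<open>If no hyperplane contained all brackets, the derived algebra would be the whole algebra, and so
  would every further term of the derived series.\<close>

lemma solvable_imp_normal:
  assumes "la_solvable (lie_algebra_of A)"
  obtains d where "d \<noteq> 0" "\<And>x y. d \<bullet> coord_bracket x y = 0"
proof (rule ccontr)
  assume "\<not> thesis"
  then have no: "\<And>d. d \<noteq> 0 \<Longrightarrow> \<exists>x y. d \<bullet> coord_bracket x y \<noteq> 0" using that by blast
  let ?L = "lie_algebra_of A"
  let ?C = "LI"
  have C: "la_subspace ?L ?C"
    unfolding la_subspace_def lie_algebra_of_def
    using vadd_left_invariant vscale_left_invariant lfield_left_invariant[of 0] by (simp add: lfield_zero)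
  have W: "?C \<subseteq> W" if sub: "la_subspace ?L W" and br: "\<And>X Y. X \<in> ?C \<Longrightarrow> Y \<in> ?C \<Longrightarrow> vbracket X Y \<in> W" for W
  proof -
    define S where "S = {v. lfield v \<in> W}"
    have "subspace S"
      using sub unfolding la_subspace_def lie_algebra_of_def
      by (auto simp: subspace_def S_def lfield_zero lfield_add lfield_scale)
    have "coord_bracket x y \<in> S" for x y
      unfolding S_def using br[OF lfield_left_invariant lfield_left_invariant] by (simp add: lfield_bracket)
    note inS = this
    have "\<not> dim S < DIM('e)"
    proof
      assume "dim S < DIM('e)"
      then obtain d where d: "d \<noteq> 0" "\<And>y. y \<in> span S \<Longrightarrow> orthogonal d y"
        by (rule orthogonal_to_subspace_exists) blast
      obtain x y where "d \<bullet> coord_bracket x y \<noteq> 0" using no[OF d(1)] by blast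
      then show False using d(2)[OF span_base[OF inS[of x y]]] by (simp add: orthogonal_def)
    qed
    then have "dim S = DIM('e)" using dim_subset_UNIV[of S] by simp
    then have "span S = UNIV" using dim_eq_full[of S] by simp
    then have "S = UNIV" using \<open>subspace S\<close> span_eq_iff[of S] by simp
    then show ?thesis using left_invariant_eq_lfield unfolding S_def by blast
  qed
  have "la_derived ?L ?C = ?C"
  proof
    show "la_derived ?L ?C \<subseteq> ?C"
      unfolding la_derived_def using C vbracket_left_invariant by (auto simp: lie_algebra_of_def)
    show "?C \<subseteq> la_derived ?L ?C"
      unfolding la_derived_def using W by (fastforce simp: lie_algebra_of_def)
  qed
  then have "(la_derived ?L ^^ k) ?C = ?C" for k by (induction k) auto
  moreover have "la_carrier ?L = ?C" "la_zero ?L = (\<lambda>f p. 0)" by (simp_all add: lie_algebra_of_def)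
  ultimately have "?C = {\<lambda>f p. 0}" using assms unfolding la_solvable_def by metis
  moreover have "lfield (SOME b. b \<in> Basis) \<noteq> (\<lambda>f p. 0)"
    using lfield_eq_iff[of "SOME b. b \<in> Basis" 0] lfield_zero nonzero_Basis[OF SOME_Basis] by auto
  ultimately show False using lfield_left_invariant by blast
qed

end

context lie_grp_metric
begin

definition coord_inner :: "'e \<Rightarrow> 'e \<Rightarrow> real" where
  "coord_inner u v = g (lfield u) (lfield v) 0"

lemma coord_inner_sym: "coord_inner u v = coord_inner v u"
  unfolding coord_inner_def by (rule metric_sym[OF lfield_vf lfield_vf])

lemma coord_inner_bilinear: "bilinear coord_inner"
proof -
  have l: "linear (\<lambda>u. coord_inner u v)" for v
    by (rule linearI) (simp_all add: coord_inner_def lfield_add lfield_scale metric_add_left metric_mult_left lfield_vf smooth_fun_const)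
  moreover have "linear (coord_inner v)" for v
    using l[of v] coord_inner_sym[of v] by (metis (no_types, lifting) ext)
  ultimately show ?thesis by (simp add: bilinear_def)
qed

lemma coord_inner_pos: "v \<noteq> 0 \<Longrightarrow> coord_inner v v > 0"
  unfolding coord_inner_def using lfield_nonzero[of v] metric_pos[OF lfield_vf] by blast

end

locale lie_grp_metric_3 = lie_grp_metric A g
  for A :: "('g::{t2_space,second_countable_topology,group_add}, real ^ 3) atlas" and g
begin

lemma adapted_iff:
  assumes a: "adapted coord_bracket coord_inner \<alpha> \<beta> \<gamma> u v w"
  shows "admits_left_invariant_weyl_einstein A (conformal_class A g) \<longleftrightarrow> \<alpha> = \<beta> \<or> \<gamma> = 0 \<and> \<alpha> * \<beta> = 0"
proof -
  define e where "e = (\<lambda>i. if i = (0::nat) then u else if i = 1 then v else w)"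
  have e: "e 0 = u" "e 1 = v" "e 2 = w" "e (Suc 0) = v" by (simp_all add: e_def)
  have on: "coord_inner (e i) (e j) = (if i = j then 1 else 0)" if "i < 3" "j < 3" for i j
  proof -
    have "i = 0 \<or> i = 1 \<or> i = 2" "j = 0 \<or> j = 1 \<or> j = 2" using that by auto
    then show ?thesis
      using a coord_inner_sym[of v u] coord_inner_sym[of w u] coord_inner_sym[of w v] unfolding adapted_def
      by (elim disjE) (simp_all add: e)
  qed
  interpret F: orthonormal_frame A g "\<lambda>i. lfield (e i)"
    by unfold_locales (use lfield_left_invariant on in \<open>auto simp: coord_inner_def\<close>)
  have br: "F.br i j k = coord_inner (coord_bracket (e i) (e j)) (e k)" for i j k
    by (simp add: F.br_def coord_inner_def lfield_bracket)
  have z: "coord_bracket x x = 0" for x by (rule anticommutative_self[of coord_bracket, OF coord_bracket_anti])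
  note bil = bilinear_ladd[OF coord_inner_bilinear] bilinear_lsub[OF coord_inner_bilinear]
    bilinear_lmul[OF coord_inner_bilinear] bilinear_lneg[OF coord_inner_bilinear] bilinear_lzero[OF coord_inner_bilinear]
  have cb: "coord_bracket u v = 0" "coord_bracket v u = 0"
    "coord_bracket w u = \<alpha> *\<^sub>R u - \<gamma> *\<^sub>R v" "coord_bracket u w = \<gamma> *\<^sub>R v - \<alpha> *\<^sub>R u"
    "coord_bracket w v = \<gamma> *\<^sub>R u + \<beta> *\<^sub>R v" "coord_bracket v w = - \<gamma> *\<^sub>R u - \<beta> *\<^sub>R v"
    using a coord_bracket_anti[of v u] coord_bracket_anti[of u w] coord_bracket_anti[of v w] by (simp_all add: adapted_def)
  have ip: "coord_inner u u = 1" "coord_inner v v = 1" "coord_inner w w = 1" "coord_inner u v = 0" "coord_inner v u = 0"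
    "coord_inner u w = 0" "coord_inner w u = 0" "coord_inner v w = 0" "coord_inner w v = 0"
    using a coord_inner_sym[of v u] coord_inner_sym[of w u] coord_inner_sym[of w v] by (simp_all add: adapted_def)
  have "F.br i j k = adapted_coeff \<alpha> \<beta> \<gamma> i j k" if "i < 3" "j < 3" "k < 3" for i j k
  proof -
    have "i = 0 \<or> i = 1 \<or> i = 2" "j = 0 \<or> j = 1 \<or> j = 2" "k = 0 \<or> k = 1 \<or> k = 2" using that by auto
    then show ?thesis
      unfolding br by (elim disjE) (simp_all add: e z cb ip bil adapted_coeff_def)
  qed
  then show ?thesis by (intro F.adapted_weyl_einstein_iff) simp
qed

lemma adapted_frame_exists:
  assumes "la_solvable (lie_algebra_of A)"
  obtains \<alpha> \<beta> \<gamma> u v w where "adapted coord_bracket coord_inner \<alpha> \<beta> \<gamma> u v w"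
proof -
  obtain d where d: "d \<noteq> 0" "\<And>x y. d \<bullet> coord_bracket x y = 0"
    using solvable_imp_normal[OF assms] by blast
  show thesis
    by (rule adapted_exists[OF coord_bracket_bilinear coord_bracket_anti coord_bracket_Jacobi
          coord_inner_bilinear coord_inner_sym coord_inner_pos d]) (auto intro: that)
qed

text \<open>An adapted basis identifies either side with \<open>real ^ 3\<close> carrying the standard inner product and a
  bracket that depends only on \<open>\<alpha>\<close>, \<open>\<beta>\<close>, \<open>\<gamma>\<close>. Conversely an isomorphism carries the adapted
  basis of the model back.\<close>

lemma metric_isomorphic_iff_adapted:
  fixes br :: "real ^ 3 \<Rightarrow> real ^ 3 \<Rightarrow> real ^ 3" and ip :: "real ^ 3 \<Rightarrow> real ^ 3 \<Rightarrow> real"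
  assumes br: "bilinear br" "\<And>x y. br x y = - br y x" and ip: "bilinear ip" "\<And>x y. ip x y = ip y x"
    and m: "adapted br ip \<alpha> \<beta> \<gamma> m1 m2 m3"
  shows "metric_isomorphic (metric_lie_algebra_of A g) (model br ip) \<longleftrightarrow>
    (\<exists>u v w. adapted coord_bracket coord_inner \<alpha> \<beta> \<gamma> u v w)" (is "?L \<longleftrightarrow> ?R")
proof
  have sel: "la_carrier (metric_lie_algebra_of A g) = LI"
    "la_add (metric_lie_algebra_of A g) = vadd" "la_scale (metric_lie_algebra_of A g) = (\<lambda>c. vmult (\<lambda>p. c))"
    "la_bracket (metric_lie_algebra_of A g) = vbracket" "la_inner (metric_lie_algebra_of A g) = (\<lambda>X Y. g X Y 0)"
    "la_carrier (model br ip) = UNIV" "la_add (model br ip) = (+)" "la_scale (model br ip) = (*\<^sub>R)"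
    "la_bracket (model br ip) = br" "la_inner (model br ip) = ip"
    by (simp_all add: metric_lie_algebra_of_def lie_algebra_of_def lie_algebra.extend_def metric_lie_algebra.fields_def model_def)
  {
    assume ?L
    then obtain F where bij: "bij_betw F (LI) UNIV"
      and F: "\<And>X Y. X \<in> LI \<Longrightarrow> Y \<in> LI \<Longrightarrow>
         F (vadd X Y) = F X + F Y \<and> F (vbracket X Y) = br (F X) (F Y) \<and> ip (F X) (F Y) = g X Y 0"
      and Fs: "\<And>c X. X \<in> LI \<Longrightarrow> F (vmult (\<lambda>p. c) X) = c *\<^sub>R F X"
      unfolding metric_isomorphic_def sel by blast
    define G where "G x = F (lfield x)" for x
    have "bij G" unfolding G_def using bij_betw_trans[OF lfield_bij bij] by (simp add: comp_def)
    have G: "G (x + y) = G x + G y" "G (coord_bracket x y) = br (G x) (G y)" "ip (G x) (G y) = coord_inner x y"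
      "G (c *\<^sub>R x) = c *\<^sub>R G x" for x y c
      unfolding G_def lfield_add lfield_bracket lfield_scale coord_inner_def
      using F[OF lfield_left_invariant lfield_left_invariant] Fs[OF lfield_left_invariant] by auto
    then have linG: "linear G" by (intro linearI)
    obtain u v w where uvw: "G u = m1" "G v = m2" "G w = m3" using \<open>bij G\<close> by (metis bij_pointE)
    have eq: "x = y" if "G x = G y" for x y using that \<open>bij G\<close> by (metis bij_is_inj injD)
    note lin = linear_add[OF linG] linear_diff[OF linG] linear_scale[OF linG] linear_0[OF linG]
    have "coord_bracket u v = 0" "coord_bracket w u = \<alpha> *\<^sub>R u - \<gamma> *\<^sub>R v" "coord_bracket w v = \<gamma> *\<^sub>R u + \<beta> *\<^sub>R v"
      by (rule eq, use m in \<open>simp add: adapted_def G(2) lin uvw\<close>)+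
    moreover have "coord_inner x y = ip (G x) (G y)" for x y by (simp add: G(3))
    ultimately have "adapted coord_bracket coord_inner \<alpha> \<beta> \<gamma> u v w"
      using m by (simp add: adapted_def uvw)
    then show ?R by blast
  }
  assume ?R
  then obtain u v w where a: "adapted coord_bracket coord_inner \<alpha> \<beta> \<gamma> u v w" by blast
  define T where "T = frame_map m1 m2 m3"
  define S where "S = frame_map u v w"
  have T: "bij T" "linear T" "\<And>x y. ip (T x) (T y) = x \<bullet> y"
    "\<And>x y. br (T x) (T y) = T (bracket3 0 (vector [\<alpha>, - \<gamma>, 0]) (vector [\<gamma>, \<beta>, 0]) x y)"
    using m unfolding T_def adapted_def
    by (auto simp: frame_map_linear intro!: frame_map_bij[OF ip] frame_map_inner[OF ip] frame_map_bracket[OF br])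
  have S: "bij S" "linear S" "\<And>x y. coord_inner (S x) (S y) = x \<bullet> y"
    "\<And>x y. coord_bracket (S x) (S y) = S (bracket3 0 (vector [\<alpha>, - \<gamma>, 0]) (vector [\<gamma>, \<beta>, 0]) x y)"
    using a unfolding S_def adapted_def
    by (auto simp: frame_map_linear intro!: frame_map_bij[OF coord_inner_bilinear coord_inner_sym]
        frame_map_inner[OF coord_inner_bilinear coord_inner_sym] frame_map_bracket[OF coord_bracket_bilinear coord_bracket_anti])
  define H where "H x = lfield (S x)" for x
  have bH: "bij_betw H UNIV LI"
    unfolding H_def using bij_betw_trans[OF S(1) lfield_bij] by (simp add: comp_def)
  define F where "F X = T (inv H X)" for X
  have HF: "F (H x) = T x" for x
    unfolding F_def using bH by (simp add: bij_betw_def)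
  have HX: "\<exists>x. X = H x" if "X \<in> LI" for X
    using bH that unfolding bij_betw_def by blast
  have "bij_betw F (LI) UNIV"
    unfolding F_def using bij_betw_trans[OF bij_betw_inv_into[OF bH] T(1)] by (simp add: comp_def)
  moreover have "F (vadd X Y) = F X + F Y \<and> F (vbracket X Y) = br (F X) (F Y) \<and> ip (F X) (F Y) = g X Y 0"
    if XY: "X \<in> LI" "Y \<in> LI" for X Y
  proof -
    obtain x y where xy: "X = H x" "Y = H y" using HX XY by metis
    have "vadd X Y = H (x + y)" "vbracket X Y = H (bracket3 0 (vector [\<alpha>, - \<gamma>, 0]) (vector [\<gamma>, \<beta>, 0]) x y)"
      "g X Y 0 = x \<bullet> y"
      unfolding xy H_def by (simp_all add: linear_add[OF S(2)] lfield_add S(4)[symmetric] lfield_bracket S(3)[unfolded coord_inner_def])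
    then show ?thesis by (simp add: xy HF linear_add[OF T(2)] T(3,4))
  qed
  moreover have "F (vmult (\<lambda>p. c) X) = c *\<^sub>R F X" if X: "X \<in> LI" for c X
  proof -
    obtain x where x: "X = H x" using HX X by metis
    have "vmult (\<lambda>p. c) X = H (c *\<^sub>R x)" unfolding x H_def by (simp add: linear_scale[OF S(2)] lfield_scale)
    then show ?thesis by (simp add: x HF linear_scale[OF T(2)])
  qed
  ultimately show ?L unfolding metric_isomorphic_def sel by blast
qed

end

section \<open>The models\<close>

lemma bracket3_bilinear: "bilinear (bracket3 a b c)"
  unfolding bilinear_def by (auto intro!: linearI simp: bracket3_def algebra_simps)

lemma bracket3_anti: "bracket3 a b c u v = - bracket3 a b c v u"
  by (simp add: bracket3_def algebra_simps)

lemma abelian3_eq: "abelian3 = bracket3 0 0 0"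
  by (intro ext) (simp add: abelian3_def bracket3_def)

lemmas model_brackets = abelian3_eq R_Id_R2_def so2_R2_def g_t_def

lemma model_inner_bilinear:
  "bilinear (g_nu \<nu>)" "bilinear (g_munu \<mu> \<nu>)" "bilinear (h_munu \<mu> \<nu>)" "bilinear (m_nu \<nu>)"
  unfolding bilinear_def
  by (auto intro!: linearI simp: g_nu_def g_munu_def h_munu_def m_nu_def sym_prod_def field_simps)

lemma model_inner_sym:
  "g_nu \<nu> x y = g_nu \<nu> y x" "g_munu \<mu> \<nu> x y = g_munu \<mu> \<nu> y x" "h_munu \<mu> \<nu> x y = h_munu \<mu> \<nu> y x" "m_nu \<nu> x y = m_nu \<nu> y x"
  by (simp_all add: g_nu_def g_munu_def h_munu_def m_nu_def sym_prod_def field_simps)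

lemma model_frame_abelian: "adapted abelian3 (\<bullet>) 0 0 0 (axis 1 1) (axis 2 1) (axis 3 1)"
  unfolding adapted_def by (simp add: abelian3_def inner_axis_axis)

lemma model_frame_Id:
  assumes "\<alpha> \<noteq> 0"
  shows "adapted R_Id_R2 (g_nu (1 / \<alpha>\<^sup>2)) \<alpha> \<alpha> 0 (vector [1, 0, 0]) (vector [0, 1, 0]) (vector [0, 0, \<alpha>])"
  using assms unfolding adapted_def
  by (simp add: R_Id_R2_def bracket3_def g_nu_def sym_prod_def vec_eq_iff forall_3 axis_def power2_eq_square)

lemma model_frame_so2:
  assumes "\<gamma> \<noteq> 0"
  shows "adapted so2_R2 (g_munu 1 (1 / \<gamma>\<^sup>2)) 0 0 \<gamma> (vector [1, 0, 0]) (vector [0, 1, 0]) (vector [0, 0, \<gamma>])"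
  using assms unfolding adapted_def
  by (simp add: so2_R2_def bracket3_def g_munu_def sym_prod_def vec_eq_iff forall_3 axis_def power2_eq_square)

text \<open>The bracket with \<open>z\<close> is the identity plus the map that sends \<open>x\<close> to \<open>y - x\<close> and \<open>y\<close> to
  \<open>y - t x\<close>, which is skew for \<open>h_munu t\<close>. The vector \<open>y - x\<close> is
  orthogonal to \<open>x\<close> and has the square norm \<open>t - 1\<close>.\<close>

lemma model_frame_g_t:
  assumes "\<alpha> \<noteq> 0" "\<gamma> \<noteq> 0"
  defines "t \<equiv> 1 + \<gamma>\<^sup>2 / \<alpha>\<^sup>2"
  shows "adapted (g_t t) (h_munu t (1 / \<alpha>\<^sup>2)) \<alpha> \<alpha> \<gamma>
    (vector [1, 0, 0]) (vector [\<alpha> / \<gamma>, - \<alpha> / \<gamma>, 0]) (vector [0, 0, \<alpha>])"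
  using assms(1,2) unfolding adapted_def t_def
  by (simp add: g_t_def bracket3_def h_munu_def sym_prod_def vec_eq_iff forall_3 axis_def power2_eq_square field_simps)

text \<open>The bracket with \<open>z\<close> has the eigenvectors \<open>y\<close> and \<open>2 x - y\<close> with eigenvalues 2 and 0. They are
  orthogonal for \<open>m_nu\<close>, and the second has the square norm 3. The two statements list them in the two orders.\<close>

lemma model_frame_g_0:
  assumes "\<alpha> \<noteq> 0"
  shows "adapted (g_t 0) (m_nu (4 / \<alpha>\<^sup>2)) \<alpha> 0 0
      (vector [0, 1, 0]) (vector [2 / sqrt 3, - 1 / sqrt 3, 0]) (vector [0, 0, \<alpha> / 2])"
    "adapted (g_t 0) (m_nu (4 / \<alpha>\<^sup>2)) 0 \<alpha> 0
      (vector [2 / sqrt 3, - 1 / sqrt 3, 0]) (vector [0, 1, 0]) (vector [0, 0, \<alpha> / 2])"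
  using assms unfolding adapted_def
  by (simp_all add: g_t_def bracket3_def m_nu_def sym_prod_def vec_eq_iff forall_3 axis_def power2_eq_square field_simps)

theorem theorem7p2:
  fixes A :: "('g::{t2_space,second_countable_topology,group_add}, real ^ 3) atlas"
    and g :: "'g vfield \<Rightarrow> 'g vfield \<Rightarrow> 'g \<Rightarrow> real"
  assumes "solvable_lie_group A"
    and "simply_connected (UNIV :: 'g set)"
    and "left_invariant_metric A g"
  shows "admits_left_invariant_weyl_einstein A (conformal_class A g) \<longleftrightarrow>
     metric_isomorphic (metric_lie_algebra_of A g) (model abelian3 (\<bullet>)) \<or>
     (\<exists>\<nu>>0. metric_isomorphic (metric_lie_algebra_of A g) (model R_Id_R2 (g_nu \<nu>))) \<or>
     (\<exists>\<nu>>0. metric_isomorphic (metric_lie_algebra_of A g) (model so2_R2 (g_munu 1 \<nu>))) \<or>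
     (\<exists>t>1. \<exists>\<nu>>0. metric_isomorphic (metric_lie_algebra_of A g) (model (g_t t) (h_munu t \<nu>))) \<or>
     (\<exists>\<nu>>0. metric_isomorphic (metric_lie_algebra_of A g) (model (g_t 0) (m_nu \<nu>)))"
proof -
  interpret lie_grp_metric_3 A g
    using assms unfolding solvable_lie_group_def by unfold_locales auto
  let ?M = "metric_lie_algebra_of A g"
  define P where "P \<alpha> \<beta> \<gamma> \<longleftrightarrow> (\<exists>u v w. adapted coord_bracket coord_inner \<alpha> \<beta> \<gamma> u v w)" for \<alpha> \<beta> \<gamma>
  have W: "admits_left_invariant_weyl_einstein A (conformal_class A g) \<longleftrightarrow> \<alpha> = \<beta> \<or> \<gamma> = 0 \<and> \<alpha> * \<beta> = 0"
    if "P \<alpha> \<beta> \<gamma>" for \<alpha> \<beta> \<gamma>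
    using that adapted_iff unfolding P_def by blast
  have inner: "bilinear ((\<bullet>) :: real ^ 3 \<Rightarrow> real ^ 3 \<Rightarrow> real)"
    by (simp add: bilinear_conv_bounded_bilinear bounded_bilinear_inner)
  have m1: "metric_isomorphic ?M (model abelian3 (\<bullet>)) \<longleftrightarrow> P 0 0 0"
    unfolding P_def
    by (rule metric_isomorphic_iff_adapted[OF _ _ inner inner_commute model_frame_abelian])
      (simp_all add: model_brackets bracket3_bilinear, rule bracket3_anti)
  have m2: "metric_isomorphic ?M (model R_Id_R2 (g_nu (1 / \<alpha>\<^sup>2))) \<longleftrightarrow> P \<alpha> \<alpha> 0" if "\<alpha> \<noteq> 0" for \<alpha>
    unfolding P_def
    by (rule metric_isomorphic_iff_adapted[OF _ _ model_inner_bilinear(1) model_inner_sym(1) model_frame_Id[OF that]])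
      (simp_all add: model_brackets bracket3_bilinear, rule bracket3_anti)
  have m3: "metric_isomorphic ?M (model so2_R2 (g_munu 1 (1 / \<gamma>\<^sup>2))) \<longleftrightarrow> P 0 0 \<gamma>" if "\<gamma> \<noteq> 0" for \<gamma>
    unfolding P_def
    by (rule metric_isomorphic_iff_adapted[OF _ _ model_inner_bilinear(2) model_inner_sym(2) model_frame_so2[OF that]])
      (simp_all add: model_brackets bracket3_bilinear, rule bracket3_anti)
  have m4: "metric_isomorphic ?M (model (g_t (1 + \<gamma>\<^sup>2 / \<alpha>\<^sup>2)) (h_munu (1 + \<gamma>\<^sup>2 / \<alpha>\<^sup>2) (1 / \<alpha>\<^sup>2))) \<longleftrightarrow> P \<alpha> \<alpha> \<gamma>"
    if "\<alpha> \<noteq> 0" "\<gamma> \<noteq> 0" for \<alpha> \<gamma>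
    unfolding P_def
    by (rule metric_isomorphic_iff_adapted[OF _ _ model_inner_bilinear(3) model_inner_sym(3) model_frame_g_t[OF that]])
      (simp_all add: model_brackets bracket3_bilinear, rule bracket3_anti)
  have m5: "metric_isomorphic ?M (model (g_t 0) (m_nu (4 / \<alpha>\<^sup>2))) \<longleftrightarrow> P \<alpha> 0 0" if "\<alpha> \<noteq> 0" for \<alpha>
    unfolding P_def
    by (rule metric_isomorphic_iff_adapted[OF _ _ model_inner_bilinear(4) model_inner_sym(4) model_frame_g_0(1)[OF that]])
      (simp_all add: model_brackets bracket3_bilinear, rule bracket3_anti)
  have m6: "metric_isomorphic ?M (model (g_t 0) (m_nu (4 / \<alpha>\<^sup>2))) \<longleftrightarrow> P 0 \<alpha> 0" if "\<alpha> \<noteq> 0" for \<alpha>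
    unfolding P_def
    by (rule metric_isomorphic_iff_adapted[OF _ _ model_inner_bilinear(4) model_inner_sym(4) model_frame_g_0(2)[OF that]])
      (simp_all add: model_brackets bracket3_bilinear, rule bracket3_anti)
  show ?thesis (is "_ \<longleftrightarrow> ?C1 \<or> ?C2 \<or> ?C3 \<or> ?C4 \<or> ?C5")
  proof
    assume ad: "admits_left_invariant_weyl_einstein A (conformal_class A g)"
    obtain \<alpha> \<beta> \<gamma> where P: "P \<alpha> \<beta> \<gamma>"
      using adapted_frame_exists assms(1) unfolding P_def solvable_lie_group_def by metis
    consider "\<alpha> = 0" "\<beta> = 0" "\<gamma> = 0" | "\<alpha> \<noteq> 0" "\<beta> = \<alpha>" "\<gamma> = 0" | "\<alpha> = 0" "\<beta> = 0" "\<gamma> \<noteq> 0"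
      | "\<alpha> \<noteq> 0" "\<beta> = \<alpha>" "\<gamma> \<noteq> 0" | "\<alpha> \<noteq> 0" "\<beta> = 0" "\<gamma> = 0" | "\<alpha> = 0" "\<beta> \<noteq> 0" "\<gamma> = 0"
      using W[OF P] ad by auto
    then show "?C1 \<or> ?C2 \<or> ?C3 \<or> ?C4 \<or> ?C5"
    proof cases
      case 1
      then show ?thesis using m1 P by simp
    next
      case 2
      then have "1 / \<alpha>\<^sup>2 > 0" "metric_isomorphic ?M (model R_Id_R2 (g_nu (1 / \<alpha>\<^sup>2)))" using m2 P by auto
      then show ?thesis by blast
    next
      case 3
      then have "1 / \<gamma>\<^sup>2 > 0" "metric_isomorphic ?M (model so2_R2 (g_munu 1 (1 / \<gamma>\<^sup>2)))" using m3 P by auto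
      then show ?thesis by blast
    next
      case 4
      then have "1 / \<alpha>\<^sup>2 > 0" "1 + \<gamma>\<^sup>2 / \<alpha>\<^sup>2 > 1"
        "metric_isomorphic ?M (model (g_t (1 + \<gamma>\<^sup>2 / \<alpha>\<^sup>2)) (h_munu (1 + \<gamma>\<^sup>2 / \<alpha>\<^sup>2) (1 / \<alpha>\<^sup>2)))" using m4 P by auto
      then show ?thesis by blast
    next
      case 5
      then have "4 / \<alpha>\<^sup>2 > 0" "metric_isomorphic ?M (model (g_t 0) (m_nu (4 / \<alpha>\<^sup>2)))" using m5 P by auto
      then show ?thesis by blast
    next
      case 6
      then have "4 / \<beta>\<^sup>2 > 0" "metric_isomorphic ?M (model (g_t 0) (m_nu (4 / \<beta>\<^sup>2)))" using m6 P by auto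
      then show ?thesis by blast
    qed
  next
    assume "?C1 \<or> ?C2 \<or> ?C3 \<or> ?C4 \<or> ?C5"
    then consider ?C1 | ?C2 | ?C3 | ?C4 | ?C5 by blast
    then show "admits_left_invariant_weyl_einstein A (conformal_class A g)"
    proof cases
      case 1
      then show ?thesis using m1 W by simp
    next
      case 2
      then obtain \<nu> where \<nu>: "\<nu> > 0" "metric_isomorphic ?M (model R_Id_R2 (g_nu \<nu>))" by blast
      have "1 / (1 / sqrt \<nu>)\<^sup>2 = \<nu>" using \<nu>(1) by (simp add: power_divide)
      then have "P (1 / sqrt \<nu>) (1 / sqrt \<nu>) 0" using m2[of "1 / sqrt \<nu>"] \<nu> by simp
      then show ?thesis using W by blast
    next
      case 3
      then obtain \<nu> where \<nu>: "\<nu> > 0" "metric_isomorphic ?M (model so2_R2 (g_munu 1 \<nu>))" by blast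
      have "1 / (1 / sqrt \<nu>)\<^sup>2 = \<nu>" using \<nu>(1) by (simp add: power_divide)
      then have "P 0 0 (1 / sqrt \<nu>)" using m3[of "1 / sqrt \<nu>"] \<nu> by simp
      then show ?thesis using W by blast
    next
      case 4
      then obtain t \<nu> where \<nu>: "t > 1" "\<nu> > 0" "metric_isomorphic ?M (model (g_t t) (h_munu t \<nu>))" by blast
      have 1: "1 / (1 / sqrt \<nu>)\<^sup>2 = \<nu>" using \<nu>(2) by (simp add: power_divide)
      have 2: "1 + (sqrt ((t - 1) / \<nu>))\<^sup>2 / (1 / sqrt \<nu>)\<^sup>2 = t"
        using \<nu>(1,2) by (simp add: power_divide)
      have "P (1 / sqrt \<nu>) (1 / sqrt \<nu>) (sqrt ((t - 1) / \<nu>))"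
        using m4[of "1 / sqrt \<nu>" "sqrt ((t - 1) / \<nu>)"] \<nu> unfolding 1 2 by simp
      then show ?thesis using W by blast
    next
      case 5
      then obtain \<nu> where \<nu>: "\<nu> > 0" "metric_isomorphic ?M (model (g_t 0) (m_nu \<nu>))" by blast
      have "4 / (2 / sqrt \<nu>)\<^sup>2 = \<nu>" using \<nu>(1) by (simp add: power_divide)
      then have "P (2 / sqrt \<nu>) 0 0" using m5[of "2 / sqrt \<nu>"] \<nu> by simp
      then show ?thesis using W by simp
    qed
  qed
qed

end
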